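(* Let $Y$ be a metric space homeomorphic to $\mathbb{R}^2$ with locally finite $\mathcal{H}^2$-measure. Let $p,q\in(1,\infty)$ with $p^{-1}+q^{-1}=1$. Let $Q\subset Y$ be homeomorphic to $[0,1]^2$, and let $A,B,C,D\subset Q$ be the continua, in cyclic order, corresponding to the four sides of $[0,1]^2$ under such a homeomorphism. Let $\Gamma_1(Q)$ be the family of curves connecting $A$ and $C$ in $Q$, and $\Gamma_2(Q)$ the family of curves connecting $B$ and $D$ in $Q$. Then $$\left(\operatorname{Mod}_p\Gamma_1(Q)\right)^{1/p}\left(\operatorname{Mod}_q\Gamma_2(Q)\right)^{1/q}\ \ge\ \frac{\pi}{4}.$$
   Context: Hausdorff measure normalization: $\mathcal{H}^2(A):=\lim_{\delta\to0}\mathcal{H}^2_\delta(A)$, where $\mathcal{H}^2_\delta(A):=\frac{\pi}{4}\inf\{\sum_i\operatorname{diam}(A_i)^2: A\subset\bigcup_iA_i,\ \operatorname{diam}(A_i)<\delta\}$, the infimum being over countable covers. A curve is a continuous map $\gamma:I\to Y$ from a compact nonempty interval $I\subset\mathbb{R}$; a curve in $Q$ is one with image in $Q$. Modulus: for $1\le r<\infty$ and a family $\Gamma$ of curves in $Y$, a Borel function $\rho:Y\to[0,\infty]$ is admissible for $\Gamma$ if $\int_\gamma\rho\,ds\ge1$ for each rectifiable $\gamma\in\Gamma$ ($ds$ denotes arc length), and $\operatorname{Mod}_r(\Gamma):=\inf\int_Y\rho^r\,d\mathcal{H}^2$ over all admissible $\rho$. *)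

theory Defs
  imports "HOL-Analysis.Analysis"
begin

section \<open>Two-dimensional Hausdorff measure\<close>

text \<open>The library's \<open>diameter\<close> is real-valued and unspecified on unbounded sets.\<close>

definition ediam :: "'a::metric_space set \<Rightarrow> ennreal" where
  "ediam S = (SUP x\<in>S. SUP y\<in>S. ennreal (dist x y))"

text \<open>Finite covers are included, since sets in the sequence \<open>C\<close> may be empty.\<close>

definition hausdorff2_pre :: "real \<Rightarrow> 'a::metric_space set \<Rightarrow> ennreal" where
  "hausdorff2_pre \<delta> S = ennreal (pi / 4) *
     (INF C\<in>{C :: nat \<Rightarrow> 'a set. S \<subseteq> (\<Union>i. C i) \<and> (\<forall>i. ediam (C i) < ennreal \<delta>)}.
        \<Sum>i. (ediam (C i))\<^sup>2)"

definition hausdorff2_outer :: "'a::metric_space set \<Rightarrow> ennreal" where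
  "hausdorff2_outer S = Lim (at_right 0) (\<lambda>\<delta>. hausdorff2_pre \<delta> S)"

text \<open>
  \<open>measure_of\<close> returns the zero measure if its last argument is not a measure on the
  given sets; \<open>emeasure_hausdorff2\<close> below shows that this does not happen here.
\<close>

definition hausdorff2 :: "'a::metric_space measure" where
  "hausdorff2 = measure_of UNIV (sets borel) hausdorff2_outer"

definition locally_finite_measure :: "'a::topological_space measure \<Rightarrow> bool" where
  "locally_finite_measure M \<longleftrightarrow> (\<forall>x. \<exists>U. open U \<and> x \<in> U \<and> emeasure M U < \<infinity>)"


section \<open>Curves, arc length and modulus\<close>

text \<open>
  A triple \<open>(a, b, \<gamma>)\<close> with \<open>a \<le> b\<close> stands for the curve \<open>\<gamma>\<close> restricted to \<open>[a, b]\<close>; the values of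
  \<open>\<gamma>\<close> outside of \<open>[a, b]\<close> are irrelevant.
\<close>

type_synonym 'a curve = "real \<times> real \<times> (real \<Rightarrow> 'a)"

definition curve_length :: "real \<Rightarrow> real \<Rightarrow> (real \<Rightarrow> 'a::metric_space) \<Rightarrow> ennreal" where
  "curve_length a b \<gamma> =
     (SUP ts\<in>{ts. sorted ts \<and> set ts \<subseteq> {a..b}}.
        \<Sum>i<length ts - 1. ennreal (dist (\<gamma> (ts ! i)) (\<gamma> (ts ! Suc i))))"

text \<open>
  The choice of \<open>t\<close> does not matter: \<open>\<gamma>\<close> is constant between any two such parameters.
\<close>

definition arclength_param :: "real \<Rightarrow> real \<Rightarrow> (real \<Rightarrow> 'a::metric_space) \<Rightarrow> real \<Rightarrow> 'a" where
  "arclength_param a b \<gamma> s = \<gamma> (SOME t. t \<in> {a..b} \<and> curve_length a t \<gamma> = ennreal s)"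

text \<open>Meaningful for rectifiable curves only.\<close>

definition line_integral ::
    "('a::metric_space \<Rightarrow> ennreal) \<Rightarrow> real \<Rightarrow> real \<Rightarrow> (real \<Rightarrow> 'a) \<Rightarrow> ennreal" where
  "line_integral \<rho> a b \<gamma> =
     (\<integral>\<^sup>+ s \<in> {0..enn2real (curve_length a b \<gamma>)}. \<rho> (arclength_param a b \<gamma> s) \<partial>lborel)"

definition admissible :: "'a::metric_space curve set \<Rightarrow> ('a \<Rightarrow> ennreal) \<Rightarrow> bool" where
  "admissible \<Gamma> \<rho> \<longleftrightarrow> \<rho> \<in> borel_measurable borel \<and>
     (\<forall>(a, b, \<gamma>)\<in>\<Gamma>. curve_length a b \<gamma> < \<infinity> \<longrightarrow> 1 \<le> line_integral \<rho> a b \<gamma>)"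

text \<open>Only used for positive exponents, so that \<open>\<infinity>\<close> to the power \<open>r\<close> is \<open>\<infinity>\<close>.\<close>

definition ennreal_powr :: "ennreal \<Rightarrow> real \<Rightarrow> ennreal" where
  "ennreal_powr x r = (if x = \<infinity> then \<infinity> else ennreal (enn2real x powr r))"

definition modulus :: "real \<Rightarrow> 'a::metric_space curve set \<Rightarrow> ennreal" where
  "modulus r \<Gamma> = (INF \<rho>\<in>{\<rho>. admissible \<Gamma> \<rho>}. \<integral>\<^sup>+ x. ennreal_powr (\<rho> x) r \<partial>hausdorff2)"

definition curves_connecting :: "'a::metric_space set \<Rightarrow> 'a set \<Rightarrow> 'a set \<Rightarrow> 'a curve set" where
  "curves_connecting Q E F = {(a, b, \<gamma>). a \<le> b \<and> continuous_on {a..b} \<gamma> \<and> \<gamma> ` {a..b} \<subseteq> Q \<and>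
     (\<gamma> a \<in> E \<and> \<gamma> b \<in> F \<or> \<gamma> a \<in> F \<and> \<gamma> b \<in> E)}"


section \<open>The Hausdorff measure is a Borel measure\<close>

lemma ediam_empty [simp]: "ediam {} = 0"
  by (simp add: ediam_def bot_ennreal)

lemma ediam_mono: "S \<subseteq> T \<Longrightarrow> ediam S \<le> ediam T"
  unfolding ediam_def by (intro SUP_mono) (metis SUP_subset_mono order_refl subsetD)

lemma dist_le_ediam: "x \<in> S \<Longrightarrow> y \<in> S \<Longrightarrow> ennreal (dist x y) \<le> ediam S"
  unfolding ediam_def by (rule SUP_upper2[of x], assumption, rule SUP_upper2[of y]) auto

lemma hausdorff2_pre_antimono:
  "\<delta> \<le> \<delta>' \<Longrightarrow> hausdorff2_pre \<delta>' S \<le> hausdorff2_pre \<delta> S"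
  unfolding hausdorff2_pre_def
  by (intro mult_left_mono INF_superset_mono) (auto intro: less_le_trans ennreal_leI)

lemma hausdorff2_outer_SUP:
  "hausdorff2_outer S = (SUP \<delta>\<in>{0<..}. hausdorff2_pre \<delta> S)" (is "_ = ?R")
  and tendsto_hausdorff2_outer:
  "((\<lambda>\<delta>. hausdorff2_pre \<delta> S) \<longlongrightarrow> hausdorff2_outer S) (at_right 0)"
proof -
  have *: "((\<lambda>\<delta>. hausdorff2_pre \<delta> S) \<longlongrightarrow> ?R) (at_right 0)"
  proof (rule order_tendstoI)
    fix a assume "a < ?R"
    then obtain d where d: "d > 0" "a < hausdorff2_pre d S"
      by (auto simp: less_SUP_iff)
    have "eventually (\<lambda>\<delta>. \<delta> < d) (at_right 0)"
      using d(1) by (auto simp: eventually_at_right_field)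
    then show "eventually (\<lambda>\<delta>. a < hausdorff2_pre \<delta> S) (at_right 0)"
      by eventually_elim (meson d(2) hausdorff2_pre_antimono less_imp_le less_le_trans)
  next
    fix a assume a: "a > ?R"
    have "eventually (\<lambda>\<delta>::real. \<delta> > 0) (at_right 0)"
      by (simp add: eventually_at_right_less)
    then show "eventually (\<lambda>\<delta>. hausdorff2_pre \<delta> S < a) (at_right 0)"
      by eventually_elim (metis SUP_upper a greaterThan_iff le_less_trans)
  qed
  then show "hausdorff2_outer S = ?R"
    unfolding hausdorff2_outer_def by (intro tendsto_Lim) auto
  with * show "((\<lambda>\<delta>. hausdorff2_pre \<delta> S) \<longlongrightarrow> hausdorff2_outer S) (at_right 0)"
    by simp
qed

lemma hausdorff2_pre_eq_outer_measure:
  "hausdorff2_pre \<delta> S = ennreal (pi / 4) *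
     outer_measure (Pow UNIV) (\<lambda>C. if ediam C < ennreal \<delta> \<or> C = {} then (ediam C)\<^sup>2 else \<infinity>) S"
  if "\<delta> > 0"
proof -
  let ?f = "\<lambda>C::'a set. if ediam C < ennreal \<delta> \<or> C = {} then (ediam C)\<^sup>2 else \<infinity>"
  have pos: "positive (Pow UNIV) ?f"
    by (auto simp: positive_def)
  have inc: "increasing (Pow UNIV) ?f"
    unfolding increasing_def
    by (auto intro!: power_mono intro: ediam_mono dest: le_less_trans[OF ediam_mono])
  interpret ring_of_sets UNIV "Pow (UNIV :: 'a set)"
    by (rule ring_of_sets_Pow)
  have "(INF C\<in>{C :: nat \<Rightarrow> 'a set. S \<subseteq> (\<Union>i. C i) \<and> (\<forall>i. ediam (C i) < ennreal \<delta>)}.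
        \<Sum>i. (ediam (C i))\<^sup>2) = outer_measure (Pow UNIV) ?f S"
  proof (rule antisym)
    show "(INF C\<in>{C :: nat \<Rightarrow> 'a set. S \<subseteq> (\<Union>i. C i) \<and> (\<forall>i. ediam (C i) < ennreal \<delta>)}.
        \<Sum>i. (ediam (C i))\<^sup>2) \<le> outer_measure (Pow UNIV) ?f S"
      unfolding outer_measure_def
    proof (rule INF_greatest)
      fix C :: "nat \<Rightarrow> 'a set"
      assume C: "C \<in> {A. range A \<subseteq> Pow UNIV \<and> disjoint_family A \<and> S \<subseteq> \<Union> (range A)}"
      show "(INF C\<in>{C :: nat \<Rightarrow> 'a set. S \<subseteq> (\<Union>i. C i) \<and> (\<forall>i. ediam (C i) < ennreal \<delta>)}.
        \<Sum>i. (ediam (C i))\<^sup>2) \<le> (\<Sum>i. ?f (C i))"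
      proof (cases "\<forall>i. ediam (C i) < ennreal \<delta>")
        case True
        then show ?thesis using C by (intro INF_lower2[of C]) auto
      next
        case False
        then obtain i where "\<not> ediam (C i) < ennreal \<delta>" by blast
        moreover have "C i \<noteq> {}" using calculation that by auto
        ultimately have "?f (C i) = \<infinity>" by simp
        moreover have "?f (C i) \<le> (\<Sum>i. ?f (C i))"
          using sum_le_suminf[of "\<lambda>i. ?f (C i)" "{i}"] by simp
        ultimately show ?thesis by (simp add: top.extremum_unique)
      qed
    qed
    show "outer_measure (Pow UNIV) ?f S \<le>
       (INF C\<in>{C :: nat \<Rightarrow> 'a set. S \<subseteq> (\<Union>i. C i) \<and> (\<forall>i. ediam (C i) < ennreal \<delta>)}.
        \<Sum>i. (ediam (C i))\<^sup>2)"
    proof (rule INF_greatest)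
      fix C :: "nat \<Rightarrow> 'a set"
      assume C: "C \<in> {C. S \<subseteq> (\<Union>i. C i) \<and> (\<forall>i. ediam (C i) < ennreal \<delta>)}"
      then show "outer_measure (Pow UNIV) ?f S \<le> (\<Sum>i. (ediam (C i))\<^sup>2)"
        using outer_measure_le[OF pos inc, of C S] by auto
    qed
  qed
  then show ?thesis unfolding hausdorff2_pre_def by simp
qed

lemma outer_measure_space_hausdorff2_pre:
  "outer_measure_space (Pow UNIV) (hausdorff2_pre \<delta>)" if "\<delta> > 0"
proof -
  let ?f = "\<lambda>C::'a set. if ediam C < ennreal \<delta> \<or> C = {} then (ediam C)\<^sup>2 else \<infinity>"
  have pos: "positive (Pow UNIV) ?f"
    by (auto simp: positive_def)
  have inc: "increasing (Pow UNIV) ?f"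
    unfolding increasing_def
    by (auto intro!: power_mono intro: ediam_mono dest: le_less_trans[OF ediam_mono])
  interpret ring_of_sets UNIV "Pow (UNIV :: 'a set)"
    by (rule ring_of_sets_Pow)
  have "outer_measure_space (Pow UNIV) (outer_measure (Pow UNIV) ?f)"
    by (rule outer_measure_space_outer_measure[OF pos inc])
  then show ?thesis
    unfolding outer_measure_space_def positive_def increasing_def countably_subadditive_def
      hausdorff2_pre_eq_outer_measure[OF that]
    by (auto intro!: mult_left_mono)
qed

lemma outer_measure_space_hausdorff2_outer:
  "outer_measure_space (Pow UNIV) hausdorff2_outer"
proof -
  have 0: "hausdorff2_pre d {} = 0" if "d > 0" for d
    using outer_measure_space_hausdorff2_pre[OF that]
    by (auto simp: outer_measure_space_def positive_def)
  have 1: "hausdorff2_pre d A \<le> hausdorff2_pre d B" if "d > 0" "A \<subseteq> B" for d and A B :: "'a set"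
    using outer_measure_space_hausdorff2_pre[OF that(1)] that(2)
    by (auto simp: outer_measure_space_def increasing_def)
  have 2: "hausdorff2_pre d (\<Union>i. A i) \<le> (\<Sum>i. hausdorff2_pre d (A i))"
    if "d > 0" "disjoint_family A" for d and A :: "nat \<Rightarrow> 'a set"
    using outer_measure_space_hausdorff2_pre[OF that(1)] that(2)
    by (auto simp: outer_measure_space_def countably_subadditive_def)
  show ?thesis
    unfolding outer_measure_space_def positive_def increasing_def countably_subadditive_def
  proof (intro conjI ballI allI impI)
    show "hausdorff2_outer ({} :: 'a set) = 0"
      by (auto simp: hausdorff2_outer_SUP 0 bot_ennreal[symmetric] intro!: SUP_eq_const)
    show "hausdorff2_outer A \<le> hausdorff2_outer B" if "A \<subseteq> B" for A B :: "'a set"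
      unfolding hausdorff2_outer_SUP using 1[OF _ that] by (intro SUP_mono) auto
    show "hausdorff2_outer (\<Union>i. A i) \<le> (\<Sum>i. hausdorff2_outer (A i))"
      if "disjoint_family A" for A :: "nat \<Rightarrow> 'a set"
    proof -
      have "hausdorff2_pre d (\<Union>i. A i) \<le> (\<Sum>i. hausdorff2_outer (A i))" if "d > 0" for d
      proof -
        have "(\<Sum>i. hausdorff2_pre d (A i)) \<le> (\<Sum>i. hausdorff2_outer (A i))"
          using that by (intro suminf_le) (auto simp: hausdorff2_outer_SUP intro!: SUP_upper)
        with 2[OF that \<open>disjoint_family A\<close>] show ?thesis by (rule order_trans)
      qed
      then show ?thesis
        by (subst hausdorff2_outer_SUP) (auto intro!: SUP_least)
    qed
  qed
qed

lemma hausdorff2_outer_mono: "S \<subseteq> T \<Longrightarrow> hausdorff2_outer S \<le> hausdorff2_outer T"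
  using outer_measure_space_hausdorff2_outer
  by (auto simp: outer_measure_space_def increasing_def)

lemma hausdorff2_outer_empty [simp]: "hausdorff2_outer {} = 0"
  using outer_measure_space_hausdorff2_outer
  by (auto simp: outer_measure_space_def positive_def)

lemma hausdorff2_outer_Un: "hausdorff2_outer (S \<union> T) \<le> hausdorff2_outer S + hausdorff2_outer T"
proof -
  interpret ring_of_sets UNIV "Pow (UNIV :: 'a set)"
    by (rule ring_of_sets_Pow)
  have "subadditive (Pow UNIV) (hausdorff2_outer :: 'a set \<Rightarrow> _)"
    using outer_measure_space_hausdorff2_outer
    by (metis countably_subadditive_subadditive outer_measure_space_def)
  then have "hausdorff2_outer (S \<union> (T - S)) \<le> hausdorff2_outer S + hausdorff2_outer (T - S)"
    by (rule subadditiveD) auto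
  also have "\<dots> \<le> hausdorff2_outer S + hausdorff2_outer T"
    by (intro add_left_mono hausdorff2_outer_mono) auto
  finally show ?thesis by (simp add: Un_Diff_cancel)
qed

lemma hausdorff2_outer_UN:
  "hausdorff2_outer (\<Union>i. A i) \<le> (\<Sum>i::nat. hausdorff2_outer (A i))"
proof -
  have "hausdorff2_outer (\<Union>i. A i) = hausdorff2_outer (\<Union>i. disjointed A i)"
    by (simp add: UN_disjointed_eq)
  also have "\<dots> \<le> (\<Sum>i. hausdorff2_outer (disjointed A i))"
    using outer_measure_space_hausdorff2_outer disjoint_family_disjointed[of A]
    by (auto simp: outer_measure_space_def countably_subadditive_def)
  also have "\<dots> \<le> (\<Sum>i. hausdorff2_outer (A i))"
    by (intro suminf_le hausdorff2_outer_mono disjointed_subset) auto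
  finally show ?thesis .
qed

lemma hausdorff2_pre_separated:
  assumes \<delta>: "0 < \<delta>" and sep: "\<And>x y. x \<in> S \<Longrightarrow> y \<in> T \<Longrightarrow> \<delta> \<le> dist x y"
  shows "hausdorff2_pre \<delta> S + hausdorff2_pre \<delta> T \<le> hausdorff2_pre \<delta> (S \<union> T)"
proof -
  let ?G = "\<lambda>S :: 'a set. INF C\<in>{C :: nat \<Rightarrow> 'a set. S \<subseteq> (\<Union>i. C i) \<and> (\<forall>i. ediam (C i) < ennreal \<delta>)}.
        \<Sum>i. (ediam (C i))\<^sup>2"
  have "?G S + ?G T \<le> ?G (S \<union> T)"
  proof (rule INF_greatest)
    fix C :: "nat \<Rightarrow> 'a set"
    assume C: "C \<in> {C. S \<union> T \<subseteq> (\<Union>i. C i) \<and> (\<forall>i. ediam (C i) < ennreal \<delta>)}"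
    define D where "D U i = (if C i \<inter> U = {} then {} else C i)" for U i
    have D: "?G U \<le> (\<Sum>i. (ediam (D U i))\<^sup>2)" if "U \<subseteq> S \<union> T" for U
    proof (rule INF_lower, safe del: UnE)
      fix x assume "x \<in> U"
      then obtain i where "x \<in> C i" using \<open>U \<subseteq> S \<union> T\<close> C by blast
      with \<open>x \<in> U\<close> show "x \<in> (\<Union>i. D U i)" by (auto simp: D_def)
    next
      show "ediam (D U i) < ennreal \<delta>" for i using C \<delta> by (simp add: D_def)
    qed
    have *: "(ediam (D S i))\<^sup>2 + (ediam (D T i))\<^sup>2 \<le> (ediam (C i))\<^sup>2" for i
    proof (cases "C i \<inter> S = {} \<or> C i \<inter> T = {}")
      case True then show ?thesis by (auto simp: D_def)
    next
      case False
      then obtain x y where "x \<in> C i" "x \<in> S" "y \<in> C i" "y \<in> T" by blast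
      then have "ennreal \<delta> \<le> ediam (C i)"
        using sep[of x y] dist_le_ediam[of x "C i" y] by (meson ennreal_leI order_trans)
      then show ?thesis using C by (auto simp: not_less[symmetric])
    qed
    have "?G S + ?G T \<le> (\<Sum>i. (ediam (D S i))\<^sup>2) + (\<Sum>i. (ediam (D T i))\<^sup>2)"
      by (intro add_mono D) auto
    also have "\<dots> = (\<Sum>i. (ediam (D S i))\<^sup>2 + (ediam (D T i))\<^sup>2)"
      by (intro suminf_add) auto
    also have "\<dots> \<le> (\<Sum>i. (ediam (C i))\<^sup>2)"
      by (intro suminf_le *) auto
    finally show "?G S + ?G T \<le> (\<Sum>i. (ediam (C i))\<^sup>2)" .
  qed
  then show ?thesis
    unfolding hausdorff2_pre_def distrib_left[symmetric] by (intro mult_left_mono) auto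
qed

lemma hausdorff2_outer_separated:
  assumes e: "0 < e" and sep: "\<And>x y. x \<in> S \<Longrightarrow> y \<in> T \<Longrightarrow> e \<le> dist x y"
  shows "hausdorff2_outer S + hausdorff2_outer T \<le> hausdorff2_outer (S \<union> T)"
proof (rule tendsto_le[OF _ tendsto_hausdorff2_outer
      tendsto_add[OF tendsto_hausdorff2_outer tendsto_hausdorff2_outer]])
  have "eventually (\<lambda>\<delta>. 0 < \<delta> \<and> \<delta> < e) (at_right 0)"
    using e by (auto simp: eventually_at_right_field)
  then show "eventually (\<lambda>\<delta>. hausdorff2_pre \<delta> S + hausdorff2_pre \<delta> T \<le>
      hausdorff2_pre \<delta> (S \<union> T)) (at_right 0)"
    by eventually_elim (meson hausdorff2_pre_separated less_imp_le order_trans sep)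
qed simp

lemma closed_in_lambda_system_hausdorff2:
  assumes F: "closed F"
  shows "F \<in> lambda_system UNIV (Pow UNIV) hausdorff2_outer"
proof -
  let ?H = "hausdorff2_outer :: 'a set \<Rightarrow> ennreal"
  have main: "?H (S \<inter> F) + ?H (S - F) \<le> ?H S" if fin: "?H S < \<infinity>" "F \<noteq> {}" for S
  proof -
    define r where "r n = 1 / real (Suc n)" for n
    define E where "E n = {x\<in>S. r n \<le> infdist x F}" for n
    define R where "R n = E (Suc n) - E n" for n
    have r: "r n > 0" "r (Suc n) < r n" for n
      by (auto simp: r_def field_simps)
    have r_mono: "m \<le> n \<Longrightarrow> r n \<le> r m" for m n
      by (auto simp: r_def field_simps)
    have E_mono: "m \<le> n \<Longrightarrow> E m \<subseteq> E n" for m n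
      using r_mono[of m n] by (auto simp: E_def)
    have E_sub: "E n \<subseteq> S" for n by (auto simp: E_def)
    have R_sub: "R n \<subseteq> E (Suc n)" "R n \<subseteq> S" for n by (auto simp: R_def E_def)
    have sepE: "r n \<le> dist x y" if "x \<in> E n" "y \<in> F" for x y n
      using that infdist_le[of y F x] by (auto simp: E_def)
    have R_sep: "r m - r (Suc m) \<le> dist x y" if "x \<in> E m" "y \<in> R n" "m < n" for x y m n
    proof -
      have "r m \<le> infdist x F" "infdist y F < r n" "r n \<le> r (Suc m)"
        using that r_mono[of "Suc m" n] by (auto simp: E_def R_def)
      moreover have "infdist x F \<le> infdist y F + dist x y"
        by (rule infdist_triangle)
      ultimately show ?thesis by linarith
    qed
    have alt: "(\<Sum>i<n. ?H (R (2 * i + k + 1))) \<le> ?H (E (2 * n + k))" for n k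
    proof (induction n)
      case (Suc n)
      let ?m = "2 * n + k"
      have "(\<Sum>i<Suc n. ?H (R (2 * i + k + 1))) \<le> ?H (E ?m) + ?H (R (?m + 1))"
        using Suc by (simp add: add_right_mono)
      also have "\<dots> \<le> ?H (E ?m \<union> R (?m + 1))"
        using r(2)[of ?m] R_sep[of _ ?m _ "?m + 1"]
        by (intro hausdorff2_outer_separated[of "r ?m - r (Suc ?m)"]) auto
      also have "\<dots> \<le> ?H (E (2 * Suc n + k))"
        using E_mono[of ?m "2 * Suc n + k"] R_sub(1)[of "?m + 1"]
        by (intro hausdorff2_outer_mono) auto
      finally show ?case .
    qed simp
    have bound: "(\<Sum>i<n. ?H (R (2 * i + k + 1))) \<le> ?H S" for n k
      using alt[of k n] hausdorff2_outer_mono[OF E_sub, of "2 * n + k"] by (rule order_trans)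
    have "(\<Sum>i. ?H (R (i + 1))) \<le> ?H S + ?H S"
    proof (rule suminf_le_const)
      fix n
      have "(\<Sum>i<n. ?H (R (i + 1))) \<le> (\<Sum>i<2 * n. ?H (R (i + 1)))"
        by (intro sum_mono2) auto
      also have "\<dots> = (\<Sum>i<n. ?H (R (2 * i + 0 + 1))) + (\<Sum>i<n. ?H (R (2 * i + 1 + 1)))"
        by (induction n) (simp_all add: ac_simps)
      also have "\<dots> \<le> ?H S + ?H S"
        by (intro add_mono bound)
      finally show "(\<Sum>i<n. ?H (R (i + 1))) \<le> ?H S + ?H S" .
    qed simp
    then have sum_fin: "(\<Sum>i. ?H (R (i + 1))) \<noteq> \<infinity>"
      using fin(1) by (auto simp: top_unique)
    define h where "h i = enn2real (?H (R (i + 1)))" for i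
    have h: "?H (R (i + 1)) = ennreal (h i)" for i
      using hausdorff2_outer_mono[OF R_sub(2), of "i + 1"] fin(1)
      by (auto simp: h_def ennreal_enn2real_if top_unique)
    have h_nonneg: "h i \<ge> 0" for i by (simp add: h_def)
    have h_sum: "summable h"
      using sum_fin by (intro summable_suminf_not_top) (auto simp: h_nonneg h[symmetric])
    have tail: "(\<Sum>i. ?H (R (i + n + 1))) = ennreal (\<Sum>i. h (i + n))" for n
      using h_sum by (simp only: h) (intro suminf_ennreal2 summable_ignore_initial_segment h_nonneg)
    have step: "?H (S \<inter> F) + ?H (S - F) \<le> ?H S + ennreal (\<Sum>i. h (i + n))" for n
    proof -
      have "S - F \<subseteq> E (n + 1) \<union> (\<Union>i. R (i + n + 1))"
      proof
        fix x assume x: "x \<in> S - F"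
        then have "infdist x F > 0"
          using F fin(2) by (simp add: infdist_pos_not_in_closed)
        then obtain m where "1 / real (Suc m) < infdist x F"
          using nat_approx_posE by blast
        then have m: "x \<in> E m" using x by (auto simp: E_def r_def)
        define l where "l = (LEAST m. x \<in> E m)"
        have l: "x \<in> E l" "\<And>j. j < l \<Longrightarrow> x \<notin> E j"
          unfolding l_def using m by (auto intro: LeastI dest: not_less_Least)
        show "x \<in> E (n + 1) \<union> (\<Union>i. R (i + n + 1))"
        proof (cases "l \<le> n + 1")
          case True
          then show ?thesis using l(1) E_mono by blast
        next
          case False
          then have "l = Suc ((l - n - 2) + n + 1)" by simp
          then obtain i where "l = Suc (i + n + 1)" by blast
          then have "x \<in> R (i + n + 1)"
            using l by (auto simp: R_def)
          then show ?thesis by blast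
        qed
      qed
      then have "?H (S - F) \<le> ?H (E (n + 1) \<union> (\<Union>i. R (i + n + 1)))"
        by (rule hausdorff2_outer_mono)
      also have "\<dots> \<le> ?H (E (n + 1)) + (\<Sum>i. ?H (R (i + n + 1)))"
        by (rule order_trans[OF hausdorff2_outer_Un]) (intro add_left_mono hausdorff2_outer_UN)
      finally have "?H (S \<inter> F) + ?H (S - F) \<le>
          ?H (S \<inter> F) + (?H (E (n + 1)) + ennreal (\<Sum>i. h (i + n)))"
        unfolding tail by (intro add_left_mono)
      also have "\<dots> = ?H (E (n + 1)) + ?H (S \<inter> F) + ennreal (\<Sum>i. h (i + n))"
        by (simp add: ac_simps)
      also have "?H (E (n + 1)) + ?H (S \<inter> F) \<le> ?H (E (n + 1) \<union> (S \<inter> F))"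
        using r(1) sepE by (intro hausdorff2_outer_separated[of "r (n + 1)"]) auto
      also have "\<dots> \<le> ?H S"
        using E_sub by (intro hausdorff2_outer_mono) auto
      finally show ?thesis by (simp add: add_right_mono)
    qed
    have "(\<lambda>n. ?H S + ennreal (\<Sum>i. h (i + n))) \<longlonglongrightarrow> ?H S + ennreal 0"
      using suminf_exist_split2[OF h_sum] by (intro tendsto_add tendsto_ennrealI tendsto_const) simp
    then show ?thesis
      using step by (intro LIMSEQ_le_const[where X = "\<lambda>n. ?H S + ennreal (\<Sum>i. h (i + n))"]) auto
  qed
  interpret algebra UNIV "Pow (UNIV :: 'a set)"
    by (rule algebra_Pow)
  show ?thesis
    unfolding lambda_system_eq
  proof safe
    fix S :: "'a set"
    have "?H S \<le> ?H (S \<inter> F) + ?H (S - F)"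
      using hausdorff2_outer_Un[of "S \<inter> F" "S - F"] by (simp add: Int_Diff_Un)
    moreover have "?H (S \<inter> F) + ?H (S - F) \<le> ?H S"
    proof (cases "?H S < \<infinity> \<and> F \<noteq> {}")
      case True
      then show ?thesis using main by blast
    next
      case False
      then show ?thesis by (auto simp: less_top[symmetric])
    qed
    ultimately show "?H (S \<inter> F) + ?H (S - F) = ?H S" by (intro antisym)
  qed simp
qed

lemma measure_space_hausdorff2:
  "measure_space UNIV (sets borel) (hausdorff2_outer :: 'a::metric_space set \<Rightarrow> ennreal)"
proof -
  interpret sigma_algebra UNIV "Pow (UNIV :: 'a set)"
    by (rule sigma_algebra_Pow)
  let ?L = "lambda_system UNIV (Pow UNIV) (hausdorff2_outer :: 'a set \<Rightarrow> ennreal)"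
  have L: "measure_space UNIV ?L hausdorff2_outer"
    by (rule caratheodory_lemma[OF outer_measure_space_hausdorff2_outer])
  then interpret L: sigma_algebra UNIV ?L
    by (simp add: measure_space_def)
  have "sigma_sets UNIV {S :: 'a set. open S} \<subseteq> ?L"
  proof (rule L.sigma_sets_subset, safe)
    fix S :: "'a set" assume "open S"
    then have "UNIV - (- S) \<in> ?L"
      using closed_in_lambda_system_hausdorff2[of "- S"] by (intro L.compl_sets) auto
    then show "S \<in> ?L" by (simp add: Compl_eq_Diff_UNIV[symmetric])
  qed
  then have "sets (borel :: 'a measure) \<subseteq> ?L"
    by (simp add: borel_def)
  moreover have "sigma_algebra UNIV (sets (borel :: 'a measure))"
    using sets.sigma_algebra_axioms[of "borel :: 'a measure"] by simp
  ultimately show ?thesis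
    using L by (blast intro: measure_down)
qed

lemma sets_hausdorff2 [simp, measurable_cong]: "sets hausdorff2 = sets borel"
  unfolding hausdorff2_def using sets.sigma_sets_eq[of borel] by (simp add: sets_measure_of_conv)

lemma space_hausdorff2 [simp]: "space hausdorff2 = UNIV"
  by (simp add: hausdorff2_def space_measure_of_conv)

lemma emeasure_hausdorff2:
  "S \<in> sets borel \<Longrightarrow> emeasure hausdorff2 S = hausdorff2_outer S"
  using measure_space_hausdorff2 unfolding hausdorff2_def
  by (intro emeasure_measure_of_sigma) (auto simp: measure_space_def)

end

theory Submission
  imports Defs
begin

text \<open>
  Curves are replaced by finite chains of points with steps shorter than \<open>\<delta>\<close>, and an admissible
  function by a continuous weight \<open>g\<close>. Let \<open>u(x)\<close> be the least \<open>g\<close>-weight of a chain from \<open>A\<close> to \<open>x\<close>.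
  By the Poincare-Miranda theorem no level set \<open>{u = t}\<close> splits into a closed part off \<open>D\<close> and a closed
  part off \<open>B\<close>, so for every finite open cover \<open>V i\<close> of \<open>Q\<close> the sets that meet \<open>{u = t}\<close> contain a
  chain from \<open>B\<close> to \<open>D\<close> which uses each \<open>V i\<close> at most once. The values \<open>t\<close> for which \<open>V i\<close> is needed
  lie in an interval of length at most \<open>sup g * diam (V i)\<close>. Integrating over \<open>t\<close> bounds the product of the
  two chain distances by \<open>\<Sum>i. sup g * sup f * (diam (V i))\<^sup>2\<close>, which for good covers is at most about
  \<open>4 / pi\<close> times the integral of \<open>f * g\<close>; Hoelder's inequality then gives the claim for the discrete
  moduli. These do not exceed the moduli: an admissible function is dominated by an increasing limit of
  continuous weights with almost the same norm, and if all of these weights had chains of weight below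
  \<open>c < 1\<close>, a limit of the chains would be a rectifiable curve with integral at most \<open>c\<close>.
\<close>

section \<open>Level sets in the unit square\<close>

text \<open>The obstacle is that the level sets of a distance function on such a space need not
  contain any curve of controlled length. Chains of points avoid this: a level set only has to be
  linked up by open cells, which is a purely topological fact. The constant arises without loss. A
  cell of diameter \<open>d\<close> on which the weights are at most \<open>G\<close> and
  \<open>H\<close> is met by levels from an interval of length \<open>G * d\<close>, and it costs
  \<open>H * d\<close> in a chain, while \<pi>/4 times \<open>d\<^sup>2\<close> is what the
  Hausdorff measure is charged for it. On the side of curves, the line integral of a Borel function
  is not semicontinuous. It becomes so once the function is majorized by the limit of an increasing
  sequence of continuous weights: a chain that is short for a late weight is also short for every
  earlier one, so the limit curve is short for all of them, and monotone convergence applies. Since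
  zero times infinity is zero in \<open>ennreal\<close>, the final inequality also requires that
  neither modulus vanishes, even if the other one is infinite.\<close>

lemma poincare_miranda:
  fixes f g :: "real \<times> real \<Rightarrow> real"
  assumes cont: "continuous_on ({0..1} \<times> {0..1}) f" "continuous_on ({0..1} \<times> {0..1}) g"
    and f: "\<And>y. y \<in> {0..1} \<Longrightarrow> f (0, y) \<le> 0" "\<And>y. y \<in> {0..1} \<Longrightarrow> 0 \<le> f (1, y)"
    and g: "\<And>x. x \<in> {0..1} \<Longrightarrow> g (x, 0) \<le> 0" "\<And>x. x \<in> {0..1} \<Longrightarrow> 0 \<le> g (x, 1)"
  shows "\<exists>z \<in> {0..1} \<times> {0..1}. f z = 0 \<and> g z = 0"
proof -
  let ?S = "{0..1::real} \<times> {0..1::real}"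
  \<comment> \<open>At a fixed point with 0 < x < 1 the clamp \<open>c\<close> is inactive, which
    forces \<open>f z = 0\<close>. At x = 0 the clamp gives 0 \<le> \<open>f z\<close>, and at x = 1
    it gives \<open>f z\<close> \<le> 0; the sign conditions on the sides supply the opposite
    inequalities. The second coordinate behaves in the same way.\<close>
  define c where "c = (\<lambda>r::real. max 0 (min 1 r))"
  define F where "F = (\<lambda>z. (c (fst z - f z), c (snd z - g z)))"
  have "continuous_on ?S F"
    unfolding F_def c_def by (intro continuous_intros cont)
  moreover have "F \<in> ?S \<rightarrow> ?S"
    by (auto simp: F_def c_def)
  moreover have "compact ?S" "convex ?S" "?S \<noteq> {}"
    by (auto intro!: compact_Times convex_Times)
  ultimately obtain z where z: "z \<in> ?S" "F z = z"
    using brouwer[of ?S F] by blast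
  obtain x y where xy: "z = (x, y)" by (cases z)
  have "x \<in> {0..1}" "y \<in> {0..1}" "c (x - f z) = x" "c (y - g z) = y"
    using z by (auto simp: F_def xy)
  moreover have "x = 0 \<Longrightarrow> f z \<le> 0" "x = 1 \<Longrightarrow> 0 \<le> f z" "y = 0 \<Longrightarrow> g z \<le> 0" "y = 1 \<Longrightarrow> 0 \<le> g z"
    using f g calculation by (auto simp: xy)
  ultimately have "f z = 0" "g z = 0"
    by (auto simp: c_def max_def min_def split: if_splits)
  then show ?thesis using z(1) by blast
qed

text \<open>A Urysohn function that is -1 on \<open>K\<^sub>1\<close> and the bottom side and 1 on
  \<open>K\<^sub>2\<close> and the top side satisfies, together with \<open>f - t\<close>, the sign
  conditions above. Their common zero lies on the level set, where the Urysohn function only takes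
  the values -1 and 1. This stands in for the existence of a continuum in the level set that joins
  bottom to top.\<close>

lemma level_set_not_separated:
  fixes f :: "real \<times> real \<Rightarrow> real"
  assumes f: "continuous_on ({0..1} \<times> {0..1}) f"
    and lr: "\<And>y. y \<in> {0..1} \<Longrightarrow> f (0, y) \<le> t" "\<And>y. y \<in> {0..1} \<Longrightarrow> t \<le> f (1, y)"
    and closed: "closed K\<^sub>1" "closed K\<^sub>2" and disj: "K\<^sub>1 \<inter> K\<^sub>2 = {}"
    and cover: "{z \<in> {0..1} \<times> {0..1}. f z = t} \<subseteq> K\<^sub>1 \<union> K\<^sub>2"
    and bottom: "K\<^sub>2 \<inter> {0..1} \<times> {0} = {}" and top: "K\<^sub>1 \<inter> {0..1} \<times> {1} = {}"
  shows False
proof -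
  have "closed (K\<^sub>1 \<union> {0..1} \<times> {0})" "closed (K\<^sub>2 \<union> {0..1} \<times> {1})"
    by (intro closed_Un closed closed_Times closed_atLeastAtMost closed_singleton)+
  moreover have "(K\<^sub>1 \<union> {0..1} \<times> {0}) \<inter> (K\<^sub>2 \<union> {0..1} \<times> {1}) = {}"
    using disj bottom top by auto
  ultimately obtain w :: "real \<times> real \<Rightarrow> real" where w: "continuous_on UNIV w"
      "\<And>z. z \<in> K\<^sub>1 \<union> {0..1} \<times> {0} \<Longrightarrow> w z = -1" "\<And>z. z \<in> K\<^sub>2 \<union> {0..1} \<times> {1} \<Longrightarrow> w z = 1"
    using Urysohn[of "K\<^sub>1 \<union> {0..1} \<times> {0}" "K\<^sub>2 \<union> {0..1} \<times> {1}" "-1::real" 1] by metis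
  have "\<exists>z \<in> {0..1} \<times> {0..1}. f z - t = 0 \<and> w z = 0"
    by (rule poincare_miranda)
      (use lr w(2,3) in \<open>auto intro!: continuous_intros f continuous_on_subset[OF w(1)]\<close>)
  then obtain z where z: "z \<in> {0..1} \<times> {0..1}" "f z - t = 0" "w z = 0"
    by blast
  then have "z \<in> K\<^sub>1 \<union> K\<^sub>2" using cover by auto
  then show False using w(2,3)[of z] z(3) by auto
qed

section \<open>Discrete chains and the length-area inequality\<close>

text \<open>A step is charged with the weight at its starting point. With this convention the chain
  distance from a set grows by at most \<open>g y * dist y z\<close> along a step from y to z, and a
  chain turned into a path can wait at y until the step is paid for.\<close>

inductive chain :: "'a::metric_space set \<Rightarrow> real \<Rightarrow> ('a \<Rightarrow> real) \<Rightarrow> 'a \<Rightarrow> real \<Rightarrow> 'a \<Rightarrow> bool"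
  for Q \<delta> g x where
  chain_refl: "x \<in> Q \<Longrightarrow> chain Q \<delta> g x 0 x"
| chain_step: "chain Q \<delta> g x W y \<Longrightarrow> z \<in> Q \<Longrightarrow> dist y z < \<delta> \<Longrightarrow> chain Q \<delta> g x (W + g y * dist y z) z"

text \<open>The discrete distance of \<open>E\<close> and \<open>F\<close> is at least
  \<open>c\<close>, said without forming an infimum; it holds vacuously if no chain joins the two
  sets.\<close>

definition chains_long ::
    "'a::metric_space set \<Rightarrow> real \<Rightarrow> ('a \<Rightarrow> real) \<Rightarrow> 'a set \<Rightarrow> 'a set \<Rightarrow> real \<Rightarrow> bool" where
  "chains_long Q \<delta> g E F c \<longleftrightarrow> (\<forall>x\<in>E. \<forall>y\<in>F. \<forall>W. chain Q \<delta> g x W y \<longrightarrow> c \<le> W)"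

lemma chain_end_in: "chain Q \<delta> g x W y \<Longrightarrow> y \<in> Q"
  by (induction rule: chain.induct) auto

lemma chain_nonneg:
  "chain Q \<delta> g x W y \<Longrightarrow> (\<And>z. z \<in> Q \<Longrightarrow> 0 \<le> g z) \<Longrightarrow> 0 \<le> W"
  by (induction rule: chain.induct) (auto simp: chain_end_in)

lemma chain_mono: "chain Q \<delta> g x W y \<Longrightarrow> \<delta> \<le> \<delta>' \<Longrightarrow> chain Q \<delta>' g x W y"
  by (induction rule: chain.induct) (auto intro: chain.intros)

lemma chains_long_antimono: "chains_long Q \<delta>' g E F c \<Longrightarrow> \<delta> \<le> \<delta>' \<Longrightarrow> chains_long Q \<delta> g E F c"
  unfolding chains_long_def by (blast intro: chain_mono)

text \<open>The index set \<open>J\<close> records the cells already passed, and a new link has to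
  use a fresh one. The cost of a connection is thereby bounded by a sum over a set of cells, without
  multiplicities.\<close>

inductive linked :: "'i set \<Rightarrow> ('i \<Rightarrow> 'a set) \<Rightarrow> 'a set \<Rightarrow> 'a set \<Rightarrow> 'i set \<Rightarrow> 'a \<Rightarrow> bool"
  for I V K X where
  linked_start: "x \<in> X \<Longrightarrow> linked I V K X {} x"
| linked_link: "linked I V K X J y \<Longrightarrow> i \<in> I \<Longrightarrow> i \<notin> J \<Longrightarrow> y \<in> V i \<Longrightarrow> z \<in> V i \<Longrightarrow> z \<in> K \<Longrightarrow>
    linked I V K X (insert i J) z"

lemma linked_in: "linked I V K X J z \<Longrightarrow> X \<subseteq> K \<Longrightarrow> z \<in> K"
  by (induction rule: linked.induct) auto

lemma linked_indices:
  "linked I V K X J z \<Longrightarrow> X \<subseteq> K \<Longrightarrow> finite J \<and> J \<subseteq> {i \<in> I. V i \<inter> K \<noteq> {}}"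
  by (induction rule: linked.induct) auto

text \<open>Shortcut: a link \<open>V i\<close> that has been used before is never entered a second time.\<close>

lemma linked_reenter:
  "linked I V K X J y \<Longrightarrow> i \<in> J \<Longrightarrow> z \<in> V i \<Longrightarrow> z \<in> K \<Longrightarrow> \<exists>J'. linked I V K X J' z"
  by (induction arbitrary: z rule: linked.induct) (auto intro: linked_link)

lemma linked_extend:
  assumes "linked I V K X J y" "i \<in> I" "y \<in> V i" "z \<in> V i" "z \<in> K"
  shows "\<exists>J'. linked I V K X J' z"
  using assms linked_reenter linked_link by metis

text \<open>A link through cell \<open>i\<close> becomes a single step. Both ends lie in
  \<open>V i\<close> and in \<open>Q\<close>, so its length is at most \<open>d i\<close>, and the
  weight at its start is at most \<open>H i\<close>. As the index is fresh, the sum over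
  \<open>J\<close> grows by exactly the term \<open>H i * d i\<close>.\<close>

lemma linked_chain:
  assumes "linked I V K X J z" "X \<subseteq> K" "K \<subseteq> Q"
    and "\<And>i x y. i \<in> I \<Longrightarrow> x \<in> V i \<inter> Q \<Longrightarrow> y \<in> V i \<inter> Q \<Longrightarrow> dist x y \<le> d i"
    and "\<And>i. i \<in> I \<Longrightarrow> d i < \<delta>"
    and "\<And>i x. i \<in> I \<Longrightarrow> x \<in> V i \<inter> Q \<Longrightarrow> 0 \<le> f x \<and> f x \<le> H i"
  shows "\<exists>x\<in>X. \<exists>W. chain Q \<delta> f x W z \<and> W \<le> (\<Sum>i\<in>J. H i * d i)"
  using assms(1)
proof (induction rule: linked.induct)
  case (linked_start x)
  then have "chain Q \<delta> f x 0 x" using assms(2,3) by (auto intro: chain_refl)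
  with linked_start show ?case by force
next
  case (linked_link J y i z)
  then obtain x W where x: "x \<in> X" "chain Q \<delta> f x W y" "W \<le> (\<Sum>i\<in>J. H i * d i)" by blast
  have yz: "y \<in> V i \<inter> Q" "z \<in> V i \<inter> Q"
    using linked_link linked_in[OF linked_link(1) assms(2)] assms(3) by auto
  have d: "dist y z \<le> d i" "d i < \<delta>"
    using assms(4)[OF linked_link(2) yz] assms(5)[OF linked_link(2)] by auto
  have f: "0 \<le> f y" "f y \<le> H i"
    using assms(6)[OF linked_link(2) yz(1)] by auto
  have c: "chain Q \<delta> f x (W + f y * dist y z) z"
    using x(2) yz d by (intro chain_step) auto
  have "f y * dist y z \<le> H i * d i"
    using d f by (intro mult_mono) auto
  moreover have "finite J" using linked_indices[OF linked_link(1) assms(2)] by simp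
  ultimately have "W + f y * dist y z \<le> (\<Sum>j\<in>insert i J. H j * d j)"
    using x(3) linked_link(3) by simp
  with c x(1) show ?case by blast
qed

text \<open>A discrete co-area inequality. Below, \<open>u\<close> is the \<open>g\<close>-distance
  from the left side, \<open>G i * d i\<close> bounds the oscillation of \<open>u\<close> on a cell,
  and \<open>H i * d i\<close> bounds the cost of the cell for an \<open>f\<close>-chain inside a
  level set. Exchanging the sum over cells with the integral over levels gives the product.\<close>

lemma discrete_length_area:
  fixes h :: "real \<times> real \<Rightarrow> 'a::metric_space"
  assumes h: "continuous_on ({0..1} \<times> {0..1}) h" "h ` ({0..1} \<times> {0..1}) = Q"
    and nonneg: "\<And>x. x \<in> Q \<Longrightarrow> 0 \<le> g x" "\<And>x. x \<in> Q \<Longrightarrow> 0 \<le> f x"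
    and long: "chains_long Q \<delta> g (h ` ({0} \<times> {0..1})) (h ` ({1} \<times> {0..1})) \<alpha>"
      "chains_long Q \<delta> f (h ` ({0..1} \<times> {0})) (h ` ({0..1} \<times> {1})) \<beta>"
    and \<alpha>: "0 < \<alpha>" and I: "finite I" and V: "\<And>i. i \<in> I \<Longrightarrow> open (V i)" "Q \<subseteq> (\<Union>i\<in>I. V i)"
    and d: "\<And>i x y. i \<in> I \<Longrightarrow> x \<in> V i \<inter> Q \<Longrightarrow> y \<in> V i \<inter> Q \<Longrightarrow> dist x y \<le> d i"
      "\<And>i. i \<in> I \<Longrightarrow> 0 \<le> d i" "\<And>i. i \<in> I \<Longrightarrow> d i < \<delta>"
    and G: "\<And>i x. i \<in> I \<Longrightarrow> x \<in> V i \<inter> Q \<Longrightarrow> g x \<le> G i" "\<And>i. i \<in> I \<Longrightarrow> 0 \<le> G i"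
    and H: "\<And>i x. i \<in> I \<Longrightarrow> x \<in> V i \<inter> Q \<Longrightarrow> f x \<le> H i" "\<And>i. i \<in> I \<Longrightarrow> 0 \<le> H i"
  shows "\<alpha> * \<beta> \<le> (\<Sum>i\<in>I. G i * H i * (d i)\<^sup>2)"
proof -
  let ?S = "{0..1::real} \<times> {0..1::real}"
  let ?A = "h ` ({0} \<times> {0..1})" and ?B = "h ` ({0..1} \<times> {0})"
  let ?C = "h ` ({1} \<times> {0..1})" and ?D = "h ` ({0..1} \<times> {1})"
  \<comment> \<open>Inserting \<open>\<alpha>\<close> truncates the distance at
    \<open>\<alpha>\<close>, so the infimum is over a nonempty set. It does not harm the lower bound
    \<open>\<alpha>\<close> on the right side.\<close>
  define U where "U x = insert \<alpha> {W. \<exists>a\<in>?A. chain Q \<delta> g a W x}" for x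
  define u where "u x = Inf (U x)" for x
  have U0: "0 \<le> W" if "W \<in> U x" for W x
    using that \<alpha> chain_nonneg[OF _ nonneg(1)] by (auto simp: U_def)
  have bdd: "bdd_below (U x)" for x
    using U0 by (auto intro: bdd_belowI[of _ 0])
  have u_le: "u x \<le> W" if "W \<in> U x" for W x
    unfolding u_def by (rule cInf_lower[OF that bdd])
  have u_ge: "c \<le> u x" if "\<And>W. W \<in> U x \<Longrightarrow> c \<le> W" for c x
    unfolding u_def using that by (intro cInf_greatest) (auto simp: U_def)
  have u0: "0 \<le> u x" for x by (rule u_ge) (rule U0)
  have uA: "u x = 0" if "x \<in> ?A" for x
  proof -
    have "x \<in> Q" using that h(2) by auto
    then have "0 \<in> U x" using that by (auto simp: U_def intro!: chain_refl bexI[of _ x])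
    then show ?thesis using u_le u0 by (meson antisym)
  qed
  have uC: "\<alpha> \<le> u x" if "x \<in> ?C" for x
    using long(1) that by (intro u_ge) (auto simp: U_def chains_long_def)
  have u_step: "u y \<le> u x + g x * dist x y" if "x \<in> Q" "y \<in> Q" "dist x y < \<delta>" for x y
  proof -
    have "u y - g x * dist x y \<le> u x"
    proof (rule u_ge)
      fix W assume "W \<in> U x"
      then consider "W = \<alpha>" | a where "a \<in> ?A" "chain Q \<delta> g a W x" by (auto simp: U_def)
      then show "u y - g x * dist x y \<le> W"
      proof cases
        case 1
        moreover have "u y \<le> \<alpha>" by (rule u_le) (simp add: U_def)
        moreover have "0 \<le> g x * dist x y" using nonneg that by simp
        ultimately show ?thesis by linarith
      next
        case 2
        then have "chain Q \<delta> g a (W + g x * dist x y) y" using that by (auto intro: chain_step)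
        then have "u y \<le> W + g x * dist x y" using 2(1) by (intro u_le) (auto simp: U_def)
        then show ?thesis by linarith
      qed
    qed
    then show ?thesis by simp
  qed
  have u_cell: "u y \<le> u x + G i * dist x y" if "i \<in> I" "x \<in> V i \<inter> Q" "y \<in> V i \<inter> Q" for i x y
  proof -
    have "dist x y < \<delta>" using d(1)[OF that] d(3)[OF that(1)] by simp
    then have "u y \<le> u x + g x * dist x y" using that by (intro u_step) auto
    also have "g x * dist x y \<le> G i * dist x y" using G(1)[OF that(1,2)] by (intro mult_right_mono) auto
    finally show ?thesis by simp
  qed
  \<comment> \<open>Points near x share an open cell with x, and there \<open>u_cell\<close>, used
    in both directions, is a Lipschitz bound. The constant \<open>G i + 1\<close> allows for
    \<open>G i = 0\<close>.\<close>
  have u_cont: "continuous_on Q u"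
    unfolding continuous_on_iff
  proof (intro ballI allI impI)
    fix x and e :: real assume x: "x \<in> Q" and e: "0 < e"
    then obtain i where i: "i \<in> I" "x \<in> V i" using V(2) by blast
    then obtain r where r: "r > 0" "ball x r \<subseteq> V i" using V(1) openE by metis
    define s where "s = min r (e / (G i + 1))"
    have "s > 0" using r e G(2)[OF i(1)] by (auto simp: s_def)
    moreover have "dist (u y) (u x) < e" if y: "y \<in> Q" "dist y x < s" for y
    proof -
      have "y \<in> V i" using y r by (auto simp: s_def dist_commute)
      then have "\<bar>u y - u x\<bar> \<le> G i * dist x y"
        using u_cell[OF i(1), of x y] u_cell[OF i(1), of y x] i x y by (auto simp: dist_commute)
      also have "\<dots> \<le> (G i + 1) * dist x y" by (simp add: distrib_right)
      also have "\<dots> < (G i + 1) * (e / (G i + 1))"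
        using y G(2)[OF i(1)] by (intro mult_strict_left_mono) (auto simp: s_def dist_commute)
      also have "\<dots> = e" using G(2)[OF i(1)] by simp
      finally show ?thesis by (simp add: dist_real_def)
    qed
    ultimately show "\<exists>d>0. \<forall>x'\<in>Q. dist x' x < d \<longrightarrow> dist (u x') (u x) < e" by blast
  qed
  have uh: "continuous_on ?S (u \<circ> h)"
    using h u_cont by (intro continuous_on_compose) auto
  define a where "a i = Inf (u ` (V i \<inter> Q))" for i
  have range: "u x \<in> {a i..a i + G i * d i}" if "i \<in> I" "x \<in> V i \<inter> Q" for i x
  proof -
    have "a i \<le> u x" unfolding a_def
      using that u0 by (intro cInf_lower bdd_belowI[of _ 0]) auto
    moreover have "u x - G i * d i \<le> a i" unfolding a_def
    proof (rule cInf_greatest)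
      fix w assume "w \<in> u ` (V i \<inter> Q)"
      then obtain y where y: "y \<in> V i \<inter> Q" "w = u y" by blast
      have "u x \<le> u y + G i * dist y x" using u_cell[OF that(1) y(1) that(2)] .
      also have "G i * dist y x \<le> G i * d i"
        using d(1)[OF that(1) y(1) that(2)] G(2)[OF that(1)] by (intro mult_left_mono)
      finally show "u x - G i * d i \<le> w" using y by simp
    qed (use that in auto)
    ultimately show ?thesis by simp
  qed
  have level: "\<beta> \<le> (\<Sum>i\<in>{i\<in>I. V i \<inter> {x\<in>Q. u x = t} \<noteq> {}}. H i * d i)" if t: "0 < t" "t < \<alpha>" for t
  proof -
    define K where "K = {x\<in>Q. u x = t}"
    define L where "L = linked I V K (K \<inter> ?B)"
    define T where "T = {z. \<exists>J. L J z}"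
    define N where "N = {i\<in>I. V i \<inter> T \<noteq> {}}"
    have TK: "T \<subseteq> K" by (auto simp: T_def L_def dest: linked_in)
    have ext: "z \<in> T" if "i \<in> N" "z \<in> V i" "z \<in> K" for i z
      using that linked_extend[of I V K "K \<inter> ?B"] by (fastforce simp: N_def T_def L_def)
    \<comment> \<open>A cell that meets \<open>T\<close> contributes all of its points in
      \<open>K\<close> to \<open>T\<close>. Hence \<open>T\<close> is \<open>K\<close> minus the
      open cells outside \<open>N\<close>, and the rest of \<open>K\<close> is \<open>K\<close>
      minus the open cells in \<open>N\<close>: both parts are relatively closed in
      \<open>K\<close>.\<close>
    have T1: "z \<in> K \<Longrightarrow> z \<in> T \<longleftrightarrow> z \<in> (\<Union>i\<in>N. V i)" for z
    proof
      assume "z \<in> K" "z \<in> T"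
      moreover from this obtain i where "i \<in> I" "z \<in> V i" using V(2) by (auto simp: K_def)
      ultimately show "z \<in> (\<Union>i\<in>N. V i)" by (auto simp: N_def)
    qed (use ext in blast)
    have T2: "z \<in> K \<Longrightarrow> z \<in> T \<longleftrightarrow> z \<notin> (\<Union>i\<in>I - N. V i)" for z
    proof
      assume "z \<in> K" and z: "z \<notin> (\<Union>i\<in>I - N. V i)"
      moreover from this obtain i where "i \<in> I" "z \<in> V i" using V(2) by (auto simp: K_def)
      ultimately show "z \<in> T" using ext[of i z] by blast
    qed (auto simp: N_def)
    have "\<exists>z. z \<in> T \<inter> ?D"
    proof (rule ccontr)
      assume no: "\<nexists>z. z \<in> T \<inter> ?D"
      \<comment> \<open>Pulled back to the square, \<open>cl (I - N)\<close> is the preimage of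
        \<open>T\<close> and \<open>cl N\<close> is the preimage of the rest of \<open>K\<close>. If
        \<open>T\<close> missed the top side, these two closed sets would separate the level
        set.\<close>
      define cl where "cl M = (?S \<inter> (u \<circ> h) -` {t}) \<inter> (?S \<inter> h -` (- (\<Union>i\<in>M. V i)))" for M
      have clM: "closed (cl M)" if "M \<subseteq> I" for M
        unfolding cl_def using V(1) that
        by (intro closed_Int continuous_closed_preimage uh h(1) closed_Times) auto
      have cl: "z \<in> cl M \<longleftrightarrow> z \<in> ?S \<and> h z \<in> K \<and> h z \<notin> (\<Union>i\<in>M. V i)" for z M
        using h(2) by (auto simp: cl_def K_def)
      have cl1: "z \<in> cl (I - N) \<longleftrightarrow> z \<in> ?S \<and> h z \<in> T" for z
        unfolding cl using T2 TK by blast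
      have cl2: "z \<in> cl N \<longleftrightarrow> z \<in> ?S \<and> h z \<in> K \<and> h z \<notin> T" for z
        unfolding cl using T1 by blast
      show False
      proof (rule level_set_not_separated[OF uh, of t "cl (I - N)" "cl N"])
        show "closed (cl (I - N))" "closed (cl N)" by (auto intro!: clM simp: N_def)
        show "cl (I - N) \<inter> cl N = {}" using cl1 cl2 by blast
        show "{z \<in> ?S. (u \<circ> h) z = t} \<subseteq> cl (I - N) \<union> cl N"
          using h(2) cl1 cl2 by (auto simp: K_def)
        show "cl N \<inter> {0..1} \<times> {0} = {}"
        proof -
          have "h z \<in> T" if "h z \<in> K" "z \<in> {0..1} \<times> {0}" for z
            using that linked_start[of "h z" "K \<inter> ?B" I V K] by (auto simp: T_def L_def)
          then show ?thesis using cl2 by blast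
        qed
        show "cl (I - N) \<inter> {0..1} \<times> {1} = {}" using cl1 no by blast
        show "(u \<circ> h) (0, y) \<le> t" if "y \<in> {0..1}" for y
          using uA[of "h (0, y)"] that t by auto
        show "t \<le> (u \<circ> h) (1, y)" if "y \<in> {0..1}" for y
          using uC[of "h (1, y)"] that t by auto
      qed
    qed
    then obtain z J where z: "z \<in> ?D" "L J z" by (auto simp: T_def)
    obtain x W where x: "x \<in> K \<inter> ?B" "chain Q \<delta> f x W z" "W \<le> (\<Sum>i\<in>J. H i * d i)"
    proof -
      have "\<exists>x\<in>K \<inter> ?B. \<exists>W. chain Q \<delta> f x W z \<and> W \<le> (\<Sum>i\<in>J. H i * d i)"
        by (rule linked_chain[OF z(2)[unfolded L_def]])
          (use d H nonneg in \<open>auto simp: K_def\<close>)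
      then show ?thesis using that by blast
    qed
    have "\<beta> \<le> W" using long(2) x z by (auto simp: chains_long_def)
    also note x(3)
    \<comment> \<open>Passing to all cells that meet the level set removes the dependence on the
      chosen chain; what remains can be bounded by indicators of intervals in
      \<open>t\<close>.\<close>
    also have "(\<Sum>i\<in>J. H i * d i) \<le> (\<Sum>i\<in>{i\<in>I. V i \<inter> K \<noteq> {}}. H i * d i)"
      using linked_indices[OF z(2)[unfolded L_def]] I d(2) H(2)
      by (intro sum_mono2) auto
    finally show ?thesis unfolding K_def .
  qed
  show ?thesis
  proof (cases "0 \<le> \<beta>")
    case False
    then have "\<alpha> * \<beta> \<le> 0" using \<alpha> by (simp add: mult_nonneg_nonpos)
    also have "0 \<le> (\<Sum>i\<in>I. G i * H i * (d i)\<^sup>2)" using G(2) H(2) by (intro sum_nonneg) auto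
    finally show ?thesis .
  next
    case True
    let ?F = "\<lambda>t. \<Sum>i\<in>I. ennreal (H i * d i) * indicator {a i..a i + G i * d i} t"
    \<comment> \<open>If cell \<open>i\<close> meets the level \<open>t\<close>, then
      \<open>t\<close> lies in the interval of values of \<open>u\<close> on that cell. The right
      side is therefore a step function whose integral is the sum of \<open>H i * d i\<close> times
      \<open>G i * d i\<close>.\<close>
    have pt: "ennreal \<beta> * indicator {0<..<\<alpha>} t \<le> ?F t" for t
    proof (cases "t \<in> {0<..<\<alpha>}")
      case t: True
      let ?J = "{i\<in>I. V i \<inter> {x\<in>Q. u x = t} \<noteq> {}}"
      have "ennreal \<beta> \<le> ennreal (\<Sum>i\<in>?J. H i * d i)"
        using t level[of t] by (intro ennreal_leI) auto
      also have "\<dots> = (\<Sum>i\<in>?J. ennreal (H i * d i))"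
        using H(2) d(2) by (intro sum_ennreal[symmetric]) auto
      also have "\<dots> = (\<Sum>i\<in>?J. ennreal (H i * d i) * indicator {a i..a i + G i * d i} t)"
      proof (rule sum.cong[OF refl])
        fix i assume "i \<in> ?J"
        then obtain x where "i \<in> I" "x \<in> V i \<inter> Q" "u x = t" by blast
        then have "t \<in> {a i..a i + G i * d i}" using range[of i x] by simp
        then show "ennreal (H i * d i) = ennreal (H i * d i) * indicator {a i..a i + G i * d i} t"
          by (simp only: indicator_simps mult_1_right)
      qed
      also have "\<dots> \<le> ?F t" using I by (intro sum_mono2) auto
      finally show ?thesis using t by simp
    qed simp
    have "ennreal (\<alpha> * \<beta>) = (\<integral>\<^sup>+ t. ennreal \<beta> * indicator {0<..<\<alpha>} t \<partial>lborel)"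
      using \<alpha> True by (simp add: nn_integral_cmult_indicator ennreal_mult'' mult.commute)
    also have "\<dots> \<le> (\<integral>\<^sup>+ t. ?F t \<partial>lborel)"
      by (intro nn_integral_mono pt)
    also have "\<dots> = (\<Sum>i\<in>I. ennreal (H i * d i) * ennreal (G i * d i))"
      using G(2) d(2) by (subst nn_integral_sum) (auto simp: nn_integral_cmult_indicator)
    also have "\<dots> = (\<Sum>i\<in>I. ennreal (G i * H i * (d i)\<^sup>2))"
      using G(2) d(2) H(2)
      by (intro sum.cong refl) (simp add: ennreal_mult''[symmetric] power2_eq_square ac_simps)
    also have "\<dots> = ennreal (\<Sum>i\<in>I. G i * H i * (d i)\<^sup>2)"
      using G(2) H(2) by (intro sum_ennreal) auto
    finally show ?thesis
      using G(2) H(2) by (subst (asm) ennreal_le_iff) (auto intro!: sum_nonneg)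
  qed
qed

section \<open>Covers and integrals\<close>

text \<open>Covers in the definition of Hausdorff measure consist of arbitrary sets, while
  compactness needs open ones. A small metric neighbourhood of the set costs arbitrarily little in
  the squared diameter.\<close>

lemma open_neighbourhood_diam:
  fixes S :: "'a::metric_space set"
  assumes S: "ediam S < ennreal \<delta>" and \<eta>: "0 < \<eta>"
  obtains V d where "open V" "S \<subseteq> V" "\<And>x y. x \<in> V \<Longrightarrow> y \<in> V \<Longrightarrow> dist x y \<le> d" "0 \<le> d" "d < \<delta>"
    "\<And>x. x \<in> V \<Longrightarrow> \<exists>y\<in>S. dist x y < \<delta>" "ennreal (d\<^sup>2) \<le> (ediam S)\<^sup>2 + ennreal \<eta>"
proof -
  define c where "c = enn2real (ediam S)"
  have c: "ediam S = ennreal c" "0 \<le> c"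
    using order.strict_trans[OF S ennreal_less_top] by (simp_all add: c_def)
  have \<delta>: "c < \<delta>" "0 < \<delta>"
    using S c by (auto simp: ennreal_less_iff)
  \<comment> \<open>The first bound keeps \<open>c + 2 * r\<close> strictly below
    \<open>\<delta>\<close>. The second one pays for the increase of the square, since 4cr + 4r^2
    \<le> 8\<delta>r once c and r are at most \<delta>.\<close>
  define r where "r = min ((\<delta> - c) / 3) (\<eta> / (8 * \<delta>))"
  have r: "0 < r" "r \<le> (\<delta> - c) / 3" "r \<le> \<eta> / (8 * \<delta>)"
    unfolding r_def using \<delta> \<eta> by (auto simp only: min.cobounded1 min.cobounded2) (auto simp: min_def)
  show ?thesis
  proof
    show "open (\<Union>y\<in>S. ball y r)" by auto
    show "S \<subseteq> (\<Union>y\<in>S. ball y r)" using r by auto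
    show "dist x y \<le> c + 2 * r" if xy: "x \<in> (\<Union>y\<in>S. ball y r)" "y \<in> (\<Union>y\<in>S. ball y r)" for x y
    proof -
      obtain x' y' where *: "x' \<in> S" "y' \<in> S" "dist x' x < r" "dist y' y < r"
        using xy by auto
      then have "dist x' y' \<le> c"
        using dist_le_ediam[of x' S y'] c by (simp add: ennreal_le_iff)
      then show ?thesis
        using * dist_triangle[of x y x'] dist_triangle[of x' y y'] by (simp add: dist_commute)
    qed
    show "0 \<le> c + 2 * r" "c + 2 * r < \<delta>" using r c \<delta> by auto
    have "r \<le> \<delta>" using r(2) \<delta> c by simp
    show "\<exists>y\<in>S. dist x y < \<delta>" if "x \<in> (\<Union>y\<in>S. ball y r)" for x
      using that \<open>r \<le> \<delta>\<close> by (auto simp: dist_commute intro: less_le_trans)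
    have "(c + 2 * r)\<^sup>2 = c\<^sup>2 + 4 * (c * r) + 4 * (r * r)" by (simp add: power2_eq_square algebra_simps)
    also have "\<dots> \<le> c\<^sup>2 + 4 * (\<delta> * r) + 4 * (\<delta> * r)"
      using \<delta> \<open>r \<le> \<delta>\<close> r by (intro add_mono mult_left_mono mult_right_mono) auto
    also have "\<dots> = c\<^sup>2 + 8 * \<delta> * r" by simp
    also have "8 * \<delta> * r \<le> \<eta>" using r(3) \<delta> by (simp add: field_simps)
    finally have "(c + 2 * r)\<^sup>2 \<le> c\<^sup>2 + \<eta>" by simp
    then have "ennreal ((c + 2 * r)\<^sup>2) \<le> ennreal (c\<^sup>2 + \<eta>)" by (rule ennreal_leI)
    then show "ennreal ((c + 2 * r)\<^sup>2) \<le> (ediam S)\<^sup>2 + ennreal \<eta>"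
      using \<eta> c by (simp add: ennreal_power)
  qed
qed

text \<open>The measure is the supremum over all scales, so it dominates the infimum at scale
  \<open>\<delta>\<close>; the factor 4/\<pi> undoes its normalization. One half of \<open>e\<close>
  pays for a nearly optimal cover, the other half, split geometrically, for making its sets
  open.\<close>

lemma hausdorff2_open_cover:
  fixes E :: "'a::metric_space set"
  assumes E: "E \<in> sets borel" "emeasure hausdorff2 E < \<infinity>" and e: "0 < e" and \<delta>: "0 < \<delta>"
  obtains V :: "nat \<Rightarrow> 'a set" and d where "E \<subseteq> (\<Union>i. V i)" "\<And>i. open (V i)"
    "\<And>i x y. x \<in> V i \<Longrightarrow> y \<in> V i \<Longrightarrow> dist x y \<le> d i" "\<And>i. 0 \<le> d i" "\<And>i. d i < \<delta>"
    "\<And>i x. x \<in> V i \<Longrightarrow> \<exists>y\<in>E. dist x y < \<delta>"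
    "(\<Sum>i. ennreal ((d i)\<^sup>2)) \<le> ennreal (4 / pi) * emeasure hausdorff2 E + ennreal e"
proof -
  define J where "J = (INF C\<in>{C :: nat \<Rightarrow> 'a set. E \<subseteq> (\<Union>i. C i) \<and> (\<forall>i. ediam (C i) < ennreal \<delta>)}.
        \<Sum>i. (ediam (C i))\<^sup>2)"
  let ?v = "ennreal (4 / pi) * emeasure hausdorff2 E"
  have "hausdorff2_pre \<delta> E \<le> emeasure hausdorff2 E"
    unfolding emeasure_hausdorff2[OF E(1)] hausdorff2_outer_SUP using \<delta> by (intro SUP_upper) auto
  then have "ennreal (4 / pi) * (ennreal (pi / 4) * J) \<le> ?v"
    unfolding hausdorff2_pre_def J_def by (rule mult_left_mono) simp
  moreover have "ennreal (4 / pi) * (ennreal (pi / 4) * J) = J"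
    by (simp add: mult.assoc[symmetric] ennreal_mult'[symmetric])
  ultimately have "J \<le> ?v" by simp
  also have "?v < ?v + ennreal (e / 2)"
    using E(2) e by (simp add: ennreal_mult_eq_top_iff less_top[symmetric])
  finally obtain C where C: "E \<subseteq> (\<Union>i. C i)" "\<And>i. ediam (C i) < ennreal \<delta>"
      "(\<Sum>i. (ediam (C i))\<^sup>2) < ?v + ennreal (e / 2)"
    unfolding J_def INF_less_iff by blast
  define \<eta> where "\<eta> i = e / 2 * (1 / 2) ^ Suc i" for i :: nat
  have \<eta>: "0 < \<eta> i" for i using e by (simp add: \<eta>_def)
  \<comment> \<open>Cutting the covering sets down to \<open>E\<close> before enlarging them keeps
    every new set within \<open>\<delta>\<close> of \<open>E\<close>; this matters later, when the
    weights on a cell are compared with their values near \<open>E\<close>.\<close>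
  have "\<exists>V d. open V \<and> C i \<inter> E \<subseteq> V \<and> (\<forall>x\<in>V. \<forall>y\<in>V. dist x y \<le> d) \<and> 0 \<le> d \<and> d < \<delta> \<and>
      (\<forall>x\<in>V. \<exists>y\<in>C i \<inter> E. dist x y < \<delta>) \<and> ennreal (d\<^sup>2) \<le> (ediam (C i \<inter> E))\<^sup>2 + ennreal (\<eta> i)" for i
  proof -
    have "ediam (C i \<inter> E) < ennreal \<delta>"
      using C(2)[of i] by (rule le_less_trans[OF ediam_mono, rotated]) auto
    from open_neighbourhood_diam[OF this \<eta>[of i]] show ?thesis by metis
  qed
  then obtain V d where V: "\<And>i. open (V i)" "\<And>i. C i \<inter> E \<subseteq> V i"
      "\<And>i x y. x \<in> V i \<Longrightarrow> y \<in> V i \<Longrightarrow> dist x y \<le> d i" "\<And>i. 0 \<le> d i" "\<And>i. d i < \<delta>"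
      "\<And>i x. x \<in> V i \<Longrightarrow> \<exists>y\<in>C i \<inter> E. dist x y < \<delta>"
      "\<And>i. ennreal ((d i)\<^sup>2) \<le> (ediam (C i \<inter> E))\<^sup>2 + ennreal (\<eta> i)"
    by metis
  have "(\<lambda>i. \<eta> i) sums (e / 2)"
    unfolding \<eta>_def using sums_mult[OF power_half_series, of "e / 2"] by simp
  then have \<eta>_sum: "(\<Sum>i. ennreal (\<eta> i)) = ennreal (e / 2)"
    by (intro suminf_ennreal_eq less_imp_le[OF \<eta>])
  have "(\<Sum>i. ennreal ((d i)\<^sup>2)) \<le> (\<Sum>i. (ediam (C i))\<^sup>2 + ennreal (\<eta> i))"
  proof (intro suminf_le)
    fix i
    have "(ediam (C i \<inter> E))\<^sup>2 \<le> (ediam (C i))\<^sup>2" by (intro power_mono ediam_mono) auto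
    with V(7)[of i] show "ennreal ((d i)\<^sup>2) \<le> (ediam (C i))\<^sup>2 + ennreal (\<eta> i)"
      by (meson add_right_mono order_trans)
  qed auto
  also have "\<dots> = (\<Sum>i. (ediam (C i))\<^sup>2) + ennreal (e / 2)"
    unfolding \<eta>_sum[symmetric] by (rule suminf_add[symmetric]) auto
  also have "\<dots> \<le> ?v + ennreal (e / 2) + ennreal (e / 2)"
    using C(3) by (intro add_right_mono) auto
  also have "\<dots> = ?v + ennreal e"
    using e by (simp add: add.assoc ennreal_plus[symmetric] del: ennreal_plus)
  finally have sum: "(\<Sum>i. ennreal ((d i)\<^sup>2)) \<le> ?v + ennreal e" .
  have "\<exists>y\<in>E. dist x y < \<delta>" if "x \<in> V i" for i x using V(6)[OF that] by fast
  moreover have "E \<subseteq> (\<Union>i. V i)"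
  proof
    fix x assume "x \<in> E"
    then obtain i where "x \<in> C i \<inter> E" using C(1) by blast
    then show "x \<in> (\<Union>i. V i)" using V(2)[of i] by blast
  qed
  ultimately show ?thesis by (intro that[of V d] V(1) V(3) V(4) V(5) sum) (assumption | blast)+
qed

section \<open>Hausdorff measure restricted to a set, kept on the Borel sets of the whole
  space\<close>

definition hausdorff2_on :: "'a::metric_space set \<Rightarrow> 'a measure" where
  "hausdorff2_on Q = density hausdorff2 (indicator Q)"

lemma sets_hausdorff2_on [simp, measurable_cong]: "sets (hausdorff2_on Q) = sets borel"
  by (simp add: hausdorff2_on_def)

lemma space_hausdorff2_on [simp]: "space (hausdorff2_on Q) = UNIV"
  by (simp add: hausdorff2_on_def)

lemma emeasure_hausdorff2_on:
  "Q \<in> sets borel \<Longrightarrow> E \<in> sets borel \<Longrightarrow> emeasure (hausdorff2_on Q) E = emeasure hausdorff2 (Q \<inter> E)"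
  unfolding hausdorff2_on_def
  by (subst emeasure_density) (auto simp: indicator_inter_arith[symmetric] intro: borel_measurable_indicator)

lemma nn_integral_hausdorff2_on:
  "Q \<in> sets borel \<Longrightarrow> f \<in> borel_measurable borel \<Longrightarrow>
    (\<integral>\<^sup>+x. f x \<partial>hausdorff2_on Q) = (\<integral>\<^sup>+x. indicator Q x * f x \<partial>hausdorff2)"
  unfolding hausdorff2_on_def by (subst nn_integral_density) auto

lemma hausdorff2_on_finite:
  assumes "locally_finite_measure (hausdorff2 :: 'a::metric_space measure)" "compact (Q :: 'a set)"
  shows "finite_measure (hausdorff2_on Q)"
proof
  have "\<forall>x. \<exists>U. open U \<and> x \<in> U \<and> emeasure (hausdorff2 :: 'a measure) U < \<infinity>"
    using assms(1) by (auto simp: locally_finite_measure_def)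
  then obtain U where U: "\<And>x :: 'a. open (U x)" "\<And>x. x \<in> U x" "\<And>x. emeasure hausdorff2 (U x) < \<infinity>"
    by metis
  obtain F where F: "F \<subseteq> Q" "finite F" "Q \<subseteq> (\<Union>x\<in>F. U x)"
    using compactE_image[OF assms(2), of Q U] U by blast
  have "emeasure hausdorff2 Q \<le> emeasure hausdorff2 (\<Union>x\<in>F. U x)"
    using U(1) F by (intro emeasure_mono) auto
  also have "\<dots> \<le> (\<Sum>x\<in>F. emeasure hausdorff2 (U x))"
    using U(1) F by (intro emeasure_subadditive_finite) auto
  also have "\<dots> < \<infinity>" using U(3) F(2) by (simp add: less_top[symmetric])
  finally show "emeasure (hausdorff2_on Q) (space (hausdorff2_on Q)) \<noteq> \<infinity>"
    using assms(2) by (simp add: emeasure_hausdorff2_on compact_imp_closed borel_closed)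
qed

text \<open>Young's inequality is applied to f and g divided by \<open>v powr (1 / p)\<close> and
  \<open>w powr (1 / q)\<close>. Normalizing by positive upper bounds instead of the norms
  themselves avoids the cases of zero or infinite norm.\<close>

lemma nn_integral_Holder:
  fixes f g :: "'a \<Rightarrow> real"
  assumes pq: "1 < p" "1 < q" "1 / p + 1 / q = 1"
    and meas: "f \<in> borel_measurable M" "g \<in> borel_measurable M"
    and nonneg: "\<And>x. 0 \<le> f x" "\<And>x. 0 \<le> g x" and vw: "0 < v" "0 < w"
    and f: "(\<integral>\<^sup>+x. ennreal (f x powr p) \<partial>M) \<le> ennreal v"
    and g: "(\<integral>\<^sup>+x. ennreal (g x powr q) \<partial>M) \<le> ennreal w"
  shows "(\<integral>\<^sup>+x. ennreal (f x * g x) \<partial>M) \<le> ennreal (v powr (1 / p) * w powr (1 / q))"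
proof -
  let ?c = "v powr (1 / p)" and ?d = "w powr (1 / q)"
  have young: "f x * g x \<le> ?c * ?d * (f x powr p / (p * v) + g x powr q / (q * w))" for x
  proof -
    have "(f x / ?c) * (g x / ?d) \<le> (f x / ?c) powr p / p + (g x / ?d) powr q / q"
      using pq nonneg by (intro Youngs_inequality) auto
    also have "\<dots> = f x powr p / (p * v) + g x powr q / (q * w)"
      using pq nonneg vw by (simp add: powr_divide powr_powr field_simps)
    finally show ?thesis using vw by (simp add: field_simps)
  qed
  have "(\<integral>\<^sup>+x. ennreal (f x * g x) \<partial>M) \<le>
      (\<integral>\<^sup>+x. ennreal (?c * ?d / (p * v)) * ennreal (f x powr p) + ennreal (?c * ?d / (q * w)) * ennreal (g x powr q) \<partial>M)"
  proof (rule nn_integral_mono)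
    fix x
    have "ennreal (f x * g x) \<le> ennreal (?c * ?d / (p * v) * (f x powr p) + ?c * ?d / (q * w) * (g x powr q))"
      using young[of x] by (intro ennreal_leI) (simp add: algebra_simps)
    also have "\<dots> = ennreal (?c * ?d / (p * v)) * ennreal (f x powr p) + ennreal (?c * ?d / (q * w)) * ennreal (g x powr q)"
      using pq vw
      by (subst ennreal_plus) (auto simp: ennreal_mult''[symmetric] simp del: times_divide_eq_left)
    finally show "ennreal (f x * g x) \<le> \<dots>" .
  qed
  also have "\<dots> = ennreal (?c * ?d / (p * v)) * (\<integral>\<^sup>+x. ennreal (f x powr p) \<partial>M) +
      ennreal (?c * ?d / (q * w)) * (\<integral>\<^sup>+x. ennreal (g x powr q) \<partial>M)"
    using meas by (simp add: nn_integral_add nn_integral_cmult)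
  also have "\<dots> \<le> ennreal (?c * ?d / (p * v)) * ennreal v + ennreal (?c * ?d / (q * w)) * ennreal w"
    by (intro add_mono mult_left_mono f g) auto
  also have "\<dots> = ennreal (?c * ?d * (1 / p + 1 / q))"
    using pq vw by (simp add: ennreal_mult''[symmetric] ennreal_plus[symmetric] field_simps del: ennreal_plus)
  finally show ?thesis using pq by simp
qed


text \<open>The compact set is cut into finitely many disjoint Borel pieces on which both functions
  are nearly constant, and each piece is covered separately. On each piece the sum of squared
  diameters is then multiplied by one constant, which can be compared with the integrand.\<close>

lemma finite_weighted_cover:
  fixes f g :: "'a::metric_space \<Rightarrow> real"
  assumes Q: "compact Q" and fin: "finite_measure (hausdorff2_on Q)"
    and cont: "continuous_on UNIV f" "continuous_on UNIV g"
    and nonneg: "\<And>x. 0 \<le> f x" "\<And>x. 0 \<le> g x" and e: "0 < e" and \<delta>: "0 < \<delta>"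
  obtains I :: "(nat \<times> nat) set" and V d G H where "finite I" "\<And>i. i \<in> I \<Longrightarrow> open (V i)" "Q \<subseteq> (\<Union>i\<in>I. V i)"
    "\<And>i x y. i \<in> I \<Longrightarrow> x \<in> V i \<inter> Q \<Longrightarrow> y \<in> V i \<inter> Q \<Longrightarrow> dist x y \<le> d i"
    "\<And>i. i \<in> I \<Longrightarrow> 0 \<le> d i" "\<And>i. i \<in> I \<Longrightarrow> d i < \<delta>"
    "\<And>i x. i \<in> I \<Longrightarrow> x \<in> V i \<inter> Q \<Longrightarrow> f x \<le> G i" "\<And>i. i \<in> I \<Longrightarrow> 0 \<le> G i"
    "\<And>i x. i \<in> I \<Longrightarrow> x \<in> V i \<inter> Q \<Longrightarrow> g x \<le> H i" "\<And>i. i \<in> I \<Longrightarrow> 0 \<le> H i"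
    "ennreal (\<Sum>i\<in>I. G i * H i * (d i)\<^sup>2) \<le>
      ennreal (4 / pi) * (\<integral>\<^sup>+x. ennreal ((f x + 2 * e) * (g x + 2 * e)) \<partial>hausdorff2_on Q) + ennreal e"
proof -
  interpret finite_measure "hausdorff2_on Q" by fact
  have Qb: "Q \<in> sets borel" using Q by (simp add: compact_imp_closed borel_closed)
  have "uniformly_continuous_on Q f" "uniformly_continuous_on Q g"
    using Q cont by (auto intro!: compact_uniformly_continuous intro: continuous_on_subset)
  then obtain s\<^sub>1 s\<^sub>2 where s: "0 < s\<^sub>1" "0 < s\<^sub>2"
      "\<And>x y. x \<in> Q \<Longrightarrow> y \<in> Q \<Longrightarrow> dist y x < s\<^sub>1 \<Longrightarrow> \<bar>f y - f x\<bar> < e"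
      "\<And>x y. x \<in> Q \<Longrightarrow> y \<in> Q \<Longrightarrow> dist y x < s\<^sub>2 \<Longrightarrow> \<bar>g y - g x\<bar> < e"
    using e unfolding uniformly_continuous_on_def dist_real_def by metis
  \<comment> \<open>A cell lies within r of its piece, and the piece within r of its centre. The
    bound on \<open>2 * r\<close> thus controls the oscillation over the whole cell.\<close>
  define r where "r = min \<delta> (min s\<^sub>1 s\<^sub>2 / 3)"
  have r: "0 < r" "r \<le> \<delta>" "2 * r < s\<^sub>1" "2 * r < s\<^sub>2"
    using s \<delta> by (auto simp: r_def min_def)
  have "Q \<subseteq> (\<Union>x\<in>Q. ball x r)" using r(1) by auto
  then obtain X where X: "X \<subseteq> Q" "finite X" "Q \<subseteq> (\<Union>x\<in>X. ball x r)"
    using compactE_image[OF Q, of Q "\<lambda>x. ball x r"] by (metis open_ball)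
  obtain N :: nat and x where x: "X = x ` {..<N}"
    using finite_imp_nat_seg_image_inj_on[OF X(2)] by (auto simp: lessThan_def)
  define B where "B n = (if n < N then Q \<inter> ball (x n) r else {})" for n
  define E where "E = disjointed B"
  have EB: "E n \<subseteq> B n" for n unfolding E_def by (rule disjointed_subset)
  have E_borel: "E n \<in> sets borel" for n
    unfolding E_def using Qb by (intro sets.range_disjointed_sets'[THEN subsetD, OF _ rangeI]) (auto simp: B_def)
  have E_disj: "disjoint_family E" unfolding E_def by (rule disjoint_family_disjointed)
  have E_un: "Q \<subseteq> (\<Union>n<N. E n)"
  proof
    fix z assume "z \<in> Q"
    moreover from this obtain n where "n < N" "z \<in> ball (x n) r" using X(3) x by blast
    ultimately have "z \<in> (\<Union>n. B n)" by (auto simp: B_def)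
    then obtain n where "z \<in> E n" using UN_disjointed_eq[of B] unfolding E_def by blast
    then show "z \<in> (\<Union>n<N. E n)" using EB[of n] by (auto simp: B_def split: if_splits)
  qed
  have EQ: "E n \<subseteq> Q" for n using EB[of n] by (auto simp: B_def split: if_splits)
  have E_fin: "emeasure hausdorff2 (E n) < \<infinity>" for n
  proof -
    have "emeasure (hausdorff2_on Q) (E n) < \<infinity>" by (simp add: emeasure_eq_measure)
    then show ?thesis using emeasure_hausdorff2_on[OF Qb E_borel] EQ by (simp add: Int_absorb1)
  qed
  \<comment> \<open>The values at the centre plus \<open>e\<close> bound the functions on the cells;
    on the piece itself they are at most \<open>f z + 2 * e\<close> and \<open>g z + 2 * e\<close>,
    whence the 2e in the integrand. The tolerance \<open>\<eta> n\<close> is chosen such that the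
    \<open>c n * \<eta> n\<close> add up to at most \<open>e\<close>.\<close>
  define c where "c n = (f (x n) + e) * (g (x n) + e)" for n
  define \<eta> where "\<eta> n = e / (real N * (c n + 1))" for n
  have c: "0 < c n" for n using nonneg e by (simp add: c_def add_nonneg_pos)
  have \<eta>: "0 < \<eta> n" if "n < N" for n
    using e c[of n] that by (auto simp: \<eta>_def intro!: divide_pos_pos mult_pos_pos)
  define good where "good n V d \<longleftrightarrow> E n \<subseteq> (\<Union>i. V i) \<and> (\<forall>i. open (V i)) \<and>
      (\<forall>i. \<forall>x\<in>V i. \<forall>y\<in>V i. dist x y \<le> d i) \<and> (\<forall>i::nat. 0 \<le> d i \<and> d i < r) \<and>
      (\<forall>i. \<forall>x\<in>V i. \<exists>y\<in>E n. dist x y < r) \<and>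
      (\<Sum>i. ennreal ((d i)\<^sup>2)) \<le> ennreal (4 / pi) * emeasure hausdorff2 (E n) + ennreal (\<eta> n)" for n V d
  have "\<exists>V d. good n V d" if n: "n < N" for n
  proof -
    obtain V :: "nat \<Rightarrow> 'a set" and d where "E n \<subseteq> (\<Union>i. V i)" "\<And>i. open (V i)"
      "\<And>i x y. x \<in> V i \<Longrightarrow> y \<in> V i \<Longrightarrow> dist x y \<le> d i" "\<And>i. 0 \<le> d i" "\<And>i. d i < r"
      "\<And>i x. x \<in> V i \<Longrightarrow> \<exists>y\<in>E n. dist x y < r"
      "(\<Sum>i. ennreal ((d i)\<^sup>2)) \<le> ennreal (4 / pi) * emeasure hausdorff2 (E n) + ennreal (\<eta> n)"
      by (rule hausdorff2_open_cover[OF E_borel[of n] E_fin \<eta>[OF n] r(1)]) (rule that; assumption)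
    then have "good n V d" unfolding good_def by blast
    then show ?thesis by blast
  qed
  then obtain V d where "\<And>n. n < N \<Longrightarrow> good n (V n) (d n)" by metis
  then have V: "\<And>n. n < N \<Longrightarrow> E n \<subseteq> (\<Union>i. V n i)" "\<And>n i. n < N \<Longrightarrow> open (V n i)"
      "\<And>n i x y. n < N \<Longrightarrow> x \<in> V n i \<Longrightarrow> y \<in> V n i \<Longrightarrow> dist x y \<le> d n i"
      "\<And>n i. n < N \<Longrightarrow> 0 \<le> d n i" "\<And>n i. n < N \<Longrightarrow> d n i < r"
      "\<And>n i x. n < N \<Longrightarrow> x \<in> V n i \<Longrightarrow> \<exists>y\<in>E n. dist x y < r"
      "\<And>n. n < N \<Longrightarrow> (\<Sum>i::nat. ennreal ((d n i)\<^sup>2)) \<le> ennreal (4 / pi) * emeasure hausdorff2 (E n) + ennreal (\<eta> n)"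
    by (simp_all add: good_def)
  have "\<exists>m. Q \<subseteq> (\<Union>i\<in>{..<N} \<times> {..<m}. case i of (n, j) \<Rightarrow> V n j)"
  proof -
    have "Q \<subseteq> (\<Union>i\<in>{..<N} \<times> UNIV. case i of (n, j) \<Rightarrow> V n j)"
    proof
      fix z assume "z \<in> Q"
      then obtain n where "n < N" "z \<in> E n" using E_un by blast
      moreover then obtain j where "z \<in> V n j" using V(1) by blast
      ultimately show "z \<in> (\<Union>i\<in>{..<N} \<times> UNIV. case i of (n, j) \<Rightarrow> V n j)"
        by (intro UN_I[of "(n, j)"]) auto
    qed
    moreover have "open (case i of (n, j) \<Rightarrow> V n j)" if "i \<in> {..<N} \<times> UNIV" for i
      using V(2) that by auto
    ultimately obtain I where I: "I \<subseteq> {..<N} \<times> UNIV" "finite I" "Q \<subseteq> (\<Union>i\<in>I. case i of (n, j) \<Rightarrow> V n j)"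
      using compactE_image[OF Q] by metis
    have "finite (snd ` I)" using I by simp
    then obtain m where "snd ` I \<subseteq> {..<m}" using finite_nat_iff_bounded by blast
    then have "I \<subseteq> {..<N} \<times> {..<m}" using I(1) by fastforce
    then show ?thesis using I(3) by blast
  qed
  then obtain m where m: "Q \<subseteq> (\<Union>i\<in>{..<N} \<times> {..<m}. case i of (n, j) \<Rightarrow> V n j)" ..
  have near: "dist z (x n) < 2 * r" "x n \<in> Q" if nz: "n < N" "z \<in> V n i" for n i z
  proof -
    obtain y where "y \<in> E n" "dist z y < r" using V(6)[OF nz] by blast
    moreover then have "dist y (x n) < r" using EB[of n] nz(1) by (auto simp: B_def dist_commute)
    ultimately show "dist z (x n) < 2 * r" using dist_triangle[of z "x n" y] by simp
    show "x n \<in> Q" using X(1) x nz(1) by auto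
  qed
  define \<phi> where "\<phi> = (\<lambda>x. ennreal ((f x + 2 * e) * (g x + 2 * e)))"
  have \<phi>: "\<phi> \<in> borel_measurable borel"
    unfolding \<phi>_def using cont[THEN borel_measurable_continuous_onI] by measurable
  have c_le: "ennreal (c n) * emeasure hausdorff2 (E n) \<le> emeasure (density hausdorff2 \<phi>) (E n)" if "n < N" for n
  proof -
    have "ennreal (c n) * emeasure hausdorff2 (E n) = (\<integral>\<^sup>+z. ennreal (c n) * indicator (E n) z \<partial>hausdorff2)"
      using E_borel by (simp add: nn_integral_cmult_indicator)
    also have "\<dots> \<le> (\<integral>\<^sup>+z. \<phi> z * indicator (E n) z \<partial>hausdorff2)"
    proof (intro nn_integral_mono)
      fix z
      show "ennreal (c n) * indicator (E n) z \<le> \<phi> z * indicator (E n) z"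
      proof (cases "z \<in> E n")
        case True
        then have "z \<in> Q" "dist z (x n) < r" using EB[of n] that by (auto simp: B_def dist_commute)
        moreover have "x n \<in> Q" using X(1) x that by auto
        ultimately have "\<bar>f z - f (x n)\<bar> < e" "\<bar>g z - g (x n)\<bar> < e" using s(3,4) r by auto
        then have "c n \<le> (f z + 2 * e) * (g z + 2 * e)"
          unfolding c_def using e nonneg by (intro mult_mono) (auto intro: add_nonneg_nonneg)
        then show ?thesis using True by (simp add: \<phi>_def ennreal_leI)
      qed simp
    qed
    also have "\<dots> = emeasure (density hausdorff2 \<phi>) (E n)"
      using \<phi> E_borel by (subst emeasure_density) auto
    finally show ?thesis .
  qed
  have \<eta>_sum: "(\<Sum>n<N. ennreal (c n) * ennreal (\<eta> n)) \<le> ennreal e"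
  proof -
    have "(\<Sum>n<N. ennreal (c n) * ennreal (\<eta> n)) \<le> (\<Sum>n<N. ennreal (e / real N))"
    proof (intro sum_mono)
      fix n assume "n \<in> {..<N}"
      have "c n * \<eta> n = e / real N * (c n / (c n + 1))" by (simp add: \<eta>_def)
      also have "\<dots> \<le> e / real N * 1"
        using c[of n] e by (intro mult_left_mono) auto
      finally have "c n * \<eta> n \<le> e / real N" by simp
      then show "ennreal (c n) * ennreal (\<eta> n) \<le> ennreal (e / real N)"
        using c[of n] by (simp add: ennreal_mult'[symmetric] ennreal_leI less_imp_le)
    qed
    also have "\<dots> \<le> ennreal e"
      using e by (subst sum_ennreal) (auto intro!: ennreal_leI simp: field_simps)
    finally show ?thesis .
  qed
  have "ennreal (\<Sum>i\<in>{..<N} \<times> {..<m}. (f (x (fst i)) + e) * (g (x (fst i)) + e) * (d (fst i) (snd i))\<^sup>2)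
      = (\<Sum>n<N. ennreal (c n) * (\<Sum>j<m. ennreal ((d n j)\<^sup>2)))"
  proof -
    have "ennreal (\<Sum>i\<in>{..<N} \<times> {..<m}. (f (x (fst i)) + e) * (g (x (fst i)) + e) * (d (fst i) (snd i))\<^sup>2)
        = (\<Sum>i\<in>{..<N} \<times> {..<m}. ennreal (c (fst i) * (d (fst i) (snd i))\<^sup>2))"
      unfolding c_def[symmetric] by (rule sum_ennreal[symmetric]) (simp add: c less_imp_le)
    also have "\<dots> = (\<Sum>i\<in>{..<N} \<times> {..<m}. case i of (n, j) \<Rightarrow> ennreal (c n) * ennreal ((d n j)\<^sup>2))"
      by (rule sum.cong) (auto simp: ennreal_mult'')
    also have "\<dots> = (\<Sum>n<N. \<Sum>j<m. ennreal (c n) * ennreal ((d n j)\<^sup>2))"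
      by (rule sum.cartesian_product[symmetric])
    finally show ?thesis by (simp only: sum_distrib_left)
  qed
  \<comment> \<open>Compactness has left \<open>m\<close> sets per piece, and a partial sum is at
    most the series.\<close>
  also have "\<dots> \<le> (\<Sum>n<N. ennreal (c n) * (ennreal (4 / pi) * emeasure hausdorff2 (E n) + ennreal (\<eta> n)))"
  proof (intro sum_mono mult_left_mono)
    fix n assume n: "n \<in> {..<N}"
    have "(\<Sum>j<m. ennreal ((d n j)\<^sup>2)) \<le> (\<Sum>j. ennreal ((d n j)\<^sup>2))" by (intro sum_le_suminf) auto
    also have "\<dots> \<le> ennreal (4 / pi) * emeasure hausdorff2 (E n) + ennreal (\<eta> n)" by (rule V(7)) (use n in simp)
    finally show "(\<Sum>j<m. ennreal ((d n j)\<^sup>2)) \<le> ennreal (4 / pi) * emeasure hausdorff2 (E n) + ennreal (\<eta> n)" .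
  qed simp
  also have "\<dots> = ennreal (4 / pi) * (\<Sum>n<N. ennreal (c n) * emeasure hausdorff2 (E n)) + (\<Sum>n<N. ennreal (c n) * ennreal (\<eta> n))"
    by (simp only: distrib_left sum.distrib sum_distrib_left mult.left_commute)
  also have "\<dots> \<le> ennreal (4 / pi) * (\<Sum>n<N. emeasure (density hausdorff2 \<phi>) (E n)) + ennreal e"
    by (intro add_mono mult_left_mono sum_mono c_le \<eta>_sum) auto
  also have "(\<Sum>n<N. emeasure (density hausdorff2 \<phi>) (E n)) = emeasure (density hausdorff2 \<phi>) (\<Union>n<N. E n)"
    using E_borel E_disj by (intro sum_emeasure) (auto simp: disjoint_family_on_def)
  also have "\<dots> \<le> emeasure (density hausdorff2 \<phi>) Q"
    using EQ Qb by (intro emeasure_mono) auto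
  also have "\<dots> = (\<integral>\<^sup>+x. \<phi> x \<partial>hausdorff2_on Q)"
    using \<phi> Qb by (simp add: emeasure_density nn_integral_hausdorff2_on mult.commute)
  finally have total: "ennreal (\<Sum>i\<in>{..<N} \<times> {..<m}. (f (x (fst i)) + e) * (g (x (fst i)) + e) * (d (fst i) (snd i))\<^sup>2)
      \<le> ennreal (4 / pi) * (\<integral>\<^sup>+x. \<phi> x \<partial>hausdorff2_on Q) + ennreal e"
    by (simp add: mult_left_mono add_right_mono)
  show ?thesis
  proof (rule that[of "{..<N} \<times> {..<m}" "\<lambda>i. V (fst i) (snd i)" "\<lambda>i. d (fst i) (snd i)"
      "\<lambda>i. f (x (fst i)) + e" "\<lambda>i. g (x (fst i)) + e"])
    fix i z assume i: "i \<in> {..<N} \<times> {..<m}" and z: "z \<in> V (fst i) (snd i) \<inter> Q"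
    then have "dist z (x (fst i)) < 2 * r" "x (fst i) \<in> Q" using near by auto
    then have "\<bar>f z - f (x (fst i))\<bar> < e" "\<bar>g z - g (x (fst i))\<bar> < e" using s(3,4) r z by auto
    then show "f z \<le> f (x (fst i)) + e" "g z \<le> g (x (fst i)) + e" by auto
  next
    fix i assume i: "i \<in> {..<N} \<times> {..<m}"
    then show "open (V (fst i) (snd i))" "0 \<le> d (fst i) (snd i)" using V(2,4) by auto
    show "d (fst i) (snd i) < \<delta>" using V(5)[of "fst i" "snd i"] i r(2) by auto
    show "0 \<le> f (x (fst i)) + e" "0 \<le> g (x (fst i)) + e" using nonneg e by (simp_all add: add_nonneg_nonneg)
    show "dist y z \<le> d (fst i) (snd i)" if "y \<in> V (fst i) (snd i) \<inter> Q" "z \<in> V (fst i) (snd i) \<inter> Q" for y z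
      using V(3)[of "fst i" y "snd i" z] that i by auto
  qed (use m total in \<open>simp_all add: \<phi>_def case_prod_unfold\<close>)
qed

text \<open>The discrete inequality with both distances equal to 1 is combined with covers of
  tolerance \<open>e\<close>, and \<open>e\<close> tends to 0. All errors are linear in
  \<open>e\<close> because the weights are bounded on the compact set \<open>Q\<close>, whose
  measure is finite.\<close>

lemma length_area:
  fixes h :: "real \<times> real \<Rightarrow> 'a::metric_space"
  assumes h: "continuous_on ({0..1} \<times> {0..1}) h" "h ` ({0..1} \<times> {0..1}) = Q"
    and fin: "finite_measure (hausdorff2_on Q)"
    and cont: "continuous_on UNIV f" "continuous_on UNIV g"
    and nonneg: "\<And>x. 0 \<le> f x" "\<And>x. 0 \<le> g x" and \<delta>: "0 < \<delta>"
    and long: "chains_long Q \<delta> f (h ` ({0} \<times> {0..1})) (h ` ({1} \<times> {0..1})) 1"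
      "chains_long Q \<delta> g (h ` ({0..1} \<times> {0})) (h ` ({0..1} \<times> {1})) 1"
  shows "ennreal (pi / 4) \<le> (\<integral>\<^sup>+x. ennreal (f x * g x) \<partial>hausdorff2_on Q)"
proof -
  interpret finite_measure "hausdorff2_on Q" by fact
  let ?M = "hausdorff2_on Q"
  have Q: "compact Q" using h by (auto intro!: compact_continuous_image compact_Times)
  have "compact (f ` Q)" "compact (g ` Q)"
    using Q cont by (auto intro!: compact_continuous_image intro: continuous_on_subset)
  then obtain m\<^sub>1 m\<^sub>2 where "\<And>x. x \<in> Q \<Longrightarrow> \<bar>f x\<bar> \<le> m\<^sub>1" "\<And>x. x \<in> Q \<Longrightarrow> \<bar>g x\<bar> \<le> m\<^sub>2"
    unfolding compact_eq_bounded_closed bounded_iff by auto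
  then obtain m where m: "\<And>x. x \<in> Q \<Longrightarrow> f x \<le> m" "\<And>x. x \<in> Q \<Longrightarrow> g x \<le> m" "0 \<le> m"
  proof (rule_tac that[of "max 0 (max m\<^sub>1 m\<^sub>2)"])
  qed force+
  \<comment> \<open>For \<open>e\<close> \<le> 1 and weights bounded by \<open>m\<close>, the
    product of \<open>f x + 2 * e\<close> and \<open>g x + 2 * e\<close> exceeds
    \<open>f x * g x\<close> by at most \<open>e * (4 * m + 4)\<close>. The summand 1 absorbs the
    additive error of the cover.\<close>
  define K where "K = 4 / pi * ((4 * m + 4) * measure ?M UNIV) + 1"
  have K: "0 < K" using m(3) by (auto simp: K_def intro!: add_nonneg_pos mult_nonneg_nonneg)
  have Qb: "Q \<in> sets borel" using Q by (simp add: compact_imp_closed borel_closed)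
  have meas [measurable]: "f \<in> borel_measurable borel" "g \<in> borel_measurable borel"
    using cont by (auto intro: borel_measurable_continuous_onI)
  have main: "1 \<le> ennreal (4 / pi) * (\<integral>\<^sup>+x. ennreal (f x * g x) \<partial>?M) + ennreal (e * K)"
    if e: "0 < e" "e \<le> 1" for e
  proof -
    obtain I :: "(nat \<times> nat) set" and V d G H where I: "finite I" "\<And>i. i \<in> I \<Longrightarrow> open (V i)" "Q \<subseteq> (\<Union>i\<in>I. V i)"
      "\<And>i x y. i \<in> I \<Longrightarrow> x \<in> V i \<inter> Q \<Longrightarrow> y \<in> V i \<inter> Q \<Longrightarrow> dist x y \<le> d i"
      "\<And>i. i \<in> I \<Longrightarrow> 0 \<le> d i" "\<And>i. i \<in> I \<Longrightarrow> d i < \<delta>"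
      "\<And>i x. i \<in> I \<Longrightarrow> x \<in> V i \<inter> Q \<Longrightarrow> f x \<le> G i" "\<And>i. i \<in> I \<Longrightarrow> 0 \<le> G i"
      "\<And>i x. i \<in> I \<Longrightarrow> x \<in> V i \<inter> Q \<Longrightarrow> g x \<le> H i" "\<And>i. i \<in> I \<Longrightarrow> 0 \<le> H i"
      "ennreal (\<Sum>i\<in>I. G i * H i * (d i)\<^sup>2) \<le>
        ennreal (4 / pi) * (\<integral>\<^sup>+x. ennreal ((f x + 2 * e) * (g x + 2 * e)) \<partial>?M) + ennreal e"
      by (rule finite_weighted_cover[OF Q fin cont nonneg e(1) \<delta>]) (rule that; assumption)
    have "1 * 1 \<le> (\<Sum>i\<in>I. G i * H i * (d i)\<^sup>2)"
      by (rule discrete_length_area[OF h _ _ long, where V = V]) (use nonneg I in auto)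
    then have "1 \<le> ennreal (\<Sum>i\<in>I. G i * H i * (d i)\<^sup>2)" by (simp add: ennreal_leI flip: ennreal_1)
    also note I(11)
    also have "(\<integral>\<^sup>+x. ennreal ((f x + 2 * e) * (g x + 2 * e)) \<partial>?M) \<le>
        (\<integral>\<^sup>+x. ennreal (f x * g x) + ennreal (e * (4 * m + 4)) \<partial>?M)"
    proof (subst (1 2) nn_integral_hausdorff2_on[OF Qb], measurable, intro nn_integral_mono)
      fix x
      show "indicator Q x * ennreal ((f x + 2 * e) * (g x + 2 * e)) \<le>
          indicator Q x * (ennreal (f x * g x) + ennreal (e * (4 * m + 4)))"
      proof (cases "x \<in> Q")
        case True
        have "e * f x \<le> e * m" "e * g x \<le> e * m" "e * e \<le> e * 1"
          using e m(1,2)[OF True] by (auto intro!: mult_left_mono)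
        then have "(f x + 2 * e) * (g x + 2 * e) \<le> f x * g x + e * (4 * m + 4)"
          by (simp add: algebra_simps)
        then have "ennreal ((f x + 2 * e) * (g x + 2 * e)) \<le> ennreal (f x * g x + e * (4 * m + 4))"
          by (rule ennreal_leI)
        with True show ?thesis using nonneg e m(3) by (simp add: ennreal_plus[symmetric] del: ennreal_plus)
      qed simp
    qed
    also have "\<dots> = (\<integral>\<^sup>+x. ennreal (f x * g x) \<partial>?M) + ennreal (e * (4 * m + 4) * measure ?M UNIV)"
      using e m(3) by (simp add: nn_integral_add emeasure_eq_measure ennreal_mult'')
    finally have "1 \<le> ennreal (4 / pi) * ((\<integral>\<^sup>+x. ennreal (f x * g x) \<partial>?M) + ennreal (e * (4 * m + 4) * measure ?M UNIV)) + ennreal e"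
      by (simp add: mult_left_mono add_right_mono)
    also have "\<dots> = ennreal (4 / pi) * (\<integral>\<^sup>+x. ennreal (f x * g x) \<partial>?M) + ennreal (e * K)"
      using e m(3) by (simp add: distrib_left add.assoc ennreal_mult''[symmetric] ennreal_plus[symmetric] K_def algebra_simps
          del: ennreal_plus)
    finally show ?thesis .
  qed
  have "1 \<le> ennreal (4 / pi) * (\<integral>\<^sup>+x. ennreal (f x * g x) \<partial>?M)"
  proof (rule ennreal_le_epsilon)
    fix e :: real assume e: "0 < e"
    have "1 \<le> ennreal (4 / pi) * (\<integral>\<^sup>+x. ennreal (f x * g x) \<partial>?M) + ennreal (min 1 (e / K) * K)"
      using e K by (intro main) auto
    also have "\<dots> \<le> ennreal (4 / pi) * (\<integral>\<^sup>+x. ennreal (f x * g x) \<partial>?M) + ennreal e"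
      using e K by (intro add_left_mono ennreal_leI) (auto simp: min_def field_simps)
    finally show "1 \<le> ennreal (4 / pi) * (\<integral>\<^sup>+x. ennreal (f x * g x) \<partial>?M) + ennreal e" .
  qed
  then have "ennreal (pi / 4) * 1 \<le> ennreal (pi / 4) * (ennreal (4 / pi) * (\<integral>\<^sup>+x. ennreal (f x * g x) \<partial>?M))"
    by (intro mult_left_mono) auto
  then show ?thesis by (simp add: mult.assoc[symmetric] ennreal_mult'[symmetric])
qed

section \<open>Lower semicontinuous majorants\<close>

text \<open>Approximating from inside and outside at once makes the property symmetric under
  complements, so it passes through the generation of the Borel sets. An open set is exhausted by
  the closed sets of points at a definite distance from its complement.\<close>

lemma finite_borel_measure_regular:
  fixes M :: "'a::metric_space measure"
  assumes "finite_measure M" and M: "sets M = sets borel" and E: "E \<in> sets borel" and e: "0 < e"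
  shows "\<exists>F U. closed F \<and> open U \<and> F \<subseteq> E \<and> E \<subseteq> U \<and> measure M (U - F) < e"
proof -
  interpret finite_measure M by fact
  have [measurable_cong]: "sets M = sets borel" by fact
  have cl: "closed F \<Longrightarrow> F \<in> sets M" and op: "open F \<Longrightarrow> F \<in> sets M" for F
    using M by auto
  have "E \<in> sigma_sets UNIV {S. open S}" using E by (simp add: borel_def)
  then show ?thesis using e
  proof (induction arbitrary: e)
    case (Basic S)
    then have S: "open S" by simp
    show ?case
    \<comment> \<open>The distance to an empty complement is 0 by convention, so the exhaustion
      below would be empty for the whole space.\<close>
    proof (cases "S = UNIV")
      case True
      then show ?thesis using Basic by (intro exI[of _ UNIV]) auto
    next
      case False
      define F where "F n = {x. 1 / real (Suc n) \<le> infdist x (- S)}" for n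
      have F: "closed (F n)" for n
        unfolding F_def by (intro closed_Collect_le continuous_intros)
      have F_sub: "F n \<subseteq> S" for n
      proof
        fix x assume "x \<in> F n"
        moreover have "(0::real) < 1 / real (Suc n)" by simp
        ultimately have "0 < infdist x (- S)" unfolding F_def mem_Collect_eq by linarith
        then show "x \<in> S" by (metis ComplI infdist_zero less_irrefl)
      qed
      have F_mono: "F m \<subseteq> F n" if "m \<le> n" for m n
      proof -
        have "1 / real (Suc n) \<le> 1 / real (Suc m)" using that by (simp add: frac_le)
        then show ?thesis by (auto simp: F_def simp del: of_nat_Suc)
      qed
      have "(\<Inter>n. S - F n) = {}"
      proof -
        have "\<exists>n. x \<in> F n" if "x \<in> S" for x
        proof -
          have "infdist x (- S) > 0"
            using S False that by (intro infdist_pos_not_in_closed) auto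
          then obtain n where "1 / real (Suc n) < infdist x (- S)" using nat_approx_posE by blast
          then show ?thesis by (auto simp: F_def intro: less_imp_le)
        qed
        then show ?thesis by auto
      qed
      moreover have "(\<lambda>n. measure M (S - F n)) \<longlonglongrightarrow> measure M (\<Inter>n. S - F n)"
        using F_mono by (intro finite_Lim_measure_decseq) (auto simp: decseq_def cl op F S)
      ultimately have "(\<lambda>n. measure M (S - F n)) \<longlonglongrightarrow> 0" by (simp only: measure_empty)
      then have "eventually (\<lambda>n. measure M (S - F n) < e) sequentially"
        using Basic(2) by (rule order_tendstoD)
      then obtain n where "measure M (S - F n) < e" by (auto simp: eventually_sequentially)
      then show ?thesis using S F F_sub by blast
    qed
  next
    case Empty
    then show ?case by (intro exI[of _ "{}"]) auto
  next
    case (Compl S)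
    from Compl.IH[OF Compl.prems] obtain F U
      where FU: "closed F" "open U" "F \<subseteq> S" "S \<subseteq> U" "measure M (U - F) < e" by blast
    have "- F - (- U) = U - F" by auto
    then show ?case using FU by (intro exI[of _ "- U"] exI[of _ "- F"]) (auto simp: closed_Compl open_Compl)
  next
    case (Union S)
    define d where "d i = e / 2 * (1 / 2) ^ Suc i" for i :: nat
    have d: "0 < d i" for i using Union(3) by (simp add: d_def)
    have "(\<lambda>i. d i) sums (e / 2)"
      unfolding d_def using sums_mult[OF power_half_series, of "e / 2"] by simp
    then have d_sum: "(\<Sum>i. ennreal (d i)) = ennreal (e / 2)"
      by (intro suminf_ennreal_eq less_imp_le[OF d])
    have "\<exists>F U. closed F \<and> open U \<and> F \<subseteq> S i \<and> S i \<subseteq> U \<and> measure M (U - F) < d i" for i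
      by (rule Union.IH[OF d])
    then obtain F U where FU: "\<And>i. closed (F i)" "\<And>i. open (U i)" "\<And>i. F i \<subseteq> S i" "\<And>i. S i \<subseteq> U i"
        "\<And>i. measure M (U i - F i) < d i" by metis
    have FM: "F i \<in> sets M" "U i \<in> sets M" for i using FU cl op by auto
    have 1: "measure M ((\<Union>i. U i) - (\<Union>i. F i)) \<le> e / 2"
    proof -
      have "emeasure M ((\<Union>i. U i) - (\<Union>i. F i)) \<le> emeasure M (\<Union>i. U i - F i)"
        using FM by (intro emeasure_mono) auto
      also have "\<dots> \<le> (\<Sum>i. emeasure M (U i - F i))"
        using FM by (intro emeasure_subadditive_countably) auto
      also have "\<dots> \<le> (\<Sum>i. ennreal (d i))"
        unfolding emeasure_eq_measure by (intro suminf_le ennreal_leI less_imp_le[OF FU(5)]) auto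
      finally show ?thesis
        using Union(3) unfolding d_sum emeasure_eq_measure by (subst (asm) ennreal_le_iff) auto
    qed
    \<comment> \<open>The union of all \<open>F i\<close> need not be closed. Finite unions are, and
      continuity from above makes the remainder smaller than the second half of
      \<open>e\<close>.\<close>
    define T where "T n = (\<Union>i\<le>n. F i)" for n
    have T: "closed (T n)" for n unfolding T_def using FU(1) by (intro closed_UN) auto
    have T_mono: "T m \<subseteq> T n" if "m \<le> n" for m n using that unfolding T_def by force
    have "(\<lambda>n. measure M ((\<Union>i. F i) - T n)) \<longlonglongrightarrow> measure M (\<Inter>n. (\<Union>i. F i) - T n)"
    proof (rule finite_Lim_measure_decseq)
      show "range (\<lambda>n. (\<Union>i. F i) - T n) \<subseteq> sets M" using FM T cl by auto
      show "decseq (\<lambda>n. (\<Union>i. F i) - T n)" using T_mono unfolding decseq_def by blast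
    qed
    moreover have "(\<Inter>n. (\<Union>i. F i) - T n) = {}" by (auto simp: T_def)
    ultimately have "(\<lambda>n. measure M ((\<Union>i. F i) - T n)) \<longlonglongrightarrow> 0" by (simp only: measure_empty)
    then have "eventually (\<lambda>n. measure M ((\<Union>i. F i) - T n) < e / 2) sequentially"
      using Union(3) by (intro order_tendstoD) auto
    then obtain n where n: "measure M ((\<Union>i. F i) - T n) < e / 2" by (auto simp: eventually_sequentially)
    have Tn: "T n \<in> sets M" using T cl by blast
    have "measure M ((\<Union>i. U i) - T n) \<le>
        measure M (((\<Union>i. U i) - (\<Union>i. F i)) \<union> ((\<Union>i. F i) - T n))"
      using FM Tn by (intro finite_measure_mono) auto
    also have "\<dots> \<le> measure M ((\<Union>i. U i) - (\<Union>i. F i)) + measure M ((\<Union>i. F i) - T n)"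
      using FM Tn by (intro measure_Un_le) auto
    also have "\<dots> < e" using 1 n by simp
    finally have "measure M ((\<Union>i. U i) - T n) < e" .
    moreover have "T n \<subseteq> (\<Union>i. S i)" using FU(3) unfolding T_def by blast
    moreover have "(\<Union>i. S i) \<subseteq> (\<Union>i. U i)" using FU(4) by blast
    moreover have "open (\<Union>i. U i)" using FU(2) by blast
    ultimately show ?case using T by (intro exI[of _ "T n"] exI[of _ "\<Union>i. U i"] conjI)
  qed
qed

text \<open>The sets \<open>U k\<close> approximate the superlevel sets \<open>{f > k s}\<close> from outside, and \<open>g n\<close> increases to
  the lower semicontinuous function with layers \<open>s\<close> on \<open>U k\<close>.\<close>

lemma vitali_caratheodory:
  fixes M :: "'a::metric_space measure" and f :: "'a \<Rightarrow> ennreal"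
  assumes "finite_measure M" and M: "sets M = sets borel" and f: "f \<in> borel_measurable borel" and e: "0 < e"
  obtains g :: "nat \<Rightarrow> 'a \<Rightarrow> real" where "\<And>n. continuous_on UNIV (g n)" "\<And>n x. 0 \<le> g n x"
    "\<And>x. incseq (\<lambda>n. g n x)" "\<And>x. f x \<le> (SUP n. ennreal (g n x))"
    "\<And>n. (\<integral>\<^sup>+x. ennreal (g n x) \<partial>M) \<le> (\<integral>\<^sup>+x. f x \<partial>M) + ennreal e"
proof -
  interpret finite_measure M by fact
  have [measurable_cong]: "sets M = sets borel" by fact
  \<comment> \<open>The layer height is chosen for two errors: discretizing \<open>f\<close> costs
    \<open>s\<close> times the total mass, and the excess of the open sets costs at most
    \<open>s\<close>, because their excess measures sum to at most 1.\<close>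
  define s where "s = e / (measure M (space M) + 1)"
  have s: "0 < s" "s * measure M (space M) + s = e"
  proof -
    have pos: "0 < measure M (space M) + 1" by (simp add: add_nonneg_pos)
    then show "0 < s" using e by (simp add: s_def)
    have "s * (measure M (space M) + 1) = e" using pos by (simp add: s_def)
    then show "s * measure M (space M) + s = e" by (simp add: algebra_simps)
  qed
  define E where "E k = {x. ennreal (real k * s) < f x}" for k
  have E: "E k \<in> sets borel" for k
    unfolding E_def using f by measurable
  have "\<exists>U. open U \<and> E k \<subseteq> U \<and> measure M (U - E k) < (1 / 2) ^ Suc k" for k
  proof -
    obtain F U where "closed F" "open U" "F \<subseteq> E k" "E k \<subseteq> U" "measure M (U - F) < (1 / 2) ^ Suc k"
      using finite_borel_measure_regular[OF assms(1) M E[of k], of "(1 / 2) ^ Suc k"] by auto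
    moreover then have "measure M (U - E k) \<le> measure M (U - F)"
      using M by (intro finite_measure_mono) auto
    ultimately show ?thesis by (meson le_less_trans)
  qed
  then obtain U where U: "\<And>k. open (U k)" "\<And>k. E k \<subseteq> U k" "\<And>k. measure M (U k - E k) < (1 / 2) ^ Suc k"
    by metis
  \<comment> \<open>Continuous functions that increase in \<open>n\<close> to the indicator of the
    open set \<open>U k\<close>; the whole space is again separate because of the convention for
    \<open>infdist\<close>.\<close>
  define \<phi> where "\<phi> k n x = (if U k = UNIV then 1 else min 1 (real n * infdist x (- U k)))" for k n x
  have \<phi>_cont: "continuous_on UNIV (\<phi> k n)" for k n
    by (cases "U k = UNIV") (auto simp: \<phi>_def[abs_def] intro!: continuous_intros)
  have \<phi>: "0 \<le> \<phi> k n x" "\<phi> k n x \<le> indicator (U k) x" for k n x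
    by (auto simp: \<phi>_def infdist_nonneg indicator_def)
  have \<phi>_mono: "\<phi> k m x \<le> \<phi> k n x" if "m \<le> n" for k m n x
  proof -
    have "real m * infdist x (- U k) \<le> real n * infdist x (- U k)"
      using that by (intro mult_right_mono) (auto simp: infdist_nonneg)
    then show ?thesis by (auto simp: \<phi>_def)
  qed
  have \<phi>_1: "\<exists>m. \<forall>n\<ge>m. \<phi> k n x = 1" if "x \<in> U k" for k x
  proof (cases "U k = UNIV")
    case False
    then have pos: "infdist x (- U k) > 0"
      using that U(1) by (intro infdist_pos_not_in_closed) auto
    then obtain m where m: "1 < real m * infdist x (- U k)" using reals_Archimedean3 by blast
    have "1 \<le> real n * infdist x (- U k)" if "n \<ge> m" for n
    proof -
      have "real m * infdist x (- U k) \<le> real n * infdist x (- U k)"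
        using that pos by (intro mult_right_mono) auto
      with m show ?thesis by simp
    qed
    then have "\<phi> k n x = 1" if "n \<ge> m" for n using that by (simp add: \<phi>_def min_absorb1)
    then show ?thesis by blast
  qed (simp add: \<phi>_def)
  \<comment> \<open>The index \<open>n\<close> counts the layers and also sets the steepness of each
    cut-off; both changes increase the sum.\<close>
  define g where "g n x = (\<Sum>k<n. s * \<phi> k n x)" for n x
  have g0: "0 \<le> g n x" for n x unfolding g_def using s \<phi> by (intro sum_nonneg) auto
  have g_mono: "g m x \<le> g n x" if "m \<le> n" for m n x
  proof -
    have "g m x \<le> (\<Sum>k<m. s * \<phi> k n x)"
      unfolding g_def using s \<phi>_mono[OF that] by (intro sum_mono mult_left_mono) auto
    also have "\<dots> \<le> g n x"
      unfolding g_def using that s \<phi> by (intro sum_mono2) auto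
    finally show ?thesis .
  qed
  have layers: "ennreal (s * real K) \<le> (SUP n. ennreal (g n x))" if "\<And>k. k < K \<Longrightarrow> x \<in> E k" for K x
  proof -
    have "\<forall>k. \<exists>m. k < K \<longrightarrow> (\<forall>n\<ge>m. \<phi> k n x = 1)" using that U(2) \<phi>_1 by blast
    then obtain m where m: "\<And>k n. k < K \<Longrightarrow> n \<ge> m k \<Longrightarrow> \<phi> k n x = 1" by metis
    define n where "n = K + (\<Sum>k<K. m k)"
    have "m k \<le> n" if "k < K" for k
      unfolding n_def using that member_le_sum[of k "{..<K}" m] by simp
    then have "s * real K = (\<Sum>k<K. s * \<phi> k n x)" using m by simp
    also have "\<dots> \<le> g n x" unfolding g_def using s \<phi> by (intro sum_mono2) (auto simp: n_def)
    finally have "ennreal (s * real K) \<le> ennreal (g n x)" by (rule ennreal_leI)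
    then show ?thesis by (rule SUP_upper2[rotated]) simp
  qed
  have f_le: "f x \<le> (SUP n. ennreal (g n x))" for x
  proof (rule dense_le)
    fix y assume y: "y < f x"
    then obtain r where r: "y = ennreal r" "0 \<le> r" by (cases y) auto
    define K where "K = nat \<lceil>r / s\<rceil>"
    have "x \<in> E k" if "k < K" for k
    proof -
      have "real k < r / s" using that by (auto simp: K_def) linarith
      then have "real k * s \<le> r" using s by (simp add: field_simps)
      then show ?thesis using y unfolding E_def r by (auto intro: le_less_trans ennreal_leI)
    qed
    moreover have "r / s \<le> real K" unfolding K_def by linarith
    then have "r \<le> s * real K" using s by (simp add: field_simps)
    then have "y \<le> ennreal (s * real K)" unfolding r by (rule ennreal_leI)
    ultimately show "y \<le> (SUP n. ennreal (g n x))" using layers order_trans by blast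
  qed
  \<comment> \<open>Layer \<open>k\<close> starts at height \<open>k * s\<close>, so the layers
    overestimate \<open>f\<close>, but by at most one height: if x lies in layer \<open>n\<close>,
    then \<open>n * s\<close> is already below \<open>f x\<close>.\<close>
  have cake: "(\<Sum>k<n. ennreal s * indicator (E k) x) \<le> f x + ennreal s" for n x
  proof (induction n)
    case (Suc n)
    show ?case
    proof (cases "x \<in> E n")
      case True
      have "(\<Sum>k<Suc n. ennreal s * indicator (E k) x) \<le> (\<Sum>k<Suc n. ennreal s)"
        by (intro sum_mono) (auto simp: indicator_def)
      also have "\<dots> = ennreal (real n * s) + ennreal s"
        using s by (simp add: ennreal_mult' ennreal_of_nat_eq_real_of_nat algebra_simps)
      also have "\<dots> \<le> f x + ennreal s" using True by (intro add_right_mono) (auto simp: E_def)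
      finally show ?thesis .
    qed (use Suc in simp)
  qed simp
  have int: "(\<integral>\<^sup>+x. ennreal (g n x) \<partial>M) \<le> (\<integral>\<^sup>+x. f x \<partial>M) + ennreal e" for n
  proof -
    have "(\<integral>\<^sup>+x. ennreal (g n x) \<partial>M) \<le>
        (\<integral>\<^sup>+x. (\<Sum>k<n. ennreal s * indicator (E k) x) + (\<Sum>k<n. ennreal s * indicator (U k - E k) x) \<partial>M)"
    proof (intro nn_integral_mono)
      fix x
      have "ennreal (g n x) = (\<Sum>k<n. ennreal (s * \<phi> k n x))"
        unfolding g_def using s \<phi> by (intro sum_ennreal[symmetric]) auto
      also have "\<dots> \<le> (\<Sum>k<n. ennreal s * indicator (E k) x + ennreal s * indicator (U k - E k) x)"
      proof (intro sum_mono)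
        fix k
        have "s * \<phi> k n x \<le> s * indicator (U k) x" using s \<phi> by (intro mult_left_mono) auto
        then have "ennreal (s * \<phi> k n x) \<le> ennreal (s * indicator (U k) x)" by (rule ennreal_leI)
        also have "\<dots> = ennreal s * indicator (E k) x + ennreal s * indicator (U k - E k) x"
          using U(2)[of k] by (auto simp: indicator_def)
        finally show "ennreal (s * \<phi> k n x) \<le> \<dots>" .
      qed
      finally show "ennreal (g n x) \<le> (\<Sum>k<n. ennreal s * indicator (E k) x) + (\<Sum>k<n. ennreal s * indicator (U k - E k) x)"
        by (simp add: sum.distrib)
    qed
    also have "\<dots> = (\<integral>\<^sup>+x. (\<Sum>k<n. ennreal s * indicator (E k) x) \<partial>M) + (\<Sum>k<n. ennreal s * emeasure M (U k - E k))"
    proof -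
      have [measurable]: "E k \<in> sets borel" "U k \<in> sets borel" for k using E U by auto
      show ?thesis
        by (subst nn_integral_add, measurable, subst (2) nn_integral_sum, measurable)
          (simp only: nn_integral_cmult_indicator M sets.Diff E borel_open U)
    qed
    also have "\<dots> \<le> (\<integral>\<^sup>+x. f x + ennreal s \<partial>M) + ennreal s"
    proof (intro add_mono nn_integral_mono cake)
      have "(\<Sum>k<n. ennreal s * emeasure M (U k - E k)) \<le> (\<Sum>k<n. ennreal s * ennreal ((1 / 2) ^ Suc k))"
        unfolding emeasure_eq_measure by (intro sum_mono mult_left_mono ennreal_leI less_imp_le[OF U(3)]) auto
      also have "\<dots> = ennreal s * ennreal (\<Sum>k<n. (1 / 2) ^ Suc k)"
        unfolding sum_distrib_left[symmetric] by (subst sum_ennreal) auto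
      also have "\<dots> \<le> ennreal s * ennreal 1"
      proof (intro mult_left_mono ennreal_leI)
        have "(\<Sum>k<n. (1 / 2) ^ Suc k) \<le> (\<Sum>k. (1 / 2 :: real) ^ Suc k)"
          using power_half_series by (intro sum_le_suminf) (auto simp: sums_iff)
        also have "\<dots> = 1" using power_half_series by (simp add: sums_iff)
        finally show "(\<Sum>k<n. (1 / 2) ^ Suc k) \<le> (1::real)" .
      qed simp
      finally show "(\<Sum>k<n. ennreal s * emeasure M (U k - E k)) \<le> ennreal s" by simp
    qed
    also have "\<dots> = (\<integral>\<^sup>+x. f x \<partial>M) + (ennreal (s * measure M (space M)) + ennreal s)"
      using f s by (subst nn_integral_add) (auto simp: emeasure_eq_measure ennreal_mult' add.assoc M)
    also have "\<dots> = (\<integral>\<^sup>+x. f x \<partial>M) + ennreal e"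
      using s by (simp add: ennreal_plus[symmetric] del: ennreal_plus)
    finally show ?thesis .
  qed
  show ?thesis
  proof (rule that[of g])
    show "continuous_on UNIV (g n)" for n
      unfolding g_def[abs_def] by (intro continuous_intros \<phi>_cont)
    show "incseq (\<lambda>n. g n x)" for x using g_mono by (auto simp: incseq_def)
  qed (use g0 f_le int in auto)
qed

section \<open>Arc length and line integrals\<close>

definition polygon_length :: "(real \<Rightarrow> 'a::metric_space) \<Rightarrow> real list \<Rightarrow> ennreal" where
  "polygon_length \<gamma> ts = (\<Sum>i<length ts - 1. ennreal (dist (\<gamma> (ts ! i)) (\<gamma> (ts ! Suc i))))"

lemma polygon_length_singleton [simp]: "polygon_length \<gamma> [x] = 0"
  by (simp add: polygon_length_def)

lemma polygon_length_snoc: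
  "polygon_length \<gamma> (ts @ [x, y]) = polygon_length \<gamma> (ts @ [x]) + ennreal (dist (\<gamma> x) (\<gamma> y))"
proof -
  have "(\<Sum>i<length ts. ennreal (dist (\<gamma> ((ts @ [x, y]) ! i)) (\<gamma> ((ts @ [x, y]) ! Suc i)))) =
      (\<Sum>i<length ts. ennreal (dist (\<gamma> ((ts @ [x]) ! i)) (\<gamma> ((ts @ [x]) ! Suc i))))"
  proof (rule sum.cong[OF HOL.refl])
    fix i assume "i \<in> {..<length ts}"
    then have "(ts @ [x, y]) ! i = (ts @ [x]) ! i" "(ts @ [x, y]) ! Suc i = (ts @ [x]) ! Suc i"
      by (auto simp: nth_append nth_Cons split: nat.splits)
    then show "ennreal (dist (\<gamma> ((ts @ [x, y]) ! i)) (\<gamma> ((ts @ [x, y]) ! Suc i))) =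
        ennreal (dist (\<gamma> ((ts @ [x]) ! i)) (\<gamma> ((ts @ [x]) ! Suc i)))" by simp
  qed
  then show ?thesis by (simp add: polygon_length_def nth_append)
qed

lemma polygon_length_append: "polygon_length \<gamma> ts \<le> polygon_length \<gamma> (ts @ [x])"
proof -
  have "polygon_length \<gamma> ts = (\<Sum>i<length ts - 1. ennreal (dist (\<gamma> ((ts @ [x]) ! i)) (\<gamma> ((ts @ [x]) ! Suc i))))"
    unfolding polygon_length_def by (intro sum.cong HOL.refl) (auto simp: nth_append)
  also have "\<dots> \<le> polygon_length \<gamma> (ts @ [x])"
    unfolding polygon_length_def by (intro sum_mono2) auto
  finally show ?thesis .
qed

lemma curve_length_eq:
  "curve_length a b \<gamma> = (SUP ts\<in>{ts. sorted ts \<and> set ts \<subseteq> {a..b}}. polygon_length \<gamma> ts)"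
  by (simp add: curve_length_def polygon_length_def)

lemma polygon_length_le:
  "sorted ts \<Longrightarrow> set ts \<subseteq> {a..b} \<Longrightarrow> polygon_length \<gamma> ts \<le> curve_length a b \<gamma>"
  unfolding curve_length_eq by (rule SUP_upper) auto

text \<open>Any subdivision of the shorter interval can be continued by t and t'.\<close>

lemma curve_length_dist_le:
  assumes "a \<le> t" "t \<le> t'"
  shows "curve_length a t \<gamma> + ennreal (dist (\<gamma> t) (\<gamma> t')) \<le> curve_length a t' \<gamma>"
proof -
  have "curve_length a t \<gamma> + ennreal (dist (\<gamma> t) (\<gamma> t')) =
      (SUP ts\<in>{ts. sorted ts \<and> set ts \<subseteq> {a..t}}. polygon_length \<gamma> ts + ennreal (dist (\<gamma> t) (\<gamma> t')))"
    unfolding curve_length_eq by (rule ennreal_SUP_add_left[symmetric]) (auto intro: exI[of _ "[]"])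
  also have "\<dots> \<le> curve_length a t' \<gamma>"
  proof (rule SUP_least)
    fix ts assume "ts \<in> {ts. sorted ts \<and> set ts \<subseteq> {a..t}}"
    then have "sorted (ts @ [t, t'])" "set (ts @ [t, t']) \<subseteq> {a..t'}"
      using assms by (auto simp: sorted_append)
    then have "polygon_length \<gamma> (ts @ [t, t']) \<le> curve_length a t' \<gamma>" by (rule polygon_length_le)
    moreover have "polygon_length \<gamma> ts + ennreal (dist (\<gamma> t) (\<gamma> t')) \<le> polygon_length \<gamma> (ts @ [t, t'])"
      unfolding polygon_length_snoc by (intro add_right_mono polygon_length_append)
    ultimately show "polygon_length \<gamma> ts + ennreal (dist (\<gamma> t) (\<gamma> t')) \<le> curve_length a t' \<gamma>" by simp
  qed
  finally show ?thesis .
qed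

lemma curve_length_refl: "curve_length a a \<gamma> = 0"
proof -
  have "polygon_length \<gamma> ts = 0" if "set ts \<subseteq> {a..a}" for ts
  proof -
    have "ts ! i = a" if "i < length ts" for i using \<open>set ts \<subseteq> {a..a}\<close> nth_mem[OF that] by auto
    then show ?thesis by (auto simp: polygon_length_def)
  qed
  then show ?thesis unfolding curve_length_eq by (intro antisym SUP_least) auto
qed

text \<open>Nothing is assumed about the curve before b. In a subdivision, the steps beyond b are
  paid for by the Lipschitz bound, and the part before b by the length up to b.\<close>

lemma curve_length_lipschitz:
  assumes "a \<le> b" "b \<le> b'" "0 \<le> K"
    and lip: "\<And>r r'. b \<le> r \<Longrightarrow> r \<le> r' \<Longrightarrow> r' \<le> b' \<Longrightarrow> dist (\<gamma> r) (\<gamma> r') \<le> K * (r' - r)"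
  shows "curve_length a b' \<gamma> \<le> curve_length a b \<gamma> + ennreal (K * (b' - b))"
proof -
  have claim: "polygon_length \<gamma> (ts @ [x]) \<le> curve_length a b \<gamma> + ennreal (K * (x - b))"
    if "b \<le> x" "sorted (ts @ [x])" "set (ts @ [x]) \<subseteq> {a..b'}" for ts x
    using that
  proof (induction ts arbitrary: x rule: rev_induct)
    case (snoc y ts)
    have ord: "sorted (ts @ [y])" "set (ts @ [y]) \<subseteq> {a..b'}" "y \<le> x" "x \<le> b'"
      using snoc.prems by (auto simp: sorted_append)
    show ?case
    proof (cases "b \<le> y")
      case True
      have "polygon_length \<gamma> ((ts @ [y]) @ [x]) = polygon_length \<gamma> (ts @ [y]) + ennreal (dist (\<gamma> y) (\<gamma> x))"
        using polygon_length_snoc[of \<gamma> ts y x] by simp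
      also have "\<dots> \<le> (curve_length a b \<gamma> + ennreal (K * (y - b))) + ennreal (K * (x - y))"
        using snoc.IH[OF True ord(1,2)] lip[OF True ord(3,4)] by (intro add_mono ennreal_leI)
      also have "\<dots> = curve_length a b \<gamma> + ennreal (K * (y - b) + K * (x - y))"
        using True ord assms(3) by (simp add: add.assoc)
      also have "K * (y - b) + K * (x - y) = K * (x - b)" by (simp add: algebra_simps)
      finally show ?thesis .
    next
      case False
      have "polygon_length \<gamma> ((ts @ [y]) @ [x]) = polygon_length \<gamma> (ts @ [y]) + ennreal (dist (\<gamma> y) (\<gamma> x))"
        using polygon_length_snoc[of \<gamma> ts y x] by simp
      \<comment> \<open>The step from y to x crosses b, so b is inserted; the subdivision ending in
        b then lies in the original interval.\<close>
      also have "\<dots> \<le> polygon_length \<gamma> (ts @ [y]) + ennreal (dist (\<gamma> y) (\<gamma> b) + dist (\<gamma> b) (\<gamma> x))"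
        by (intro add_left_mono ennreal_leI dist_triangle)
      also have "\<dots> = polygon_length \<gamma> (ts @ [y, b]) + ennreal (dist (\<gamma> b) (\<gamma> x))"
        by (simp add: polygon_length_snoc add.assoc)
      also have "\<dots> \<le> curve_length a b \<gamma> + ennreal (K * (x - b))"
      proof (intro add_mono ennreal_leI lip polygon_length_le)
        show "sorted (ts @ [y, b])" using ord False by (auto simp: sorted_append)
        show "set (ts @ [y, b]) \<subseteq> {a..b}"
          using ord False assms(1) by (force simp: sorted_append)
      qed (use snoc.prems ord in auto)
      finally show ?thesis .
    qed
  qed simp
  show ?thesis
    unfolding curve_length_eq[of a b']
  proof (rule SUP_least)
    fix ts assume "ts \<in> {ts. sorted ts \<and> set ts \<subseteq> {a..b'}}"
    then have "sorted (ts @ [b'])" "set (ts @ [b']) \<subseteq> {a..b'}"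
      using assms by (auto simp: sorted_append)
    from polygon_length_append claim[OF assms(2) this]
    show "polygon_length \<gamma> ts \<le> curve_length a b \<gamma> + ennreal (K * (b' - b))" by (rule order_trans)
  qed
qed

section \<open>Length function and line integrals of a Lipschitz curve\<close>

context
  fixes c K :: real and \<gamma> :: "real \<Rightarrow> 'a::metric_space"
  assumes c: "0 \<le> c" and K: "0 \<le> K"
    and lip: "\<And>s t. 0 \<le> s \<Longrightarrow> s \<le> t \<Longrightarrow> t \<le> c \<Longrightarrow> dist (\<gamma> s) (\<gamma> t) \<le> K * (t - s)"
begin

private definition \<l> :: "real \<Rightarrow> real" where "\<l> t = enn2real (curve_length 0 t \<gamma>)"

private lemma length_finite: "0 \<le> t \<Longrightarrow> t \<le> c \<Longrightarrow> curve_length 0 t \<gamma> = ennreal (\<l> t)"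
proof -
  assume t: "0 \<le> t" "t \<le> c"
  have "curve_length 0 t \<gamma> \<le> curve_length 0 0 \<gamma> + ennreal (K * (t - 0))"
    by (rule curve_length_lipschitz) (use t K lip in auto)
  also have "\<dots> < \<infinity>" by (simp add: curve_length_refl)
  finally show ?thesis by (simp add: \<l>_def less_top)
qed

private lemma \<l>_nonneg: "0 \<le> \<l> t" by (simp add: \<l>_def)

private lemma \<l>_0: "\<l> 0 = 0" by (simp add: \<l>_def curve_length_refl)

text \<open>The constant \<open>K'\<close> is local and may be much smaller than \<open>K\<close>:
  this is what relates the growth of length to the weight at a place.\<close>

private lemma \<l>_le:
  assumes "0 \<le> s" "s \<le> t" "t \<le> c" "0 \<le> K'"
    and "\<And>r r'. s \<le> r \<Longrightarrow> r \<le> r' \<Longrightarrow> r' \<le> t \<Longrightarrow> dist (\<gamma> r) (\<gamma> r') \<le> K' * (r' - r)"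
  shows "\<l> t \<le> \<l> s + K' * (t - s)"
proof -
  have "ennreal (\<l> t) \<le> ennreal (\<l> s) + ennreal (K' * (t - s))"
    using curve_length_lipschitz[of 0 s t K' \<gamma>] assms length_finite[of s] length_finite[of t] by auto
  also have "\<dots> = ennreal (\<l> s + K' * (t - s))"
    using assms by (simp add: \<l>_nonneg)
  finally show ?thesis using assms by (subst (asm) ennreal_le_iff) (auto simp: \<l>_nonneg)
qed

private lemma \<l>_dist:
  assumes "0 \<le> s" "s \<le> t" "t \<le> c"
  shows "dist (\<gamma> s) (\<gamma> t) \<le> \<l> t - \<l> s"
proof -
  have "ennreal (\<l> s + dist (\<gamma> s) (\<gamma> t)) \<le> ennreal (\<l> t)"
    using curve_length_dist_le[of 0 s t \<gamma>] assms length_finite[of s] length_finite[of t]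
    by (simp add: \<l>_nonneg)
  then show ?thesis by (subst (asm) ennreal_le_iff) (auto simp: \<l>_nonneg)
qed

private lemma \<l>_mono: "0 \<le> s \<Longrightarrow> s \<le> t \<Longrightarrow> t \<le> c \<Longrightarrow> \<l> s \<le> \<l> t"
  using \<l>_dist[of s t] zero_le_dist[of "\<gamma> s" "\<gamma> t"] by linarith

private lemma \<l>_continuous: "continuous_on {0..c} \<l>"
proof -
  have "\<bar>\<l> x - \<l> y\<bar> \<le> K * \<bar>x - y\<bar>" if "x \<in> {0..c}" "y \<in> {0..c}" for x y
    using that \<l>_le[of x y K] \<l>_le[of y x K] \<l>_mono[of x y] \<l>_mono[of y x] K lip
    by (cases "x \<le> y") (auto simp: abs_if)
  then have "K-lipschitz_on {0..c} \<l>"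
    using K by (intro lipschitz_onI) (auto simp: dist_real_def)
  then show ?thesis by (rule lipschitz_on_continuous_on)
qed

text \<open>By the intermediate value theorem the continuous length function attains every value up
  to the total length, so the choice in \<open>arclength_param\<close> has a witness.\<close>

private lemma arclength_param_eq:
  assumes "0 \<le> s" "s \<le> \<l> c"
  obtains t where "0 \<le> t" "t \<le> c" "\<l> t = s" "arclength_param 0 c \<gamma> s = \<gamma> t"
proof -
  define t where "t = (SOME t. t \<in> {0..c} \<and> curve_length 0 t \<gamma> = ennreal s)"
  have "\<exists>t\<ge>0. t \<le> c \<and> \<l> t = s"
    using assms c by (intro IVT' \<l>_continuous) (auto simp: \<l>_0)
  then have "\<exists>t. t \<in> {0..c} \<and> curve_length 0 t \<gamma> = ennreal s"
    using length_finite by auto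
  then have t: "t \<in> {0..c} \<and> curve_length 0 t \<gamma> = ennreal s" unfolding t_def by (rule someI_ex)
  then have "\<l> t = s" using assms by (simp add: \<l>_def)
  with t show ?thesis by (intro that[of t]) (auto simp: arclength_param_def t_def)
qed

text \<open>Length dominates distance, so the parametrization is 1-Lipschitz; this provides the
  measurability needed for monotone convergence.\<close>

private lemma arclength_param_continuous: "continuous_on {0..\<l> c} (arclength_param 0 c \<gamma>)"
proof -
  have *: "dist (arclength_param 0 c \<gamma> s) (arclength_param 0 c \<gamma> s') \<le> s' - s"
    if ss': "0 \<le> s" "s \<le> s'" "s' \<le> \<l> c" for s s'
  proof -
    obtain t where t: "0 \<le> t" "t \<le> c" "\<l> t = s" "arclength_param 0 c \<gamma> s = \<gamma> t"
      using arclength_param_eq[of s] ss' by auto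
    obtain t' where t': "0 \<le> t'" "t' \<le> c" "\<l> t' = s'" "arclength_param 0 c \<gamma> s' = \<gamma> t'"
      using arclength_param_eq[of s'] ss' by auto
    show ?thesis
      using \<l>_dist[of t t'] \<l>_dist[of t' t] t t' ss' by (cases "t \<le> t'") (auto simp: dist_commute)
  qed
  have "dist (arclength_param 0 c \<gamma> x) (arclength_param 0 c \<gamma> y) \<le> 1 * dist x y"
    if "x \<in> {0..\<l> c}" "y \<in> {0..\<l> c}" for x y
    using *[of x y] *[of y x] that by (cases "x \<le> y") (auto simp: dist_real_def dist_commute)
  then have "1-lipschitz_on {0..\<l> c} (arclength_param 0 c \<gamma>)" by (intro lipschitz_onI) auto
  then show ?thesis by (rule lipschitz_on_continuous_on)
qed

text \<open>The hypothesis \<open>speed\<close> says that the curve runs at speed at most 1/g to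
  first order, so the time \<open>c\<close> bounds its \<open>g\<close>-length. On short time
  intervals \<open>g\<close> is nearly constant and the curve is Lipschitz with a constant close to
  1/g.\<close>

private lemma line_integral_continuous_le:
  assumes g: "continuous_on UNIV g" "\<And>x. 0 \<le> g x"
    and speed: "\<And>e. 0 < e \<Longrightarrow> \<exists>\<tau>>0. \<forall>s t. 0 \<le> s \<longrightarrow> s \<le> t \<longrightarrow> t \<le> c \<longrightarrow> t - s \<le> \<tau> \<longrightarrow>
        g (\<gamma> s) * dist (\<gamma> s) (\<gamma> t) \<le> (1 + e) * (t - s)"
  shows "line_integral (\<lambda>x. ennreal (g x)) 0 c \<gamma> \<le> ennreal c"
proof (rule ennreal_le_epsilon)
  fix e' :: real assume e': "0 < e'"
  \<comment> \<open>The Riemann sum below comes out as \<open>(1 + e) * c + 2 * e * \<l> c\<close>,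
    which this choice makes at most \<open>c + e'\<close>.\<close>
  define e where "e = e' / (c + 2 * \<l> c + 1)"
  have e: "0 < e" "e * (c + 2 * \<l> c) \<le> e'"
  proof -
    have pos: "0 < c + 2 * \<l> c + 1" using c \<l>_nonneg[of c] by linarith
    then show e: "0 < e" using e' by (simp add: e_def)
    have "e * (c + 2 * \<l> c) \<le> e * (c + 2 * \<l> c + 1)" using e by (intro mult_left_mono) auto
    also have "\<dots> = e'" using pos by (simp add: e_def)
    finally show "e * (c + 2 * \<l> c) \<le> e'" .
  qed
  obtain \<tau>\<^sub>1 where \<tau>1: "\<tau>\<^sub>1 > 0" "\<And>s t. 0 \<le> s \<Longrightarrow> s \<le> t \<Longrightarrow> t \<le> c \<Longrightarrow> t - s \<le> \<tau>\<^sub>1 \<Longrightarrow>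
        g (\<gamma> s) * dist (\<gamma> s) (\<gamma> t) \<le> (1 + e) * (t - s)"
    using speed[OF e(1)] by blast
  have "K-lipschitz_on {0..c} \<gamma>"
  proof (rule lipschitz_onI)
    show "dist (\<gamma> x) (\<gamma> y) \<le> K * dist x y" if "x \<in> {0..c}" "y \<in> {0..c}" for x y
      using lip[of x y] lip[of y x] that by (cases "x \<le> y") (auto simp: dist_real_def dist_commute)
  qed (rule K)
  then have "continuous_on {0..c} \<gamma>" by (rule lipschitz_on_continuous_on)
  then have "continuous_on {0..c} (g \<circ> \<gamma>)"
    using g(1) by (intro continuous_on_compose) (auto intro: continuous_on_subset)
  then have "uniformly_continuous_on {0..c} (g \<circ> \<gamma>)" by (intro compact_uniformly_continuous) auto
  then obtain \<tau>\<^sub>2 where \<tau>2: "\<tau>\<^sub>2 > 0" "\<And>s t. s \<in> {0..c} \<Longrightarrow> t \<in> {0..c} \<Longrightarrow> dist t s < \<tau>\<^sub>2 \<Longrightarrow> \<bar>g (\<gamma> t) - g (\<gamma> s)\<bar> < e"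
    using e(1) unfolding uniformly_continuous_on_def dist_real_def o_def by metis
  define \<tau> where "\<tau> = min \<tau>\<^sub>1 (\<tau>\<^sub>2 / 2)"
  have \<tau>: "0 < \<tau>" "\<tau> \<le> \<tau>\<^sub>1" "\<tau> < \<tau>\<^sub>2" using \<tau>1 \<tau>2 by (auto simp: \<tau>_def min_def)
  obtain N where N: "c / \<tau> < real N" "0 < N"
    using reals_Archimedean2[of "c / \<tau>"] c \<tau> by (metis divide_nonneg_pos gr0I le_less_trans less_irrefl of_nat_0)
  define t where "t j = real j * (c / real N)" for j
  have t: "0 \<le> t j" "t j \<le> t (Suc j)" "t (Suc j) - t j = c / real N" for j
    using c by (auto simp: t_def algebra_simps add_divide_distrib)
  have t_le: "t j \<le> c" if "j \<le> N" for j
  proof -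
    have "t j = c * (real j / real N)" by (simp add: t_def)
    also have "\<dots> \<le> c * 1" using that N c by (intro mult_left_mono) auto
    finally show ?thesis by simp
  qed
  have t0N: "t 0 = 0" "t N = c" using N by (auto simp: t_def)
  have cN: "c / real N \<le> \<tau>" using N \<tau> c by (simp add: field_simps)
  have locate: "\<exists>j<n. t j \<le> r \<and> r \<le> t (Suc j)" if "0 \<le> r" "r \<le> t n" "0 < n" for r n
    using that
  proof (induction n)
    case (Suc n)
    show ?case
    proof (cases "r \<le> t n \<and> 0 < n")
      case True
      then show ?thesis using Suc by (auto intro: less_SucI)
    next
      case False
      then have "t n \<le> r" using Suc.prems t0N by auto
      then show ?thesis using Suc.prems by blast
    qed
  qed simp
  have piece: "(g (\<gamma> (t j)) + e) * (\<l> (t (Suc j)) - \<l> (t j)) \<le> (1 + e) * (c / real N) + 2 * e * (\<l> (t (Suc j)) - \<l> (t j))"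
    if j: "j < N" for j
  proof -
    \<comment> \<open>A lower bound for \<open>g\<close> along the piece; if it is positive,
      \<open>(1 + e) / m\<close> is a Lipschitz constant there. The upper bound for \<open>g\<close>
      is \<open>m + 2 * e\<close>, which explains the extra term in the claim.\<close>
    define m where "m = g (\<gamma> (t j)) - e"
    have in01: "t j \<in> {0..c}" "t (Suc j) \<le> c" using t t_le[of j] t_le[of "Suc j"] j by auto
    have d0: "0 \<le> \<l> (t (Suc j)) - \<l> (t j)" using \<l>_mono[of "t j" "t (Suc j)"] t in01 by auto
    have "m * (\<l> (t (Suc j)) - \<l> (t j)) \<le> (1 + e) * (c / real N)"
    proof (cases "0 < m")
      case True
      have "dist (\<gamma> r) (\<gamma> r') \<le> (1 + e) / m * (r' - r)" if r: "t j \<le> r" "r \<le> r'" "r' \<le> t (Suc j)" for r r'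
      proof -
        have "r \<in> {0..c}" "dist r (t j) < \<tau>\<^sub>2" "r' - r \<le> \<tau>\<^sub>1" "r' \<le> c"
          using r t[of j] in01 cN \<tau> by (auto simp: dist_real_def)
        then have "m \<le> g (\<gamma> r)" "g (\<gamma> r) * dist (\<gamma> r) (\<gamma> r') \<le> (1 + e) * (r' - r)"
          using \<tau>2(2)[of "t j" r] \<tau>1(2)[of r r'] in01 r by (auto simp: m_def)
        moreover from this have "m * dist (\<gamma> r) (\<gamma> r') \<le> g (\<gamma> r) * dist (\<gamma> r) (\<gamma> r')"
          by (intro mult_right_mono) auto
        ultimately have "m * dist (\<gamma> r) (\<gamma> r') \<le> (1 + e) * (r' - r)" by linarith
        then show ?thesis using True by (simp add: field_simps)
      qed
      then have "\<l> (t (Suc j)) \<le> \<l> (t j) + (1 + e) / m * (t (Suc j) - t j)"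
        using True e t in01 by (intro \<l>_le) auto
      then have "m * (\<l> (t (Suc j)) - \<l> (t j)) \<le> m * ((1 + e) / m * (c / real N))"
        using True unfolding t(3) by (intro mult_left_mono) auto
      then show ?thesis using True by simp
    next
      case False
      then have "m * (\<l> (t (Suc j)) - \<l> (t j)) \<le> 0" using d0 by (intro mult_nonpos_nonneg) auto
      also have "0 \<le> (1 + e) * (c / real N)" using e c by simp
      finally show ?thesis .
    qed
    then show ?thesis by (simp add: m_def algebra_simps)
  qed
  let ?I = "\<lambda>j. {\<l> (t j)..\<l> (t (Suc j))}"
  \<comment> \<open>The images of the pieces under the length function cover the range of
    integration. They may overlap at endpoints, which is harmless for an upper bound.\<close>
  have pt: "ennreal (g (arclength_param 0 c \<gamma> s)) * indicator {0..\<l> c} s \<le>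
      (\<Sum>j<N. ennreal (g (\<gamma> (t j)) + e) * indicator (?I j) s)" for s
  proof (cases "s \<in> {0..\<l> c}")
    case True
    then obtain r where r: "0 \<le> r" "r \<le> c" "\<l> r = s" "arclength_param 0 c \<gamma> s = \<gamma> r"
      using arclength_param_eq[of s] by auto
    obtain j where j: "j < N" "t j \<le> r" "r \<le> t (Suc j)" using locate[of r N] r t0N N by auto
    have "s \<in> ?I j" using \<l>_mono[of "t j" r] \<l>_mono[of r "t (Suc j)"] r j t t_le[of "Suc j"] by auto
    have "dist r (t j) < \<tau>\<^sub>2" using j t(3)[of j] cN \<tau> by (auto simp: dist_real_def)
    then have "g (\<gamma> r) \<le> g (\<gamma> (t j)) + e"
      using \<tau>2(2)[of "t j" r] r t t_le[of j] j by auto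
    then have "ennreal (g (\<gamma> r)) \<le> ennreal (g (\<gamma> (t j)) + e) * indicator (?I j) s"
      using \<open>s \<in> ?I j\<close> by (simp add: ennreal_leI)
    also have "\<dots> \<le> (\<Sum>j<N. ennreal (g (\<gamma> (t j)) + e) * indicator (?I j) s)"
      using j by (intro member_le_sum) auto
    finally show ?thesis using True r by simp
  qed simp
  have "line_integral (\<lambda>x. ennreal (g x)) 0 c \<gamma> =
      (\<integral>\<^sup>+s. ennreal (g (arclength_param 0 c \<gamma> s)) * indicator {0..\<l> c} s \<partial>lborel)"
    by (simp add: line_integral_def \<l>_def)
  also have "\<dots> \<le> (\<integral>\<^sup>+s. (\<Sum>j<N. ennreal (g (\<gamma> (t j)) + e) * indicator (?I j) s) \<partial>lborel)"
    by (intro nn_integral_mono pt)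
  also have "\<dots> = (\<Sum>j<N. ennreal (g (\<gamma> (t j)) + e) * emeasure lborel (?I j))"
    by (subst nn_integral_sum) (auto simp: nn_integral_cmult_indicator)
  also have "\<dots> = (\<Sum>j<N. ennreal ((g (\<gamma> (t j)) + e) * (\<l> (t (Suc j)) - \<l> (t j))))"
  proof (rule sum.cong[OF HOL.refl])
    fix j assume "j \<in> {..<N}"
    then have "\<l> (t j) \<le> \<l> (t (Suc j))" using \<l>_mono[of "t j" "t (Suc j)"] t t_le[of "Suc j"] by auto
    then show "ennreal (g (\<gamma> (t j)) + e) * emeasure lborel (?I j) = ennreal ((g (\<gamma> (t j)) + e) * (\<l> (t (Suc j)) - \<l> (t j)))"
      using g(2)[of "\<gamma> (t j)"] e(1) by (simp add: ennreal_mult)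
  qed
  also have "\<dots> \<le> (\<Sum>j<N. ennreal ((1 + e) * (c / real N) + 2 * e * (\<l> (t (Suc j)) - \<l> (t j))))"
    by (intro sum_mono ennreal_leI piece) auto
  also have "\<dots> = ennreal (\<Sum>j<N. (1 + e) * (c / real N) + 2 * e * (\<l> (t (Suc j)) - \<l> (t j)))"
  proof (rule sum_ennreal)
    fix j assume "j \<in> {..<N}"
    then have "\<l> (t j) \<le> \<l> (t (Suc j))" using \<l>_mono[of "t j" "t (Suc j)"] t t_le[of "Suc j"] by auto
    then show "0 \<le> (1 + e) * (c / real N) + 2 * e * (\<l> (t (Suc j)) - \<l> (t j))" using e c by simp
  qed
  also have "(\<Sum>j<N. (1 + e) * (c / real N) + 2 * e * (\<l> (t (Suc j)) - \<l> (t j))) = (1 + e) * c + 2 * e * \<l> c"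
    using N sum_lessThan_telescope[of "\<lambda>j. \<l> (t j)" N]
    by (simp add: sum.distrib sum_distrib_left[symmetric] t0N \<l>_0)
  also have "ennreal \<dots> \<le> ennreal (c + e')" using e by (intro ennreal_leI) (simp add: algebra_simps)
  also have "\<dots> = ennreal c + ennreal e'" using c e' by simp
  finally show "line_integral (\<lambda>x. ennreal (g x)) 0 c \<gamma> \<le> ennreal c + ennreal e'" .
qed

text \<open>Each continuous weight has integral at most \<open>c\<close>, and monotone convergence
  along the arc length parametrization carries this to their supremum, hence to every function below
  it on the curve.\<close>

lemma line_integral_SUP_le:
  assumes g: "\<And>n. continuous_on UNIV (g n)" "\<And>n x. 0 \<le> g n x" "\<And>x. incseq (\<lambda>n. g n x)"
    and speed: "\<And>n e. 0 < e \<Longrightarrow> \<exists>\<tau>>0. \<forall>s t. 0 \<le> s \<longrightarrow> s \<le> t \<longrightarrow> t \<le> c \<longrightarrow> t - s \<le> \<tau> \<longrightarrow>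
        g n (\<gamma> s) * dist (\<gamma> s) (\<gamma> t) \<le> (1 + e) * (t - s)"
    and \<rho>: "\<And>t. 0 \<le> t \<Longrightarrow> t \<le> c \<Longrightarrow> \<rho> (\<gamma> t) \<le> (SUP n. ennreal (g n (\<gamma> t)))"
  shows "line_integral \<rho> 0 c \<gamma> \<le> ennreal c" "curve_length 0 c \<gamma> < \<infinity>"
proof -
  show "curve_length 0 c \<gamma> < \<infinity>" using length_finite[of c] c by simp
  let ?\<alpha> = "arclength_param 0 c \<gamma>" and ?L = "{0..\<l> c}"
  have "line_integral \<rho> 0 c \<gamma> = (\<integral>\<^sup>+s. \<rho> (?\<alpha> s) * indicator ?L s \<partial>lborel)"
    by (simp add: line_integral_def \<l>_def)
  also have "\<dots> \<le> (\<integral>\<^sup>+s. (SUP n. ennreal (g n (?\<alpha> s)) * indicator ?L s) \<partial>lborel)"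
  proof (intro nn_integral_mono)
    fix s
    show "\<rho> (?\<alpha> s) * indicator ?L s \<le> (SUP n. ennreal (g n (?\<alpha> s)) * indicator ?L s)"
    proof (cases "s \<in> ?L")
      case True
      then obtain t where "0 \<le> t" "t \<le> c" "?\<alpha> s = \<gamma> t" using arclength_param_eq[of s] by auto
      then show ?thesis using \<rho>[of t] True by simp
    qed simp
  qed
  also have "\<dots> = (SUP n. (\<integral>\<^sup>+s. ennreal (g n (?\<alpha> s)) * indicator ?L s \<partial>lborel))"
  proof (rule nn_integral_monotone_convergence_SUP)
    show "incseq (\<lambda>n s. ennreal (g n (?\<alpha> s)) * indicator ?L s)"
      using g(3) by (intro monoI le_funI mult_right_mono ennreal_leI) (auto simp: incseq_def)
    fix n
    have "continuous_on ?L (\<lambda>s. g n (?\<alpha> s))"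
      by (rule continuous_on_compose2[OF g(1) arclength_param_continuous]) auto
    then have "(\<lambda>s. indicator ?L s *\<^sub>R g n (?\<alpha> s)) \<in> borel_measurable borel"
      by (intro borel_measurable_continuous_on_indicator) auto
    then have "(\<lambda>s. ennreal (indicator ?L s *\<^sub>R g n (?\<alpha> s))) \<in> borel_measurable borel" by measurable
    also have "(\<lambda>s. ennreal (indicator ?L s *\<^sub>R g n (?\<alpha> s))) = (\<lambda>s. ennreal (g n (?\<alpha> s)) * indicator ?L s)"
      by (auto simp: indicator_def fun_eq_iff)
    finally show "(\<lambda>s. ennreal (g n (?\<alpha> s)) * indicator ?L s) \<in> borel_measurable lborel" by simp
  qed
  also have "\<dots> = (SUP n. line_integral (\<lambda>x. ennreal (g n x)) 0 c \<gamma>)"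
    by (simp add: line_integral_def \<l>_def)
  also have "\<dots> \<le> ennreal c"
    by (intro SUP_least line_integral_continuous_le g speed)
  finally show "line_integral \<rho> 0 c \<gamma> \<le> ennreal c" .
qed

end

section \<open>Limits of short chains\<close>

text \<open>Tychonoff's theorem gives a cluster point of the sequence in the product of copies of
  \<open>Q\<close>. The maps may jump and the index set may be uncountable, so no convergent
  subsequence is claimed; since later estimates compare two parameters at a time, closeness at two
  coordinates for arbitrarily late \<open>n\<close> suffices.\<close>

lemma pointwise_cluster:
  fixes \<phi> :: "nat \<Rightarrow> 'b \<Rightarrow> 'a::metric_space"
  assumes Q: "compact Q" and \<phi>: "\<And>n r. \<phi> n r \<in> Q"
  obtains \<gamma> where "\<And>r. \<gamma> r \<in> Q"
    "\<And>s t \<epsilon> N. 0 < \<epsilon> \<Longrightarrow> \<exists>n\<ge>N. dist (\<phi> n s) (\<gamma> s) < \<epsilon> \<and> dist (\<phi> n t) (\<gamma> t) < \<epsilon>"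
proof -
  have "compactin (product_topology (\<lambda>_. euclidean) UNIV) (PiE UNIV (\<lambda>_ :: 'b. Q))"
    using Q by (simp add: compactin_PiE)
  then have "compact (PiE UNIV (\<lambda>_ :: 'b. Q))"
    by (simp add: euclidean_product_topology)
  moreover have "filtermap \<phi> sequentially \<noteq> bot"
    by (simp add: filtermap_bot_iff)
  moreover have "eventually (\<lambda>x. x \<in> PiE UNIV (\<lambda>_. Q)) (filtermap \<phi> sequentially)"
    using \<phi> by (simp add: eventually_filtermap PiE_UNIV_domain)
  ultimately obtain \<gamma> where \<gamma>: "\<gamma> \<in> PiE UNIV (\<lambda>_. Q)" "inf (nhds \<gamma>) (filtermap \<phi> sequentially) \<noteq> bot"
    unfolding compact_filter by blast
  show ?thesis
  proof (rule that)
    show "\<gamma> r \<in> Q" for r using \<gamma>(1) by auto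
    show "\<exists>n\<ge>N. dist (\<phi> n s) (\<gamma> s) < \<epsilon> \<and> dist (\<phi> n t) (\<gamma> t) < \<epsilon>" if "0 < \<epsilon>" for s t \<epsilon> N
    proof (rule ccontr)
      assume no: "\<not> ?thesis"
      have "eventually (\<lambda>\<psi>. dist (\<psi> r) (\<gamma> r) < \<epsilon>) (nhds \<gamma>)" for r
      proof -
        have "open ((\<lambda>\<psi> :: 'b \<Rightarrow> 'a. \<psi> r) -` ball (\<gamma> r) \<epsilon>)"
          by (intro open_vimage open_ball continuous_on_product_coordinates)
        then show ?thesis
          unfolding eventually_nhds using \<open>0 < \<epsilon>\<close> by (intro exI[of _ "(\<lambda>\<psi>. \<psi> r) -` ball (\<gamma> r) \<epsilon>"]) (auto simp: dist_commute)
      qed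
      then have 1: "eventually (\<lambda>\<psi>. dist (\<psi> s) (\<gamma> s) < \<epsilon> \<and> dist (\<psi> t) (\<gamma> t) < \<epsilon>) (nhds \<gamma>)"
        by (intro eventually_conj)
      have 2: "eventually (\<lambda>\<psi>. \<not> (dist (\<psi> s) (\<gamma> s) < \<epsilon> \<and> dist (\<psi> t) (\<gamma> t) < \<epsilon>)) (filtermap \<phi> sequentially)"
        unfolding eventually_filtermap eventually_sequentially using no by blast
      have "eventually (\<lambda>_. False) (inf (nhds \<gamma>) (filtermap \<phi> sequentially))"
        unfolding eventually_inf using 1 2 by blast
      then show False using \<gamma>(2) by (simp add: eventually_False)
    qed
  qed
qed

text \<open>The chain is run through at speed \<open>1 / g\<close>, resting at \<open>y\<close> while the step from \<open>y\<close> to \<open>z\<close> is pending.\<close>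

lemma chain_parametrization:
  assumes "chain Q \<delta> g x W y" and g: "\<And>z. z \<in> Q \<Longrightarrow> 0 < g z" "\<And>z. z \<in> Q \<Longrightarrow> g z * \<delta> \<le> \<kappa>" and \<kappa>: "0 \<le> \<kappa>"
  shows "\<exists>\<phi>. (\<forall>r. \<phi> r \<in> Q) \<and> \<phi> 0 = x \<and> (\<forall>r\<ge>W. \<phi> r = y) \<and>
    (\<forall>s t m. 0 \<le> s \<longrightarrow> s \<le> t \<longrightarrow> 0 \<le> m \<longrightarrow> (\<forall>r\<in>{s..t}. m \<le> g (\<phi> r)) \<longrightarrow> m * dist (\<phi> s) (\<phi> t) \<le> t - s + \<kappa>)"
  using assms(1)
proof (induction rule: chain.induct)
  case chain_refl
  then show ?case using \<kappa> by (intro exI[of _ "\<lambda>_. x"]) auto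
next
  case (chain_step W y z)
  obtain \<phi> where *: "(\<forall>r. \<phi> r \<in> Q) \<and> \<phi> 0 = x \<and> (\<forall>r\<ge>W. \<phi> r = y) \<and>
    (\<forall>s t m. 0 \<le> s \<longrightarrow> s \<le> t \<longrightarrow> 0 \<le> m \<longrightarrow> (\<forall>r\<in>{s..t}. m \<le> g (\<phi> r)) \<longrightarrow> m * dist (\<phi> s) (\<phi> t) \<le> t - s + \<kappa>)"
    using chain_step.IH by blast
  then have \<phi>: "\<And>r. \<phi> r \<in> Q" "\<phi> 0 = x" "\<And>r. W \<le> r \<Longrightarrow> \<phi> r = y" by auto
  have \<phi>_speed: "m * dist (\<phi> s) (\<phi> t) \<le> t - s + \<kappa>"
    if "0 \<le> s" "s \<le> t" "0 \<le> m" "\<And>r. s \<le> r \<Longrightarrow> r \<le> t \<Longrightarrow> m \<le> g (\<phi> r)" for s t m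
    using * that by simp
  have W: "0 \<le> W" using chain_nonneg[OF chain_step.hyps(1)] g(1) by (simp add: less_imp_le)
  have y: "y \<in> Q" by (rule chain_end_in[OF chain_step.hyps(1)])
  define w where "w = g y * dist y z"
  have w: "0 \<le> w" "w \<le> \<kappa>"
  proof -
    show "0 \<le> w" using g(1)[OF y] by (simp add: w_def)
    have "w \<le> g y * \<delta>" unfolding w_def using g(1)[OF y] chain_step.hyps by (intro mult_left_mono) auto
    then show "w \<le> \<kappa>" using g(2)[OF y] by simp
  qed
  show ?case
  proof (cases "w = 0")
    case True
    then have "y = z" using g(1)[OF y] by (simp add: w_def)
    then show ?thesis using chain_step.IH True by (simp add: w_def)
  next
    case False
    with w have w0: "0 < w" by simp
    define \<psi> where "\<psi> r = (if r < W + w then \<phi> r else z)" for r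
    have "m * dist (\<psi> s) (\<psi> t) \<le> t - s + \<kappa>"
      if st: "0 \<le> s" "s \<le> t" and m: "0 \<le> m" "\<forall>r\<in>{s..t}. m \<le> g (\<psi> r)" for s t m
    proof -
      \<comment> \<open>The error \<open>\<kappa>\<close> does not accumulate along the chain. In
        the second case the new step is paid for in full by the time \<open>w\<close>, and only the
        error of the earlier part remains; in the third case the pause began before
        \<open>s\<close>, and the jump alone costs at most \<open>w\<close>, hence at most
        \<open>\<kappa>\<close>.\<close>
      consider "t < W + w" | "s \<le> W" "W + w \<le> t" | "W < s" "s < W + w" "W + w \<le> t" | "W + w \<le> s"
        using st by linarith
      then show ?thesis
      proof cases
        case 1
        then have "m \<le> g (\<phi> r)" if "s \<le> r" "r \<le> t" for r using m(2) that by (auto simp: \<psi>_def)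
        with \<phi>_speed[OF st m(1)] 1 st show ?thesis by (simp add: \<psi>_def)
      next
        case 2
        then have "m \<le> g (\<phi> r)" if "s \<le> r" "r \<le> W" for r
        proof -
          have "r \<in> {s..t}" "r < W + w" using that 2 w0 by auto
          with m(2) show ?thesis by (auto simp: \<psi>_def split: if_splits)
        qed
        moreover from this[of W] have "m * dist y z \<le> w"
          using 2 \<phi>(3)[of W] unfolding w_def by (intro mult_right_mono) auto
        ultimately have "m * dist (\<phi> s) y \<le> W - s + \<kappa>" "m * dist y z \<le> w"
          using \<phi>_speed[of s W m] st m(1) 2 \<phi>(3)[of W] by auto
        moreover have "m * dist (\<phi> s) z \<le> m * (dist (\<phi> s) y + dist y z)"
          using m(1) by (intro mult_left_mono dist_triangle)
        ultimately have "m * dist (\<phi> s) z \<le> W + w - s + \<kappa>" by (simp add: distrib_left)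
        then show ?thesis using 2 w0 by (simp add: \<psi>_def)
      next
        case 3
        then have "\<psi> s = y" "\<psi> t = z" using \<phi>(3) by (auto simp: \<psi>_def)
        moreover have "m \<le> g y" using m(2) st calculation by force
        then have "m * dist y z \<le> w" unfolding w_def by (intro mult_right_mono) auto
        ultimately show ?thesis using st w by simp
      next
        case 4
        then show ?thesis using st \<kappa> by (simp add: \<psi>_def)
      qed
    qed
    moreover have "\<psi> 0 = x" using \<phi>(2) W w0 by (simp add: \<psi>_def)
    moreover have "\<psi> r \<in> Q" for r using \<phi>(1) chain_step.hyps by (simp add: \<psi>_def)
    ultimately show ?thesis
      by (intro exI[of _ \<psi>]) (auto simp: \<psi>_def w_def)
  qed
qed

text \<open>The chains for \<open>g n\<close> become maps on a time interval of length
  \<open>c\<close> whose jumps cost at most 1/(n+1). The lower bound \<open>\<eta>\<close> on the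
  weights makes a pointwise cluster point Lipschitz, and monotonicity in \<open>n\<close> lets it
  inherit the speed bound of every \<open>g k\<close>.\<close>

lemma short_chains_limit_curve:
  fixes Q :: "'a::metric_space set" and g :: "nat \<Rightarrow> 'a \<Rightarrow> real"
  assumes Q: "compact Q" and EF: "closed E" "closed F" and c: "0 \<le> c" and \<eta>: "0 < \<eta>"
    and g: "\<And>n. continuous_on UNIV (g n)" "\<And>n x. \<eta> \<le> g n x" "\<And>x. incseq (\<lambda>n. g n x)"
    and short: "\<And>n \<delta>. 0 < \<delta> \<Longrightarrow> \<not> chains_long Q \<delta> (g n) E F c"
  obtains \<gamma> where "continuous_on {0..c} \<gamma>" "\<gamma> ` {0..c} \<subseteq> Q" "\<gamma> 0 \<in> E" "\<gamma> c \<in> F" "curve_length 0 c \<gamma> < \<infinity>"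
    "\<And>\<rho>. (\<And>x. x \<in> Q \<Longrightarrow> \<rho> x \<le> (SUP n. ennreal (g n x))) \<Longrightarrow> line_integral \<rho> 0 c \<gamma> \<le> ennreal c"
proof -
  have gpos: "0 < g n x" for n x using g(2)[of n x] \<eta> by linarith
  have "\<exists>\<phi>. (\<forall>r. \<phi> r \<in> Q) \<and> \<phi> 0 \<in> E \<and> \<phi> c \<in> F \<and>
      (\<forall>s t m. 0 \<le> s \<longrightarrow> s \<le> t \<longrightarrow> 0 \<le> m \<longrightarrow> (\<forall>r\<in>{s..t}. m \<le> g n (\<phi> r)) \<longrightarrow>
        m * dist (\<phi> s) (\<phi> t) \<le> t - s + 1 / real (Suc n))" for n
  proof -
    have "compact (g n ` Q)"
      using Q g(1) by (auto intro!: compact_continuous_image intro: continuous_on_subset)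
    then obtain M' where M': "\<And>x. x \<in> Q \<Longrightarrow> \<bar>g n x\<bar> \<le> M'"
      unfolding compact_eq_bounded_closed bounded_iff by auto
    define M where "M = max 1 M'"
    \<comment> \<open>With \<open>M\<close> bounding the weight on \<open>Q\<close>, a single step
      of the chain has weight at most 1/(n+1).\<close>
    define \<delta> where "\<delta> = 1 / (real (Suc n) * M)"
    have M: "0 < M" "\<And>x. x \<in> Q \<Longrightarrow> g n x \<le> M" using M' by (auto simp: M_def max_def) fastforce+
    have \<delta>: "0 < \<delta>" using M by (simp add: \<delta>_def)
    have g\<delta>: "g n x * \<delta> \<le> 1 / real (Suc n)" if "x \<in> Q" for x
    proof -
      have "g n x * \<delta> \<le> M * \<delta>" using M that \<delta> by (intro mult_right_mono) auto
      also have "\<dots> = 1 / real (Suc n)" using M by (simp add: \<delta>_def)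
      finally show ?thesis .
    qed
    obtain x y W where ch: "x \<in> E" "y \<in> F" "chain Q \<delta> (g n) x W y" "W < c"
      using short[OF \<delta>, of n] by (auto simp: chains_long_def not_le)
    obtain \<phi> where "\<forall>r. \<phi> r \<in> Q" "\<phi> 0 = x" "\<forall>r\<ge>W. \<phi> r = y"
      "\<forall>s t m. 0 \<le> s \<longrightarrow> s \<le> t \<longrightarrow> 0 \<le> m \<longrightarrow> (\<forall>r\<in>{s..t}. m \<le> g n (\<phi> r)) \<longrightarrow>
        m * dist (\<phi> s) (\<phi> t) \<le> t - s + 1 / real (Suc n)"
      using chain_parametrization[OF ch(3) gpos g\<delta>] by auto
    then show ?thesis using ch by (intro exI[of _ \<phi>]) auto
  qed
  then obtain \<phi> where \<phi>: "\<And>n r. \<phi> n r \<in> Q" "\<And>n. \<phi> n 0 \<in> E" "\<And>n. \<phi> n c \<in> F"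
    "\<And>n s t m. 0 \<le> s \<Longrightarrow> s \<le> t \<Longrightarrow> 0 \<le> m \<Longrightarrow> (\<And>r. s \<le> r \<Longrightarrow> r \<le> t \<Longrightarrow> m \<le> g n (\<phi> n r)) \<Longrightarrow>
        m * dist (\<phi> n s) (\<phi> n t) \<le> t - s + 1 / real (Suc n)"
    unfolding Ball_def atLeastAtMost_iff by metis
  obtain \<gamma> where \<gamma>: "\<And>r. \<gamma> r \<in> Q"
    "\<And>s t \<epsilon> N. 0 < \<epsilon> \<Longrightarrow> \<exists>n\<ge>N. dist (\<phi> n s) (\<gamma> s) < \<epsilon> \<and> dist (\<phi> n t) (\<gamma> t) < \<epsilon>"
    using pointwise_cluster[of Q \<phi>, OF Q \<phi>(1)] by blast
  have near: "\<exists>n\<ge>N. dist (\<phi> n s) (\<gamma> s) < \<epsilon> \<and> dist (\<phi> n t) (\<gamma> t) < \<epsilon> \<and> 1 / real (Suc n) < \<epsilon>"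
    if "0 < \<epsilon>" for s t \<epsilon> N
  proof -
    obtain n\<^sub>0 where n0: "1 / real (Suc n\<^sub>0) < \<epsilon>" using nat_approx_posE[OF \<open>0 < \<epsilon>\<close>] by blast
    obtain n where n: "n \<ge> max N n\<^sub>0" "dist (\<phi> n s) (\<gamma> s) < \<epsilon>" "dist (\<phi> n t) (\<gamma> t) < \<epsilon>"
      using \<gamma>(2)[OF \<open>0 < \<epsilon>\<close>] by blast
    have "1 / real (Suc n) \<le> 1 / real (Suc n\<^sub>0)" using n(1) by (intro divide_left_mono) auto
    then show ?thesis using n n0 by (intro exI[of _ n]) auto
  qed
  have endpoint: "\<gamma> t \<in> S" if "closed S" "\<And>n. \<phi> n t \<in> S" for t S
  proof -
    have "\<gamma> t \<in> closure S"
      unfolding closure_approachable using near[of _ 0 t t] that(2) by blast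
    then show ?thesis using that(1) by simp
  qed
  \<comment> \<open>The speed bound with the constant lower bound \<open>\<eta>\<close>; it yields
    the Lipschitz constant of the limit and confines the approximating maps in the estimate of
    \<open>speed\<close>.\<close>
  have coarse: "\<eta> * dist (\<phi> n s) (\<phi> n t) \<le> t - s + 1 / real (Suc n)" if "0 \<le> s" "s \<le> t" for n s t
    using that \<eta> g(2) by (intro \<phi>(4)) auto
  have lip: "dist (\<gamma> s) (\<gamma> t) \<le> 1 / \<eta> * (t - s)" if st: "0 \<le> s" "s \<le> t" for s t
  proof -
    have "\<eta> * dist (\<gamma> s) (\<gamma> t) \<le> t - s + e" if e: "0 < e" for e
    proof -
      define \<epsilon> where "\<epsilon> = e / (2 * \<eta> + 1)"
      have \<epsilon>: "0 < \<epsilon>" "(2 * \<eta> + 1) * \<epsilon> = e" using e \<eta> by (auto simp: \<epsilon>_def)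
      obtain n where n: "dist (\<phi> n s) (\<gamma> s) < \<epsilon>" "dist (\<phi> n t) (\<gamma> t) < \<epsilon>" "1 / real (Suc n) < \<epsilon>"
        using near[OF \<epsilon>(1)] by blast
      have "dist (\<gamma> s) (\<gamma> t) \<le> dist (\<phi> n s) (\<phi> n t) + 2 * \<epsilon>"
        using n dist_triangle[of "\<gamma> s" "\<gamma> t" "\<phi> n s"] dist_triangle[of "\<phi> n s" "\<gamma> t" "\<phi> n t"]
        by (simp add: dist_commute)
      then have "\<eta> * dist (\<gamma> s) (\<gamma> t) \<le> \<eta> * (dist (\<phi> n s) (\<phi> n t) + 2 * \<epsilon>)"
        using \<eta> by (intro mult_left_mono) auto
      also have "\<dots> \<le> t - s + \<epsilon> + \<eta> * (2 * \<epsilon>)"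
        using coarse[OF st, of n] n(3) by (simp add: distrib_left)
      also have "\<dots> = t - s + e" using \<epsilon>(2) by (simp add: algebra_simps)
      finally show ?thesis .
    qed
    then have "\<eta> * dist (\<gamma> s) (\<gamma> t) \<le> t - s" by (rule field_le_epsilon)
    then show ?thesis using \<eta> by (simp add: field_simps)
  qed
  have speed: "\<exists>\<tau>>0. \<forall>s t. 0 \<le> s \<longrightarrow> s \<le> t \<longrightarrow> t \<le> c \<longrightarrow> t - s \<le> \<tau> \<longrightarrow>
      g k (\<gamma> s) * dist (\<gamma> s) (\<gamma> t) \<le> (1 + e) * (t - s)" if e: "0 < e" for k e
  proof -
    have "uniformly_continuous_on Q (g k)"
      using Q g(1) by (intro compact_uniformly_continuous) (auto intro: continuous_on_subset)
    then obtain d where d: "0 < d" "\<And>x y. x \<in> Q \<Longrightarrow> y \<in> Q \<Longrightarrow> dist y x < d \<Longrightarrow> \<bar>g k y - g k x\<bar> < e * \<eta>"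
      using e \<eta> unfolding uniformly_continuous_on_def dist_real_def by (metis mult_pos_pos)
    have "g k (\<gamma> s) * dist (\<gamma> s) (\<gamma> t) \<le> (1 + e) * (t - s)"
      if st: "0 \<le> s" "s \<le> t" "t \<le> c" "t - s \<le> d * \<eta> / 4" for s t
    proof -
      \<comment> \<open>Lowering the weight at \<open>\<gamma> s\<close> by
        \<open>e * \<eta>\<close> gives a lower bound on the whole \<open>d\<close>-ball around it
        within \<open>Q\<close>. The amount removed costs at most \<open>e * (t - s)\<close>,
        because the limit is Lipschitz with constant 1/\<eta>.\<close>
      define m where "m = g k (\<gamma> s) - e * \<eta>"
      have "m * dist (\<gamma> s) (\<gamma> t) \<le> t - s"
      proof (cases "0 \<le> m")
        case True
        show ?thesis
        proof (rule field_le_epsilon)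
          fix e' :: real assume e': "0 < e'"
          \<comment> \<open>The last two bounds keep \<open>\<phi> n r\<close> within
            \<open>d\<close> of \<open>\<gamma> s\<close>: at most d/2 from the movement since time
            s and at most d/4 from the approximation. The first bound makes the total error
            \<open>(2 * m + 1) * \<epsilon>\<close> at most \<open>e'\<close>.\<close>
          define \<epsilon> where "\<epsilon> = min (e' / (2 * m + 1)) (min (d / 4) (d * \<eta> / 4))"
          have \<epsilon>: "0 < \<epsilon>" "\<epsilon> \<le> e' / (2 * m + 1)" "\<epsilon> \<le> d / 4" "\<epsilon> \<le> d * \<eta> / 4"
            using e' True d(1) \<eta> by (auto simp: \<epsilon>_def simp del: divide_le_eq_numeral1 le_divide_eq_numeral1)
          have \<epsilon>m: "(2 * m + 1) * \<epsilon> \<le> e'" using \<epsilon>(2) True by (simp add: field_simps)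
          obtain n where n: "n \<ge> k" "dist (\<phi> n s) (\<gamma> s) < \<epsilon>" "dist (\<phi> n t) (\<gamma> t) < \<epsilon>" "1 / real (Suc n) < \<epsilon>"
            using near[OF \<epsilon>(1)] by blast
          have "m \<le> g n (\<phi> n r)" if r: "s \<le> r" "r \<le> t" for r
          proof -
            have "\<eta> * dist (\<phi> n s) (\<phi> n r) \<le> r - s + 1 / real (Suc n)" using st r by (intro coarse) auto
            also have "\<dots> \<le> d * \<eta> / 2" using r st n(4) \<epsilon>(4) by linarith
            finally have "dist (\<phi> n s) (\<phi> n r) \<le> d / 2" using \<eta> by (simp add: field_simps)
            then have "dist (\<phi> n r) (\<gamma> s) < d"
              using n(2) \<epsilon>(3) d(1) dist_triangle[of "\<phi> n r" "\<gamma> s" "\<phi> n s"] by (simp add: dist_commute)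
            then have "m \<le> g k (\<phi> n r)" using d(2)[OF \<gamma>(1) \<phi>(1)] by (fastforce simp: m_def)
            also have "\<dots> \<le> g n (\<phi> n r)" using incseqD[OF g(3) n(1)] .
            finally show ?thesis .
          qed
          then have "m * dist (\<phi> n s) (\<phi> n t) \<le> t - s + 1 / real (Suc n)"
            using st True by (intro \<phi>(4)) auto
          moreover have "dist (\<gamma> s) (\<gamma> t) \<le> dist (\<phi> n s) (\<phi> n t) + 2 * \<epsilon>"
            using n dist_triangle[of "\<gamma> s" "\<gamma> t" "\<phi> n s"] dist_triangle[of "\<phi> n s" "\<gamma> t" "\<phi> n t"]
            by (simp add: dist_commute)
          then have "m * dist (\<gamma> s) (\<gamma> t) \<le> m * (dist (\<phi> n s) (\<phi> n t) + 2 * \<epsilon>)"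
            using True by (intro mult_left_mono) auto
          ultimately have "m * dist (\<gamma> s) (\<gamma> t) \<le> t - s + (2 * m + 1) * \<epsilon>"
            using n(4) by (simp add: algebra_simps)
          then show "m * dist (\<gamma> s) (\<gamma> t) \<le> t - s + e'" using \<epsilon>m by linarith
        qed
      next
        case False
        then have "m * dist (\<gamma> s) (\<gamma> t) \<le> 0" by (intro mult_nonpos_nonneg) auto
        then show ?thesis using st by linarith
      qed
      moreover have "\<eta> * dist (\<gamma> s) (\<gamma> t) \<le> t - s" using lip[OF st(1,2)] \<eta> by (simp add: field_simps)
      then have "e * (\<eta> * dist (\<gamma> s) (\<gamma> t)) \<le> e * (t - s)" using e by (intro mult_left_mono) auto
      ultimately show ?thesis by (simp add: m_def algebra_simps)
    qed
    then show ?thesis using d(1) \<eta> by (intro exI[of _ "d * \<eta> / 4"]) auto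
  qed
  have g0: "0 \<le> g n x" for n x using gpos by (rule less_imp_le)
  note integral = line_integral_SUP_le[OF c _ _ g(1) g0 g(3) speed, of "1 / \<eta>"]
  show ?thesis
  proof (rule that[of \<gamma>])
    show "\<gamma> ` {0..c} \<subseteq> Q" using \<gamma>(1) by auto
    show "\<gamma> 0 \<in> E" "\<gamma> c \<in> F" using endpoint EF \<phi>(2,3) by auto
    show "line_integral \<rho> 0 c \<gamma> \<le> ennreal c" if "\<And>x. x \<in> Q \<Longrightarrow> \<rho> x \<le> (SUP n. ennreal (g n x))" for \<rho>
      by (rule integral(1)) (use \<eta> lip that \<gamma>(1) in auto)
    show "curve_length 0 c \<gamma> < \<infinity>"
      by (rule integral(2)[of "\<lambda>_. 0"]) (use \<eta> lip in auto)
    have "dist (\<gamma> x) (\<gamma> y) \<le> 1 / \<eta> * dist x y" if "x \<in> {0..c}" "y \<in> {0..c}" for x y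
      using lip[of x y] lip[of y x] that by (cases "x \<le> y") (auto simp: dist_real_def dist_commute)
    then have "(1 / \<eta>)-lipschitz_on {0..c} \<gamma>" using \<eta> by (intro lipschitz_onI) auto
    then show "continuous_on {0..c} \<gamma>" by (rule lipschitz_on_continuous_on)
  qed
qed

section \<open>Discrete modulus and duality\<close>

text \<open>An upper bound for the discrete modulus, stated through a witness: only bounds strictly
  above a modulus are ever transferred, and they need no infimum. Positivity of \<open>v\<close>
  allows dividing by it in Hoelder's inequality.\<close>

definition chain_modulus_le :: "real \<Rightarrow> 'a::metric_space set \<Rightarrow> 'a set \<Rightarrow> 'a set \<Rightarrow> real \<Rightarrow> bool" where
  "chain_modulus_le r Q E F v \<longleftrightarrow> 0 < v \<and> (\<exists>g \<delta>. continuous_on UNIV g \<and> (\<forall>x. 0 \<le> g x) \<and> 0 < \<delta> \<and>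
     chains_long Q \<delta> g E F 1 \<and> (\<integral>\<^sup>+x. ennreal (g x powr r) \<partial>hausdorff2_on Q) \<le> ennreal v)"

lemma chain_const: "chain Q \<delta> (\<lambda>_. k) x W y \<Longrightarrow> 0 \<le> k \<Longrightarrow> k * dist x y \<le> W"
proof (induction rule: chain.induct)
  case (chain_step W y z)
  have "k * dist x z \<le> k * (dist x y + dist y z)"
    using chain_step.prems by (intro mult_left_mono dist_triangle)
  then show ?case using chain_step.IH chain_step.prems by (simp add: distrib_left)
qed simp

lemma chain_scale: "chain Q \<delta> (\<lambda>x. g x / c) x W y \<Longrightarrow> c \<noteq> 0 \<Longrightarrow> chain Q \<delta> g x (W * c) y"
proof (induction rule: chain.induct)
  case (chain_step W y z)
  have "chain Q \<delta> g x (W * c + g y * dist y z) z"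
    using chain_step by (intro chain.chain_step) auto
  moreover have "W * c + g y * dist y z = (W + g y / c * dist y z) * c"
    using chain_step.prems by (simp add: distrib_right)
  ultimately show ?case by simp
qed (simp add: chain_refl)

text \<open>A constant weight suffices, the reciprocal of a positive lower bound for the distance of
  the two sets. Finite bounds of this kind later exclude that the modulus of the other family is
  zero; the summand 1 in \<open>v\<close> makes it positive.\<close>

lemma chain_modulus_finite:
  assumes fin: "finite_measure (hausdorff2_on Q)" and E: "compact E" and F: "closed F" and disj: "E \<inter> F = {}"
    and r: "1 < r"
  obtains v where "chain_modulus_le r Q E F v"
proof -
  interpret finite_measure "hausdorff2_on Q" by fact
  obtain d where d: "0 < d" "\<And>x y. x \<in> E \<Longrightarrow> y \<in> F \<Longrightarrow> d \<le> dist x y"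
  proof (cases "E = {} \<or> F = {}")
    case True
    then show ?thesis by (intro that[of 1]) auto
  next
    case False
    have "continuous_on E (\<lambda>x. infdist x F)" by (intro continuous_intros)
    then obtain x where x: "x \<in> E" "\<And>y. y \<in> E \<Longrightarrow> infdist x F \<le> infdist y F"
      using continuous_attains_inf[OF E] False by blast
    then have "0 < infdist x F" using F False disj by (intro infdist_pos_not_in_closed) auto
    then show ?thesis using x(2) by (intro that[of "infdist x F"]) (auto intro: order_trans infdist_le)
  qed
  define v where "v = (1 / d) powr r * measure (hausdorff2_on Q) UNIV + 1"
  have "chains_long Q 1 (\<lambda>_. 1 / d) E F 1"
    unfolding chains_long_def
  proof (intro ballI allI impI)
    fix x y W assume *: "x \<in> E" "y \<in> F" "chain Q 1 (\<lambda>_. 1 / d) x W y"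
    have "1 = 1 / d * d" using d(1) by simp
    also have "\<dots> \<le> 1 / d * dist x y" using d * by (intro mult_left_mono) auto
    also have "\<dots> \<le> W" using chain_const[OF *(3)] d(1) by simp
    finally show "1 \<le> W" .
  qed
  moreover have "(\<integral>\<^sup>+x. ennreal ((1 / d) powr r) \<partial>hausdorff2_on Q) \<le> ennreal v"
    by (simp add: emeasure_eq_measure ennreal_mult'[symmetric] v_def)
  moreover have "0 < v" unfolding v_def by (simp add: add_nonneg_pos)
  ultimately show ?thesis
    using d(1) by (intro that[of v]) (auto simp: chain_modulus_le_def intro!: exI[of _ "\<lambda>_. 1 / d"] exI[of _ 1])
qed

text \<open>The majorants are taken for the power of \<open>\<rho>\<close>, where the integral is
  controlled, and roots are taken afterwards. If none of the resulting weights kept chains longer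
  than some \<open>c\<close> < 1 at any scale, a limit curve would contradict admissibility;
  otherwise dividing by \<open>c\<close> restores the threshold 1.\<close>

lemma chain_modulus_admissible:
  fixes Q :: "'a::metric_space set"
  assumes Q: "compact Q" and fin: "finite_measure (hausdorff2_on Q)" and EF: "closed E" "closed F" and r: "1 < r"
    and \<rho>: "admissible (curves_connecting Q E F) \<rho>"
    and v: "(\<integral>\<^sup>+x. ennreal_powr (\<rho> x) r \<partial>hausdorff2) < ennreal v"
  shows "chain_modulus_le r Q E F v"
proof -
  interpret finite_measure "hausdorff2_on Q" by fact
  let ?M = "hausdorff2_on Q"
  have Qb: "Q \<in> sets borel" using Q by (simp add: compact_imp_closed borel_closed)
  have \<rho>_borel [measurable]: "\<rho> \<in> borel_measurable borel" using \<rho> by (simp add: admissible_def)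
  define f where "f x = ennreal_powr (\<rho> x) r" for x
  have f: "f \<in> borel_measurable borel"
    unfolding f_def ennreal_powr_def by measurable
  have "(\<integral>\<^sup>+x. f x \<partial>?M) \<le> (\<integral>\<^sup>+x. f x \<partial>hausdorff2)"
    unfolding nn_integral_hausdorff2_on[OF Qb f]
    by (intro nn_integral_mono) (auto simp: indicator_def)
  also have "\<dots> < ennreal v" using v by (simp add: f_def)
  finally have f_int: "(\<integral>\<^sup>+x. f x \<partial>?M) < ennreal v" .
  define P where "P = enn2real (\<integral>\<^sup>+x. f x \<partial>?M)"
  have P: "(\<integral>\<^sup>+x. f x \<partial>?M) = ennreal P" "0 \<le> P" "P < v"
  proof -
    show 1: "(\<integral>\<^sup>+x. f x \<partial>?M) = ennreal P"
      using order.strict_trans[OF f_int ennreal_less_top] by (simp add: P_def)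
    show 2: "0 \<le> P" by (simp add: P_def)
    show "P < v" using f_int 2 unfolding 1 by (simp add: ennreal_less_iff)
  qed
  \<comment> \<open>The gap below \<open>v\<close> is split in three: the majorant, the constant
    \<open>\<eta>\<close>, and the room for rescaling by \<open>c\<close>.\<close>
  define e where "e = (v - P) / 3"
  have e: "0 < e" using P by (simp add: e_def)
  define \<eta> where "\<eta> = e / (measure ?M UNIV + 1)"
  have \<eta>: "0 < \<eta>" "\<eta> * measure ?M UNIV \<le> e"
  proof -
    have pos: "0 < measure ?M UNIV + 1" by (simp add: add_nonneg_pos)
    then show 1: "0 < \<eta>" using e by (simp add: \<eta>_def)
    have "\<eta> * measure ?M UNIV \<le> \<eta> * (measure ?M UNIV + 1)" using 1 by (intro mult_left_mono) auto
    also have "\<dots> = e" using pos by (simp add: \<eta>_def)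
    finally show "\<eta> * measure ?M UNIV \<le> e" .
  qed
  obtain g :: "nat \<Rightarrow> 'a \<Rightarrow> real" where g: "\<And>n. continuous_on UNIV (g n)" "\<And>n x. 0 \<le> g n x"
    "\<And>x. incseq (\<lambda>n. g n x)" "\<And>x. f x \<le> (SUP n. ennreal (g n x))"
    "\<And>n. (\<integral>\<^sup>+x. ennreal (g n x) \<partial>?M) \<le> (\<integral>\<^sup>+x. f x \<partial>?M) + ennreal e"
    by (rule vitali_caratheodory[OF fin sets_hausdorff2_on f e]) (rule that; assumption)
  \<comment> \<open>Adding \<open>\<eta>\<close> keeps the weights away from zero, which the limit
    curve needs for its Lipschitz bound.\<close>
  define G where "G n x = (g n x + \<eta>) powr (1 / r)" for n x
  have g\<eta>: "0 < g n x + \<eta>" for n x using g(2)[of n x] \<eta> by linarith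
  have G_powr: "G n x powr r = g n x + \<eta>" for n x
    unfolding G_def using r g\<eta>[of n x] by (simp add: powr_powr)
  have G0: "0 \<le> G n x" for n x by (simp add: G_def)
  have G_cont: "continuous_on UNIV (G n)" for n
    unfolding G_def[abs_def] using g\<eta> by (intro continuous_intros g) (auto simp: less_imp_neq[symmetric])
  have G_low: "\<eta> powr (1 / r) \<le> G n x" for n x
    unfolding G_def using g(2) \<eta> r by (intro powr_mono2) auto
  have G_inc: "incseq (\<lambda>n. G n x)" for x
    unfolding G_def incseq_def using g(2) \<eta> r incseqD[OF g(3)]
    by (auto intro!: powr_mono2 add_nonneg_nonneg less_imp_le[OF \<eta>(1)])
  \<comment> \<open>If the supremum were smaller than \<open>\<rho> x\<close>, it would be a finite
    \<sigma>; taking powers termwise would then bound the power of \<open>\<rho> x\<close> by that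
    of \<sigma>. The case of infinite \<open>\<rho> x\<close> is included.\<close>
  have G_SUP: "\<rho> x \<le> (SUP n. ennreal (G n x))" for x
  proof (rule ccontr)
    assume "\<not> ?thesis"
    then have less: "(SUP n. ennreal (G n x)) < \<rho> x" by simp
    then obtain \<sigma> where \<sigma>: "(SUP n. ennreal (G n x)) = ennreal \<sigma>" "0 \<le> \<sigma>"
      by (cases "SUP n. ennreal (G n x)") auto
    have "ennreal (g n x) \<le> ennreal (\<sigma> powr r)" for n
    proof -
      have "ennreal (G n x) \<le> ennreal \<sigma>" unfolding \<sigma>(1)[symmetric] by (rule SUP_upper) simp
      then have "G n x \<le> \<sigma>" using \<sigma>(2) by simp
      then have "G n x powr r \<le> \<sigma> powr r" using G0 r by (intro powr_mono2) auto
      then show ?thesis using \<eta> by (intro ennreal_leI) (simp add: G_powr)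
    qed
    then have "f x \<le> ennreal (\<sigma> powr r)" using g(4)[of x] by (meson SUP_least order_trans)
    moreover have "ennreal (\<sigma> powr r) < f x"
    proof (cases "\<rho> x")
      case (real s)
      then have "\<sigma> < s" using less \<sigma> by (simp add: ennreal_less_iff)
      then have "\<sigma> powr r < s powr r" using \<sigma>(2) r by (intro powr_less_mono2) auto
      then show ?thesis using real by (simp add: f_def ennreal_powr_def ennreal_less_iff)
    qed (simp add: f_def ennreal_powr_def)
    ultimately show False by simp
  qed
  define v' where "v' = P + 2 * e"
  have v': "0 < v'" "v' < v"
  proof -
    show "0 < v'" using P(2) e by (simp add: v'_def)
    have "v' = v - e" by (simp add: v'_def e_def field_simps)
    with e show "v' < v" by simp
  qed
  \<comment> \<open>Division of the weight by \<open>c\<close> multiplies the integral of its power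
    by \<open>v / v'\<close>, which turns the bound \<open>v'\<close> into \<open>v\<close>.\<close>
  define c where "c = (v' / v) powr (1 / r)"
  have c: "0 < c" "c < 1" "c powr r = v' / v"
  proof -
    show "0 < c" using v' by (simp add: c_def)
    show "c powr r = v' / v" unfolding c_def using v' r by (simp add: powr_powr)
    have "(v' / v) powr (1 / r) < 1 powr (1 / r)" using v' r by (intro powr_less_mono2) auto
    then show "c < 1" by (simp add: c_def)
  qed
  have "\<exists>n \<delta>. 0 < \<delta> \<and> chains_long Q \<delta> (G n) E F c"
  proof (rule ccontr)
    assume "\<not> ?thesis"
    then have short: "\<And>n \<delta>. 0 < \<delta> \<Longrightarrow> \<not> chains_long Q \<delta> (G n) E F c" by blast
    have \<eta>': "0 < \<eta> powr (1 / r)" using \<eta> by simp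
    show False
    proof (rule short_chains_limit_curve[OF Q EF less_imp_le[OF c(1)] \<eta>' G_cont G_low G_inc])
      show "\<not> chains_long Q \<delta> (G n) E F c" if "0 < \<delta>" for n \<delta> using short that by blast
    next
      fix \<gamma> assume \<gamma>: "continuous_on {0..c} \<gamma>" "\<gamma> ` {0..c} \<subseteq> Q" "\<gamma> 0 \<in> E" "\<gamma> c \<in> F" "curve_length 0 c \<gamma> < \<infinity>"
        and int: "\<And>\<rho>. (\<And>x. x \<in> Q \<Longrightarrow> \<rho> x \<le> (SUP n. ennreal (G n x))) \<Longrightarrow> line_integral \<rho> 0 c \<gamma> \<le> ennreal c"
      have "(0, c, \<gamma>) \<in> curves_connecting Q E F"
        using \<gamma> c by (auto simp: curves_connecting_def)
      then have "1 \<le> line_integral \<rho> 0 c \<gamma>" using \<rho> \<gamma>(5) by (auto simp: admissible_def)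
      also have "\<dots> \<le> ennreal c" by (rule int) (rule G_SUP)
      finally have "ennreal 1 \<le> ennreal c" by simp
      then show False using c by (simp only: ennreal_le_iff less_imp_le)
    qed
  qed
  then obtain n \<delta> where \<delta>: "0 < \<delta>" "chains_long Q \<delta> (G n) E F c" by blast
  have "chains_long Q \<delta> (\<lambda>x. G n x / c) E F 1"
    unfolding chains_long_def
  proof (intro ballI allI impI)
    fix x y W assume "x \<in> E" "y \<in> F" "chain Q \<delta> (\<lambda>x. G n x / c) x W y"
    then have "c \<le> W * c" using \<delta>(2) chain_scale c(1) unfolding chains_long_def by blast
    then show "1 \<le> W" using c(1) by simp
  qed
  moreover have "(\<integral>\<^sup>+x. ennreal ((G n x / c) powr r) \<partial>?M) \<le> ennreal v"
  proof -
    have "(\<integral>\<^sup>+x. ennreal ((G n x / c) powr r) \<partial>?M) = (\<integral>\<^sup>+x. ennreal (v / v') * (ennreal (g n x) + ennreal \<eta>) \<partial>?M)"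
    proof (rule nn_integral_cong)
      fix x
      have "(G n x / c) powr r = v / v' * (g n x + \<eta>)"
        using c G0 by (simp add: powr_divide G_powr)
      then have "ennreal ((G n x / c) powr r) = ennreal (v / v') * ennreal (g n x + \<eta>)"
        using v' g\<eta>[of n x] by (simp only: ennreal_mult less_imp_le divide_nonneg_pos less_trans[OF v'])
      also have "ennreal (g n x + \<eta>) = ennreal (g n x) + ennreal \<eta>"
        using g(2) \<eta>(1) by (intro ennreal_plus) auto
      finally show "ennreal ((G n x / c) powr r) = ennreal (v / v') * (ennreal (g n x) + ennreal \<eta>)" .
    qed
    also have "\<dots> = ennreal (v / v') * ((\<integral>\<^sup>+x. ennreal (g n x) \<partial>?M) + ennreal (\<eta> * measure ?M UNIV))"
      using borel_measurable_continuous_onI[OF g(1)[of n]] \<eta>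
      by (simp add: nn_integral_cmult nn_integral_add emeasure_eq_measure ennreal_mult')
    also have "\<dots> \<le> ennreal (v / v') * ((ennreal P + ennreal e) + ennreal e)"
      using g(5)[of n] \<eta>(2) unfolding P(1) by (intro mult_left_mono add_mono ennreal_leI) auto
    also have "(ennreal P + ennreal e) + ennreal e = ennreal v'"
      using P e by (simp add: ennreal_plus[symmetric] v'_def del: ennreal_plus)
    also have "ennreal (v / v') * ennreal v' = ennreal (v / v' * v')"
      by (rule ennreal_mult''[symmetric]) (use v' in simp)
    finally show ?thesis using v' by simp
  qed
  moreover have "continuous_on UNIV (\<lambda>x. G n x / c)" using c(1) by (intro continuous_intros G_cont) auto
  moreover have "0 \<le> G n x / c" for x using G0 c(1) by simp
  ultimately show ?thesis using v' \<delta>(1) unfolding chain_modulus_le_def by fastforce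
qed

text \<open>Long chains stay long at finer scales, so both weights can be used at the smaller of
  their two scales; the length-area inequality and Hoelder's inequality then combine.\<close>

lemma chain_modulus_duality:
  fixes h :: "real \<times> real \<Rightarrow> 'a::metric_space"
  assumes h: "continuous_on ({0..1} \<times> {0..1}) h" "h ` ({0..1} \<times> {0..1}) = Q"
    and fin: "finite_measure (hausdorff2_on Q)"
    and pq: "1 < p" "1 < q" "1 / p + 1 / q = 1"
    and v: "chain_modulus_le p Q (h ` ({0} \<times> {0..1})) (h ` ({1} \<times> {0..1})) v"
    and w: "chain_modulus_le q Q (h ` ({0..1} \<times> {0})) (h ` ({0..1} \<times> {1})) w"
  shows "pi / 4 \<le> v powr (1 / p) * w powr (1 / q)"
proof -
  obtain f \<delta>\<^sub>1 where f: "continuous_on UNIV f" "\<And>x. 0 \<le> f x" "0 < \<delta>\<^sub>1"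
    "chains_long Q \<delta>\<^sub>1 f (h ` ({0} \<times> {0..1})) (h ` ({1} \<times> {0..1})) 1"
    "(\<integral>\<^sup>+x. ennreal (f x powr p) \<partial>hausdorff2_on Q) \<le> ennreal v" "0 < v"
    using v unfolding chain_modulus_le_def by blast
  obtain g \<delta>\<^sub>2 where g: "continuous_on UNIV g" "\<And>x. 0 \<le> g x" "0 < \<delta>\<^sub>2"
    "chains_long Q \<delta>\<^sub>2 g (h ` ({0..1} \<times> {0})) (h ` ({0..1} \<times> {1})) 1"
    "(\<integral>\<^sup>+x. ennreal (g x powr q) \<partial>hausdorff2_on Q) \<le> ennreal w" "0 < w"
    using w unfolding chain_modulus_le_def by blast
  have "ennreal (pi / 4) \<le> (\<integral>\<^sup>+x. ennreal (f x * g x) \<partial>hausdorff2_on Q)"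
    by (rule length_area[OF h fin f(1) g(1) f(2) g(2), of "min \<delta>\<^sub>1 \<delta>\<^sub>2"])
      (use f(3) g(3) chains_long_antimono[OF f(4)] chains_long_antimono[OF g(4)] in auto)
  also have "\<dots> \<le> ennreal (v powr (1 / p) * w powr (1 / q))"
    by (rule nn_integral_Holder[OF pq _ _ f(2) g(2) f(6) g(6) f(5) g(5)])
      (use borel_measurable_continuous_onI[OF f(1)] borel_measurable_continuous_onI[OF g(1)] in measurable)
  finally show ?thesis by (simp add: ennreal_le_iff)
qed

section \<open>Positivity of the moduli and the final inequality\<close>

lemma powr_positive_infimum:
  fixes K V s :: real
  assumes K: "0 < K" and V: "0 < V" and s: "0 < s" and le: "\<And>w. 0 < w \<Longrightarrow> K \<le> V * w powr s"
  shows False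
proof -
  \<comment> \<open>The witness is chosen such that the right side becomes half of
    \<open>K\<close>.\<close>
  have "K \<le> V * ((K / (2 * V)) powr (1 / s)) powr s" using K V by (intro le) auto
  also have "\<dots> = K / 2" using K V s by (simp add: powr_powr)
  finally show False using K by simp
qed

theorem corollary1p2:
  fixes p q :: real
    and Q A B C D :: "'a::metric_space set"
    and h :: "real \<times> real \<Rightarrow> 'a" and k :: "'a \<Rightarrow> real \<times> real"
  assumes "(UNIV :: 'a set) homeomorphic (UNIV :: (real \<times> real) set)"
    and "locally_finite_measure (hausdorff2 :: 'a measure)"
    and "1 < p" and "1 < q" and "1 / p + 1 / q = 1"
    and "homeomorphism ({0..1} \<times> {0..1}) Q h k"
    and "A = h ` ({0} \<times> {0..1})"
    and "B = h ` ({0..1} \<times> {0})"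
    and "C = h ` ({1} \<times> {0..1})"
    and "D = h ` ({0..1} \<times> {1})"
  shows "ennreal_powr (modulus p (curves_connecting Q A C)) (1 / p) *
         ennreal_powr (modulus q (curves_connecting Q B D)) (1 / q) \<ge> ennreal (pi / 4)"
proof -
  let ?S = "{0..1::real} \<times> {0..1::real}"
  define a where "a = modulus p (curves_connecting Q A C)"
  define b where "b = modulus q (curves_connecting Q B D)"
  have h: "continuous_on ?S h" "h ` ?S = Q" "inj_on h ?S"
    using assms(6) by (auto simp: homeomorphism_def intro: inj_on_inverseI)
  have Q: "compact Q" using h(1) unfolding h(2)[symmetric] by (intro compact_continuous_image compact_Times) auto
  have sub: "{0} \<times> {0..1} \<subseteq> ?S" "{1} \<times> {0..1} \<subseteq> ?S" "{0..1} \<times> {0} \<subseteq> ?S" "{0..1} \<times> {1} \<subseteq> ?S" by auto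
  have cpt: "compact A" "compact B" "compact C" "compact D"
    unfolding assms(7-10) using sub h(1)
    by (auto intro!: compact_continuous_image compact_Times intro: continuous_on_subset)
  have disj: "A \<inter> C = {}" "B \<inter> D = {}"
    unfolding assms(7-10) using sub
    by (auto simp: inj_on_image_Int[OF h(3), symmetric])
  have fin: "finite_measure (hausdorff2_on Q)" by (rule hausdorff2_on_finite[OF assms(2) Q])
  note closed = cpt[THEN compact_imp_closed]
  have av: "chain_modulus_le p Q A C v" if "a < ennreal v" for v
    using that chain_modulus_admissible[OF Q fin closed(1,3) assms(3)]
    by (auto simp: a_def modulus_def INF_less_iff)
  have bw: "chain_modulus_le q Q B D w" if "b < ennreal w" for w
    using that chain_modulus_admissible[OF Q fin closed(2,4) assms(4)]
    by (auto simp: b_def modulus_def INF_less_iff)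
  have dual: "pi / 4 \<le> v powr (1 / p) * w powr (1 / q)"
    if "chain_modulus_le p Q A C v" "chain_modulus_le q Q B D w" for v w
    using chain_modulus_duality[OF h(1,2) fin assms(3-5)] that unfolding assms(7-10) by blast
  obtain v\<^sub>0 where v0: "chain_modulus_le p Q A C v\<^sub>0"
    using chain_modulus_finite[OF fin cpt(1) closed(3) disj(1) assms(3)] by blast
  obtain w\<^sub>0 where w0: "chain_modulus_le q Q B D w\<^sub>0"
    using chain_modulus_finite[OF fin cpt(2) closed(4) disj(2) assms(4)] by blast
  have pos: "0 < v\<^sub>0" "0 < w\<^sub>0" using v0 w0 by (auto simp: chain_modulus_le_def)
  \<comment> \<open>If \<open>b\<close> were zero, every positive \<open>w\<close> would bound the
    discrete modulus of the second family, while \<open>v\<^sub>0\<close> stays fixed, so the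
    product in \<open>dual\<close> could be made arbitrarily small.\<close>
  have b0: "b \<noteq> 0"
  proof
    assume "b = 0"
    then have "pi / 4 \<le> v\<^sub>0 powr (1 / p) * w powr (1 / q)" if "0 < w" for w
      using that by (intro dual v0 bw) simp
    then show False
      using powr_positive_infimum[of "pi / 4" "v\<^sub>0 powr (1 / p)" "1 / q"] pos assms(4) by auto
  qed
  have a0: "a \<noteq> 0"
  proof
    assume "a = 0"
    then have "pi / 4 \<le> w\<^sub>0 powr (1 / q) * v powr (1 / p)" if "0 < v" for v
      using that dual[OF av w0] by (simp add: mult.commute)
    then show False
      using powr_positive_infimum[of "pi / 4" "w\<^sub>0 powr (1 / q)" "1 / p"] pos assms(3) by auto
  qed
  have powr0: "ennreal_powr x r \<noteq> 0" if "x \<noteq> 0" for x r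
    using that by (cases x) (auto simp: ennreal_powr_def)
  have "ennreal (pi / 4) \<le> ennreal_powr a (1 / p) * ennreal_powr b (1 / q)"
  proof (cases "a = \<infinity> \<or> b = \<infinity>")
    \<comment> \<open>An infinite factor makes the product infinite only because the other one is
      known to be nonzero.\<close>
    case True
    then show ?thesis
      using powr0[OF a0] powr0[OF b0] by (auto simp: ennreal_powr_def ennreal_mult_eq_top_iff)
  next
    case False
    then obtain a' b' where ab: "a = ennreal a'" "0 \<le> a'" "b = ennreal b'" "0 \<le> b'"
      by (cases a; cases b) auto
    \<comment> \<open>The transfer to chains needs bounds strictly above the moduli, hence the added
      \<open>e\<close>; continuity of the powers at nonnegative arguments allows it to tend to
      0.\<close>
    have "pi / 4 \<le> (a' + e) powr (1 / p) * (b' + e) powr (1 / q)" if "0 < e" for e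
      using that ab by (intro dual av bw) (auto simp: ennreal_less_iff)
    then have "eventually (\<lambda>e. pi / 4 \<le> (a' + e) powr (1 / p) * (b' + e) powr (1 / q)) (at_right 0)"
      by (auto simp: eventually_at_right_field intro: exI[of _ 1])
    moreover have "((\<lambda>e. (x + e) powr r) \<longlongrightarrow> x powr r) (at_right 0)" if "0 \<le> x" "0 < r" for x r :: real
    proof -
      have "((\<lambda>e. x + e) \<longlongrightarrow> x + 0) (at_right 0)" by (intro tendsto_intros)
      moreover have "eventually (\<lambda>e. 0 \<le> x + e) (at_right 0)"
        using that by (auto simp: eventually_at_right_field intro: exI[of _ 1])
      ultimately show ?thesis using that by (intro tendsto_powr') auto
    qed
    then have "((\<lambda>e. (a' + e) powr (1 / p) * (b' + e) powr (1 / q)) \<longlongrightarrow> a' powr (1 / p) * b' powr (1 / q)) (at_right 0)"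
      using ab assms(3,4) by (intro tendsto_mult) auto
    ultimately have "pi / 4 \<le> a' powr (1 / p) * b' powr (1 / q)"
      by (intro tendsto_lowerbound) auto
    then have "ennreal (pi / 4) \<le> ennreal (a' powr (1 / p) * b' powr (1 / q))" by (rule ennreal_leI)
    then show ?thesis using ab by (simp add: ennreal_powr_def ennreal_mult)
  qed
  then show ?thesis by (simp add: a_def b_def)
qed

end
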